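(* Let $s,d\in\mathbb{N}$ with $s>d/2$, let $B\in\mathbb{R}^{d\times d}$ be a Frolov matrix, and let $U$ be a random vector uniformly distributed in $[1,2^{1/d}]^d$. There is a constant $c>0$ (which may depend on $s$, $d$ and $B$) such that for every $n\in\mathbb{N}$, every shift parameter $v\in\mathbb{R}^d$ and every $f\in \mathring{H}^{s}([0,1]^d)$ \[ \mathbb{E}\left|Q_{n^{1/d}\hat{U}B}^v(f)-I_d(f)\right| \leq c\, n^{-s/d-1/2}\, \Vert f\Vert_{H^{s}([0,1]^d)}. \]
   Context: Notation: $\mathbb{N}=\{1,2,\dots\}$ and $I_d(f)=\int_{\mathbb{R}^d} f(x)\,dx$. For an invertible matrix $S\in\mathbb{R}^{d\times d}$ and $v\in\mathbb{R}^d$, the quadrature rule $Q_S^v$ is \[Q_S^v(f)=\frac{1}{|\det S|}\sum_{m\in\mathbb{Z}^d} f\left(S^{-\top}(m+v)\right),\] where $S^{-\top}$ is the transpose of the inverse of $S$. For $u\in\mathbb{R}^d$, $\hat{u}=\mathrm{diag}(u_1,\dots,u_d)$; thus $\hat U$ is the random diagonal matrix with diagonal $U$. The expectation is with respect to $U$. A matrix $B\in\mathbb{R}^{d\times d}$ is a Frolov matrix if: (a) $B$ is invertible; (b) $\left|\prod_{j=1}^d (Bm)_j\right|\geq 1$ for every $m\in\mathbb{Z}^d\setminus\{0\}$; (c) for all $x,y\in\mathbb{R}^d$ the box $[x,y]=\{z\in\mathbb{R}^d : z_j \text{ lies between } x_j \text{ and } y_j \text{ (inclusive) for } j=1,\dots,d\}$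 with volume $V=\prod_{j=1}^d|x_j-y_j|$ contains at most $V+1$ lattice points $Bm$, $m\in\mathbb{Z}^d$. $H^{s}(\mathbb{R}^d)$ is the space of real-valued $f\in L^2(\mathbb{R}^d)$ whose weak derivatives $D^\alpha f$ exist and lie in $L^2(\mathbb{R}^d)$ for all $\alpha\in\mathbb{N}_0^d$ with $|\alpha|=\sum_j\alpha_j\leq s$; since $s>d/2$, its elements are identified with their continuous representatives. $\mathring{H}^{s}([0,1]^d)$ is the subspace of those $f$ with support in $[0,1]^d$. The norm is $\Vert f\Vert_{H^{s}([0,1]^d)}=\left(\sum_{|\alpha|\leq s}\Vert D^\alpha f\Vert_{L^2([0,1]^d)}^2\right)^{1/2}$. *)

theory Defs
  imports "HOL-Probability.Probability"
begin

definition int_vec :: "int ^ 'd \<Rightarrow> real ^ 'd" where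
  "int_vec m = (\<chi> j. of_int (m $ j))"

definition diag_mat :: "real ^ 'd \<Rightarrow> real ^ 'd ^ 'd" where
  "diag_mat u = (\<chi> i j. if i = j then u $ i else 0)"

text \<open>The infinite sum is 0 by convention if it does not converge absolutely; for \<open>f\<close> of compact
  support and \<open>S\<close> invertible only finitely many terms are nonzero.\<close>

definition quadrature :: "real ^ 'd ^ 'd \<Rightarrow> real ^ 'd \<Rightarrow> (real ^ 'd \<Rightarrow> real) \<Rightarrow> real" where
  "quadrature S v f =
     1 / \<bar>det S\<bar> * (\<Sum>\<^sub>\<infinity>m\<in>UNIV. f (transpose (matrix_inv S) *v (int_vec m + v)))"

definition box_between :: "real ^ 'd \<Rightarrow> real ^ 'd \<Rightarrow> (real ^ 'd) set" where
  "box_between x y = {z. \<forall>j. min (x $ j) (y $ j) \<le> z $ j \<and> z $ j \<le> max (x $ j) (y $ j)}"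

definition frolov_matrix :: "real ^ 'd ^ 'd \<Rightarrow> bool" where
  "frolov_matrix B \<longleftrightarrow>
     invertible B \<and>
     (\<forall>m. m \<noteq> 0 \<longrightarrow> \<bar>\<Prod>j\<in>UNIV. (B *v int_vec m) $ j\<bar> \<ge> 1) \<and>
     (\<forall>x y. finite (range (\<lambda>m. B *v int_vec m) \<inter> box_between x y) \<and>
        real (card (range (\<lambda>m. B *v int_vec m) \<inter> box_between x y))
          \<le> (\<Prod>j\<in>UNIV. \<bar>x $ j - y $ j\<bar>) + 1)"

definition partial_deriv :: "'d \<Rightarrow> (real ^ 'd \<Rightarrow> real) \<Rightarrow> real ^ 'd \<Rightarrow> real" where
  "partial_deriv i \<phi> x = frechet_derivative \<phi> (at x) (axis i 1)"

text \<open>Infinitely differentiable: all iterated partial derivatives are differentiable everywhere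
  (and hence continuous).\<close>

definition smooth_fun :: "(real ^ 'd \<Rightarrow> real) \<Rightarrow> bool" where
  "smooth_fun \<phi> \<longleftrightarrow> (\<forall>is x. foldr partial_deriv is \<phi> differentiable (at x))"

definition test_fun :: "(real ^ 'd \<Rightarrow> real) \<Rightarrow> bool" where
  "test_fun \<phi> \<longleftrightarrow> smooth_fun \<phi> \<and> compact (closure {x. \<phi> x \<noteq> 0})"

definition multi_order :: "nat ^ 'd \<Rightarrow> nat" where
  "multi_order \<alpha> = (\<Sum>j\<in>UNIV. \<alpha> $ j)"

text \<open>The coordinate directions are processed in some arbitrary fixed order. This operator is only
  applied to smooth functions, where the order is immaterial.\<close>

definition mixed_partial :: "nat ^ 'd \<Rightarrow> (real ^ 'd \<Rightarrow> real) \<Rightarrow> real ^ 'd \<Rightarrow> real" where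
  "mixed_partial \<alpha> \<phi> =
     foldr (\<lambda>i. partial_deriv i ^^ (\<alpha> $ i)) (SOME is. distinct is \<and> set is = UNIV) \<phi>"

text \<open>Every Lebesgue measurable function agrees almost everywhere with a Borel function, so
  \<^term>\<open>lborel\<close> represents all classes in \<open>L\<^sup>1\<^sub>l\<^sub>o\<^sub>c\<close> and \<open>L\<^sup>2\<close>.\<close>

definition locally_integrable :: "(real ^ 'd \<Rightarrow> real) \<Rightarrow> bool" where
  "locally_integrable f \<longleftrightarrow> (\<forall>K. compact K \<longrightarrow> set_integrable lborel K f)"

definition square_integrable :: "(real ^ 'd \<Rightarrow> real) \<Rightarrow> bool" where
  "square_integrable f \<longleftrightarrow> f \<in> borel_measurable lborel \<and> integrable lborel (\<lambda>x. (f x)\<^sup>2)"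

definition has_weak_deriv :: "(real ^ 'd \<Rightarrow> real) \<Rightarrow> nat ^ 'd \<Rightarrow> (real ^ 'd \<Rightarrow> real) \<Rightarrow> bool" where
  "has_weak_deriv f \<alpha> g \<longleftrightarrow>
     locally_integrable f \<and> locally_integrable g \<and>
     (\<forall>\<phi>. test_fun \<phi> \<longrightarrow>
        (LINT x|lborel. f x * mixed_partial \<alpha> \<phi> x)
          = (-1) ^ multi_order \<alpha> * (LINT x|lborel. g x * \<phi> x))"

text \<open>A representative of the weak derivative \<open>D\<^sup>\<alpha> f\<close>, which is unique up to null sets;
  meaningful if \<open>f\<close> has a weak derivative of this order in \<open>L\<^sup>2\<close>.\<close>

definition weak_deriv :: "nat ^ 'd \<Rightarrow> (real ^ 'd \<Rightarrow> real) \<Rightarrow> real ^ 'd \<Rightarrow> real" where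
  "weak_deriv \<alpha> f = (SOME g. square_integrable g \<and> has_weak_deriv f \<alpha> g)"

definition sobolev :: "nat \<Rightarrow> (real ^ 'd \<Rightarrow> real) set" where
  "sobolev s = {f. square_integrable f \<and>
     (\<forall>\<alpha>. multi_order \<alpha> \<le> s \<longrightarrow> (\<exists>g. square_integrable g \<and> has_weak_deriv f \<alpha> g))}"

abbreviation unit_cube :: "(real ^ 'd) set" where
  "unit_cube \<equiv> cbox 0 (\<chi> j. 1)"

text \<open>Continuity selects the continuous representative, which exists for \<open>s > d/2\<close>.\<close>

definition sobolev0_cube :: "nat \<Rightarrow> (real ^ 'd \<Rightarrow> real) set" where
  "sobolev0_cube s =
     {f \<in> sobolev s. continuous_on UNIV f \<and> closure {x. f x \<noteq> 0} \<subseteq> unit_cube}"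

lemma finite_multi_order_le: "finite {\<alpha> :: nat ^ 'd. multi_order \<alpha> \<le> s}"
proof -
  have "{\<alpha> :: nat ^ 'd. multi_order \<alpha> \<le> s} \<subseteq> vec_lambda ` {f. range f \<subseteq> {..s}}"
  proof
    fix \<alpha> :: "nat ^ 'd"
    assume "\<alpha> \<in> {\<alpha>. multi_order \<alpha> \<le> s}"
    then have "\<alpha> $ j \<le> s" for j
      using member_le_sum[of j UNIV "\<lambda>j. \<alpha> $ j"] by (simp add: multi_order_def)
    then have "vec_nth \<alpha> \<in> {f. range f \<subseteq> {..s}}"
      by auto
    then show "\<alpha> \<in> vec_lambda ` {f. range f \<subseteq> {..s}}"
      by (metis image_eqI vec_nth_inverse)
  qed
  moreover have "finite {f :: 'd \<Rightarrow> nat. range f \<subseteq> {..s}}"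
    using finite_PiE[of "UNIV :: 'd set" "\<lambda>_. {..s}"]
    by (simp add: PiE_UNIV_domain image_subset_iff Pi_def)
  ultimately show ?thesis
    by (meson finite_imageI finite_subset)
qed

definition sobolev_norm :: "nat \<Rightarrow> (real ^ 'd \<Rightarrow> real) \<Rightarrow> real" where
  "sobolev_norm s f =
     sqrt (\<Sum>\<alpha> | multi_order \<alpha> \<le> s. LINT x:unit_cube|lborel. (weak_deriv \<alpha> f x)\<^sup>2)"

definition uniform_on_cube :: "'a measure \<Rightarrow> ('a \<Rightarrow> real ^ 'd) \<Rightarrow> real \<Rightarrow> real \<Rightarrow> bool" where
  "uniform_on_cube M U a b \<longleftrightarrow>
     distributed M lborel U
       (\<lambda>x. indicator (cbox (\<chi> j. a) (\<chi> j. b)) x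
         / measure lborel (cbox (\<chi> j. a) (\<chi> j. b) :: (real ^ 'd) set))"

end

theory Submission
  imports Defs
begin

text \<open>
  Let \<open>S = n\<^bsup>1/d\<^esup> diag(u) B\<close>. By Poisson summation the error of the rule \<open>Q\<^sub>S\<close> is at most the sum
  of \<open>|F f (S m)|\<close> over \<open>m \<noteq> 0\<close>, where \<open>F f\<close> is the Fourier transform. Averaging over \<open>u\<close> smears
  each frequency \<open>n\<^bsup>1/d\<^esup> B m\<close> over a box. Since \<open>B\<close> is a Frolov matrix, these boxes avoid
  \<open>|\<Prod>\<^sub>j x\<^sub>j| < n\<close>, and each point \<open>x\<close> is covered at most \<open>2 |\<Prod>\<^sub>j x\<^sub>j| / n\<close> times, so the expected
  error is at most a multiple of \<open>1/n\<close> times the integral of \<open>|F f|\<close> over \<open>|\<Prod>\<^sub>j x\<^sub>j| \<ge> n\<close>. There some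
  coordinate exceeds \<open>n\<^bsup>1/d\<^esup>\<close>, and the Cauchy--Schwarz inequality gains the factor \<open>n\<^bsup>1/2 - s/d\<^esup>\<close>
  against the \<open>L\<^sup>2\<close> norm of \<open>|x\<^sub>j|\<^sup>s F f\<close>.

  Two general theorems are replaced by elementary substitutes. Only the inequality in Poisson
  summation is needed; it follows by integrating against the trigonometric kernel
  \<open>\<Prod>\<^sub>j cos\<^bsup>2N\<^esup>(\<pi> x\<^sub>j)\<close> (normalised), whose Fourier coefficients lie in \<open>[0, 1]\<close>. Only the
  inequality in Plancherel's theorem is needed, for functions supported in the unit cube; it follows
  by integrating Bessel's inequality for the shifted characters \<open>exp(2 \<pi> i (k + \<theta>) \<cdot> x)\<close> over
  \<open>\<theta>\<close>.
\<close>

section \<open>Linear changes of variables\<close>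

text \<open>The sum of the \<open>|F f (S m)|\<close> is never shown to be finite for a single
  \<open>u\<close>; only its average is bounded. So all estimates live in \<open>ennreal\<close>,
  and integrability of the error drops out at the end. The shift \<open>v\<close> only multiplies
  Fourier coefficients by numbers of modulus 1, whence the uniformity in \<open>v\<close>. The side
  2^(1/d) is chosen so that the product of the coordinates of \<open>u\<close> ranges over [1, 2].
  The Jacobian of the map from \<open>u\<close> to \<open>x\<close> is the product of the |n^(1/d)
  (B m)_j|; it may thus be replaced, at the cost of a factor 2, by the product of the |x_j|. The
  resulting weight no longer depends on \<open>m\<close>, and it cancels exactly against the growing
  number of boxes that cover \<open>x\<close>. The obstacle in the tail estimate is that weak
  derivatives are tested only against real, smooth, compactly supported functions, whereas the
  Fourier transform tests against characters. This is why an explicit class of smooth functions is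
  built, why characters are split into cosines with a free phase, and why a limit of cutoffs
  appears. In the final exponent, -1 comes from the averaging and 1/2 - s/d from the tail.\<close>

lemma borel_measurable_matrix_vector_mult [measurable]:
  fixes A :: "real ^ 'n ^ 'm"
  shows "(*v) A \<in> borel_measurable borel"
  by (intro borel_measurable_continuous_onI matrix_vector_mult_linear_continuous_on)

lemma borel_measurable_vec_nth [measurable]: "(\<lambda>x :: real ^ 'd. x $ i) \<in> borel_measurable borel"
  by (intro borel_measurable_continuous_onI continuous_intros)

lemma borel_measurable_vec_lambda [measurable]:
  fixes f :: "'i::finite \<Rightarrow> 'a \<Rightarrow> real"
  assumes "\<And>i. f i \<in> borel_measurable M"
  shows "(\<lambda>x. \<chi> i. f i x) \<in> borel_measurable M"
  by (subst borel_measurable_euclidean_space) (use assms in \<open>auto simp: Basis_vec_def inner_axis\<close>)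

lemma nn_integral_lborel_translation:
  fixes f :: "'a::euclidean_space \<Rightarrow> ennreal"
  assumes [measurable]: "f \<in> borel_measurable borel"
  shows "(\<integral>\<^sup>+x. f (t + x) \<partial>lborel) = (\<integral>\<^sup>+x. f x \<partial>lborel)"
proof -
  have "(\<integral>\<^sup>+x. f x \<partial>lborel) = (\<integral>\<^sup>+x. f x \<partial>distr lborel borel ((+) t))"
    by (simp add: lborel_distr_plus)
  also have "\<dots> = (\<integral>\<^sup>+x. f (t + x) \<partial>lborel)"
    by (subst nn_integral_distr) auto
  finally show ?thesis ..
qed

text \<open>Smearing the integrand with a window in the direction of the shear turns the shear into a
  one-dimensional translation.\<close>

lemma nn_integral_lborel_shear:
  fixes f :: "real ^ 'd \<Rightarrow> ennreal"
  assumes [measurable]: "f \<in> borel_measurable borel" and "m \<noteq> n"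
  shows "(\<integral>\<^sup>+x. f (x + (c * x $ n) *\<^sub>R axis m 1) \<partial>lborel) = (\<integral>\<^sup>+x. f x \<partial>lborel)"
proof -
  let ?e = "axis m 1 :: real ^ 'd"
  define w :: "real \<Rightarrow> ennreal" where "w = indicator {0..1}"
  have [measurable]: "w \<in> borel_measurable borel"
    by (simp add: w_def)
  have w: "(\<integral>\<^sup>+t. w (a - t) \<partial>lborel) = 1" for a
  proof -
    have "(\<integral>\<^sup>+t. w (a - t) \<partial>lborel) = (\<integral>\<^sup>+t. indicator {a - 1..a} t \<partial>lborel)"
      by (intro nn_integral_cong) (auto simp: w_def indicator_def)
    then show ?thesis by simp
  qed
  have key: "(\<integral>\<^sup>+x. g x \<partial>lborel) = (\<integral>\<^sup>+x. (\<integral>\<^sup>+t. g (t *\<^sub>R ?e + x) \<partial>lborel) * w (x $ m) \<partial>lborel)"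
    if [measurable]: "g \<in> borel_measurable borel" for g :: "real ^ 'd \<Rightarrow> ennreal"
  proof -
    have "(\<integral>\<^sup>+x. g x \<partial>lborel) = (\<integral>\<^sup>+x. (\<integral>\<^sup>+t. g x * w (x $ m - t) \<partial>lborel) \<partial>lborel)"
      by (simp add: nn_integral_cmult w)
    also have "\<dots> = (\<integral>\<^sup>+t. (\<integral>\<^sup>+x. g x * w (x $ m - t) \<partial>lborel) \<partial>lborel)"
      by (subst lborel_pair.Fubini') auto
    also have "\<dots> = (\<integral>\<^sup>+t. (\<integral>\<^sup>+x. g (t *\<^sub>R ?e + x) * w (x $ m) \<partial>lborel) \<partial>lborel)"
    proof (rule nn_integral_cong)
      fix t :: real
      show "(\<integral>\<^sup>+x. g x * w (x $ m - t) \<partial>lborel) = (\<integral>\<^sup>+x. g (t *\<^sub>R ?e + x) * w (x $ m) \<partial>lborel)"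
        using nn_integral_lborel_translation[of "\<lambda>x. g x * w (x $ m - t)" "t *\<^sub>R ?e"] by simp
    qed
    also have "\<dots> = (\<integral>\<^sup>+x. (\<integral>\<^sup>+t. g (t *\<^sub>R ?e + x) * w (x $ m) \<partial>lborel) \<partial>lborel)"
      by (subst lborel_pair.Fubini') auto
    also have "\<dots> = (\<integral>\<^sup>+x. (\<integral>\<^sup>+t. g (t *\<^sub>R ?e + x) \<partial>lborel) * w (x $ m) \<partial>lborel)"
      by (simp add: nn_integral_multc)
    finally show ?thesis .
  qed
  \<comment> \<open>As \<open>m \<noteq> n\<close>, moving along \<open>?e\<close> does not change
    \<open>x $ n\<close>. In the inner integral of \<open>key\<close> the shear is therefore the
    constant shift \<open>c * x $ n\<close> of \<open>t\<close>, and the window sees only the outer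
    \<open>x\<close>.\<close>
  have "(\<integral>\<^sup>+t. f ((t *\<^sub>R ?e + x) + (c * (t *\<^sub>R ?e + x) $ n) *\<^sub>R ?e) \<partial>lborel)
      = (\<integral>\<^sup>+t. f (t *\<^sub>R ?e + x) \<partial>lborel)" for x
  proof -
    have "(\<integral>\<^sup>+t. f ((t *\<^sub>R ?e + x) + (c * (t *\<^sub>R ?e + x) $ n) *\<^sub>R ?e) \<partial>lborel)
        = (\<integral>\<^sup>+t. f ((c * x $ n + t) *\<^sub>R ?e + x) \<partial>lborel)"
      using \<open>m \<noteq> n\<close> by (simp add: axis_def algebra_simps)
    also have "\<dots> = (\<integral>\<^sup>+t. f (t *\<^sub>R ?e + x) \<partial>lborel)"
      by (rule nn_integral_lborel_translation) simp
    finally show ?thesis .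
  qed
  then show ?thesis
    by (simp add: key[of f] key[of "\<lambda>x. f (x + (c * x $ n) *\<^sub>R ?e)"])
qed

lemma prod_Basis_vec: "(\<Prod>b\<in>Basis. g b) = (\<Prod>i\<in>UNIV. g (axis i (1::real)))"
proof -
  have "inj_on (\<lambda>i. axis i (1::real)) UNIV"
    by (auto simp: inj_on_def axis_eq_axis)
  then show ?thesis
    using prod.reindex[of "\<lambda>i. axis i (1::real)" UNIV g]
    by (simp add: Basis_vec_def UNION_singleton_eq_range o_def)
qed

lemma sum_Basis_vec: "(\<Sum>b\<in>Basis. g b) = (\<Sum>i\<in>UNIV. g (axis i (1::real)))"
proof -
  have "inj_on (\<lambda>i. axis i (1::real)) UNIV"
    by (auto simp: inj_on_def axis_eq_axis)
  then show ?thesis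
    using sum.reindex[of "\<lambda>i. axis i (1::real)" UNIV g]
    by (simp add: Basis_vec_def UNION_singleton_eq_range o_def)
qed

lemma nn_integral_lborel_diag:
  fixes f :: "real ^ 'd \<Rightarrow> ennreal"
  assumes [measurable]: "f \<in> borel_measurable borel" and c: "\<And>i. c i \<noteq> 0"
  shows "(\<integral>\<^sup>+x. f x \<partial>lborel) = ennreal (\<Prod>i\<in>UNIV. \<bar>c i\<bar>) * (\<integral>\<^sup>+x. f (\<chi> i. c i * x $ i) \<partial>lborel)"
proof -
  \<comment> \<open>The affine change of variables is indexed by basis vectors; \<open>SOME\<close>
    reads off the coordinate that a basis vector belongs to.\<close>
  define C where "C = (\<lambda>b :: real ^ 'd. c (SOME i. b = axis i 1))"
  have C: "C (axis i 1) = c i" for i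
    by (simp add: C_def axis_eq_axis)
  define T where "T = (\<lambda>x :: real ^ 'd. 0 + (\<Sum>j\<in>Basis. (C j * (x \<bullet> j)) *\<^sub>R j))"
  have T: "T x = (\<chi> i. c i * x $ i)" for x
    unfolding T_def sum_Basis_vec vec_eq_iff
    by (simp add: C inner_axis) (simp add: axis_def if_distrib[of "(*) _"] cong: if_cong)
  have "lborel = density (distr lborel borel T) (\<lambda>_. (\<Prod>j\<in>Basis. \<bar>C j\<bar>))"
    unfolding T_def by (rule lborel_affine_euclidean) (auto simp: Basis_vec_def C c)
  then have "(\<integral>\<^sup>+x. f x \<partial>lborel) = (\<integral>\<^sup>+x. f x \<partial>density (distr lborel borel T) (\<lambda>_. (\<Prod>j\<in>Basis. \<bar>C j\<bar>)))"
    by simp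
  also have "T \<in> borel \<rightarrow>\<^sub>M borel"
    unfolding T_def by simp
  then have "(\<integral>\<^sup>+x. f x \<partial>density (distr lborel borel T) (\<lambda>_. (\<Prod>j\<in>Basis. \<bar>C j\<bar>)))
      = (\<Prod>j\<in>Basis. \<bar>C j\<bar>) * (\<integral>\<^sup>+x. f (T x) \<partial>lborel)"
    by (subst nn_integral_density) (auto simp: nn_integral_distr nn_integral_cmult)
  finally show ?thesis
    by (simp add: T prod_Basis_vec C)
qed

lemma nn_integral_lborel_permute:
  fixes f :: "real ^ 'd \<Rightarrow> ennreal"
  assumes [measurable]: "f \<in> borel_measurable borel" and p: "p permutes UNIV"
  shows "(\<integral>\<^sup>+x. f (\<chi> i. x $ p i) \<partial>lborel) = (\<integral>\<^sup>+x. f x \<partial>lborel)"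
proof -
  let ?T = "\<lambda>x :: real ^ 'd. \<chi> i. x $ p i"
  have bij: "bij p"
    using p by (rule permutes_bij)
  have [measurable]: "?T \<in> borel_measurable borel"
    by measurable
  have "lborel = distr lborel borel ?T"
  proof (rule lborel_eqI)
    fix l u :: "real ^ 'd"
    assume le: "\<And>b. b \<in> Basis \<Longrightarrow> l \<bullet> b \<le> u \<bullet> b"
    let ?q = "inv p"
    have pq: "p (?q i) = i" "?q (p i) = i" for i
      using p by (simp_all add: permutes_inverses)
    have "?T -` box l u = box (\<chi> i. l $ ?q i) (\<chi> i. u $ ?q i)"
      by (auto simp: mem_box_cart) (metis pq)+
    then have "emeasure (distr lborel borel ?T) (box l u)
        = emeasure lborel (box (\<chi> i. l $ ?q i) (\<chi> i. u $ ?q i) :: (real ^ 'd) set)"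
      by (simp add: emeasure_distr)
    also have "\<dots> = (\<Prod>i\<in>UNIV. (u - l) $ ?q i)"
    proof (subst emeasure_lborel_box)
      show "(\<chi> i. l $ ?q i) \<bullet> b \<le> (\<chi> i. u $ ?q i) \<bullet> b" if "b \<in> Basis" for b
        using that le[OF axis_in_Basis_iff[THEN iffD2], of 1 "?q _"]
        by (auto simp: Basis_vec_def inner_axis)
    qed (simp add: prod_Basis_vec inner_axis)
    also have "(\<Prod>i\<in>UNIV. (u - l) $ ?q i) = (\<Prod>i\<in>UNIV. (u - l) $ i)"
      by (intro prod.reindex_bij_betw bij_imp_bij_inv bij)
    finally show "emeasure (distr lborel borel ?T) (box l u) = (\<Prod>b\<in>Basis. (u - l) \<bullet> b)"
      by (simp add: prod_Basis_vec inner_axis)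
  qed simp
  then have "(\<integral>\<^sup>+x. f x \<partial>lborel) = (\<integral>\<^sup>+x. f x \<partial>distr lborel borel ?T)"
    by simp
  then show ?thesis
    by (simp add: nn_integral_distr)
qed

text \<open>The formula is multiplicative in the matrix, so scalings, transpositions and shears
  suffice. The condition on the determinant and the quantifier over \<open>f\<close> sit inside
  \<open>?P\<close>: a zero row makes the claim vacuous, and the product case applies the hypothesis
  for \<open>B\<close> to \<open>f\<close> composed with \<open>A\<close>.\<close>

theorem nn_integral_lborel_linear:
  fixes A :: "real ^ 'd ^ 'd"
  assumes "det A \<noteq> 0" "f \<in> borel_measurable borel"
  shows "(\<integral>\<^sup>+x. f x \<partial>lborel) = ennreal \<bar>det A\<bar> * (\<integral>\<^sup>+x. f (A *v x) \<partial>lborel)"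
proof -
  let ?P = "\<lambda>A :: real ^ 'd ^ 'd. det A \<noteq> 0 \<longrightarrow> (\<forall>f \<in> borel_measurable borel.
    (\<integral>\<^sup>+x. f x \<partial>lborel) = ennreal \<bar>det A\<bar> * (\<integral>\<^sup>+x. f (A *v x) \<partial>lborel))"
  have "?P A"
  proof (rule induct_matrix_elementary)
    fix A B :: "real ^ 'd ^ 'd"
    assume A: "?P A" and B: "?P B"
    show "?P (A ** B)"
    proof (intro impI ballI)
      fix f :: "real ^ 'd \<Rightarrow> ennreal"
      assume det: "det (A ** B) \<noteq> 0" and [measurable]: "f \<in> borel_measurable borel"
      have [measurable]: "(\<lambda>x. f (A *v x)) \<in> borel_measurable borel"
        by measurable
      show "(\<integral>\<^sup>+x. f x \<partial>lborel) = ennreal \<bar>det (A ** B)\<bar> * (\<integral>\<^sup>+x. f (A ** B *v x) \<partial>lborel)"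
      proof -
        have "det A \<noteq> 0" "det B \<noteq> 0"
          using det by (auto simp: det_mul)
        then have "(\<integral>\<^sup>+x. f x \<partial>lborel) = ennreal \<bar>det A\<bar> * (\<integral>\<^sup>+x. f (A *v x) \<partial>lborel)"
          "(\<integral>\<^sup>+x. f (A *v x) \<partial>lborel) = ennreal \<bar>det B\<bar> * (\<integral>\<^sup>+x. f (A *v (B *v x)) \<partial>lborel)"
          using A[rule_format, of f] B[rule_format, of "\<lambda>x. f (A *v x)"] by simp_all
        then show ?thesis
          by (simp add: det_mul abs_mult ennreal_mult mult.assoc matrix_vector_mul_assoc)
      qed
    qed
  next
    fix A :: "real ^ 'd ^ 'd" and i
    assume "row i A = 0"
    then show "?P A"
      using det_zero_row(2)[of i A] by simp
  next
    fix A :: "real ^ 'd ^ 'd"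
    assume A: "\<And>i j. i \<noteq> j \<Longrightarrow> A $ i $ j = 0"
    have det: "det A = (\<Prod>i\<in>UNIV. A $ i $ i)"
      using A by (rule det_diagonal)
    have "(\<Sum>j\<in>UNIV. A $ i $ j * x $ j) = A $ i $ i * x $ i" for x i
      using A by (simp add: sum.remove[where x=i])
    then have mult: "A *v x = (\<chi> i. A $ i $ i * x $ i)" for x
      by (simp add: matrix_vector_mult_def)
    show "?P A"
      by (auto simp: det mult abs_prod intro!: nn_integral_lborel_diag)
  next
    fix m n :: 'd
    assume "m \<noteq> n"
    let ?A = "\<chi> i j. mat 1 $ i $ Transposition.transpose m n j :: real ^ 'd ^ 'd"
    have perm: "Transposition.transpose m n permutes UNIV"
      by (simp add: permutes_swap_id)
    have "\<bar>det ?A\<bar> = 1"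
      using det_permute_columns[OF perm, of "mat 1 :: real ^ 'd ^ 'd"] \<open>m \<noteq> n\<close>
      by (simp add: sign_swap_id)
    moreover have "?A *v x = (\<chi> i. x $ Transposition.transpose m n i)" for x
    proof -
      have "mat 1 $ i $ Transposition.transpose m n j * x $ j
          = (if j = Transposition.transpose m n i then x $ j else 0)" for i j
        by (auto simp: mat_def Transposition.transpose_def split: if_splits)
      then show ?thesis
        by (simp add: matrix_vector_mult_def)
    qed
    ultimately show "?P ?A"
      using nn_integral_lborel_permute[OF _ perm] by simp
  next
    fix m n :: 'd and c
    assume "m \<noteq> n"
    let ?A = "\<chi> i j. if i = m \<and> j = n then c else of_bool (i = j) :: real ^ 'd ^ 'd"
    have "?A = (\<chi> k. if k = m then row m (mat 1) + c *s row n (mat 1) else row k (mat 1))"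
      using \<open>m \<noteq> n\<close> by (auto simp: vec_eq_iff row_def mat_def)
    then have "det ?A = 1"
      using det_row_operation[OF \<open>m \<noteq> n\<close>, of "mat 1 :: real ^ 'd ^ 'd" c] by simp
    moreover have "?A *v x = x + (c * x $ n) *\<^sub>R axis m 1" for x
    proof -
      have "(\<Sum>j\<in>UNIV. (if i = m \<and> j = n then c else of_bool (i = j)) * x $ j)
          = x $ i + (if i = m then c * x $ n else 0)" for i
      proof -
        have "(\<Sum>j\<in>UNIV. (if i = m \<and> j = n then c else of_bool (i = j)) * x $ j)
          = (\<Sum>j\<in>UNIV. (if i = j then x $ j else 0) + (if j = n then if i = m then c * x $ n else 0 else 0))"
          using \<open>m \<noteq> n\<close> by (intro sum.cong) auto
        then show ?thesis by (simp add: sum.distrib)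
      qed
      then show ?thesis
        by (simp add: matrix_vector_mult_def vec_eq_iff axis_def)
    qed
    ultimately show "?P ?A"
      using nn_integral_lborel_shear[OF _ \<open>m \<noteq> n\<close>] by simp
  qed
  then show ?thesis
    using assms by blast
qed

text \<open>On indicators the nonnegative formula becomes an identity of measures, which carries
  over to real and complex Bochner integrals.\<close>

theorem integral_lborel_linear:
  fixes A :: "real ^ 'd ^ 'd" and f :: "real ^ 'd \<Rightarrow> 'b::{banach, second_countable_topology}"
  assumes A: "det A \<noteq> 0" and [measurable]: "f \<in> borel_measurable borel"
  shows "(LINT x|lborel. f x) = \<bar>det A\<bar> *\<^sub>R (LINT x|lborel. f (A *v x))"
proof -
  have "lborel = density (distr lborel borel ((*v) A)) (\<lambda>_. ennreal \<bar>det A\<bar>)"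
  proof (rule measure_eqI)
    fix X :: "(real ^ 'd) set"
    assume "X \<in> sets lborel"
    then have [measurable]: "X \<in> sets borel"
      by simp
    have "emeasure (distr lborel borel ((*v) A)) X = (\<integral>\<^sup>+x. indicator X (A *v x) \<partial>lborel)"
      using nn_integral_distr[of "(*v) A" lborel borel "indicator X"] by simp
    then show "emeasure lborel X = emeasure (density (distr lborel borel ((*v) A)) (\<lambda>_. ennreal \<bar>det A\<bar>)) X"
      using nn_integral_lborel_linear[OF A, of "indicator X"]
      by (simp add: emeasure_density nn_integral_cmult)
  qed simp
  then have "(LINT x|lborel. f x) = (LINT x|density (distr lborel borel ((*v) A)) (\<lambda>_. ennreal \<bar>det A\<bar>). f x)"
    by simp
  then show ?thesis
    by (simp add: integral_density integral_distr)
qed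

section \<open>Smooth cutoff functions\<close>

text \<open>The classical smooth, non-analytic function exp(-1/t). The polynomial in 1/t is carried
  along to make the family closed under differentiation.\<close>

definition flat :: "real poly \<Rightarrow> real \<Rightarrow> real" where
  "flat p t = (if t \<le> 0 then 0 else poly p (1 / t) * exp (- (1 / t)))"

lemma poly_times_exp_minus_tendsto_0:
  fixes p :: "real poly"
  shows "((\<lambda>y. poly p y * exp (- y)) \<longlongrightarrow> 0) at_top"
proof -
  have "((\<lambda>y. \<Sum>i\<le>degree p. coeff p i * (y ^ i / exp y)) \<longlongrightarrow> (\<Sum>i\<le>degree p. coeff p i * 0)) at_top"
    by (intro tendsto_intros tendsto_power_div_exp_0)
  then show ?thesis
    by (simp add: poly_altdef sum_distrib_right exp_minus divide_inverse mult.assoc)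
qed

text \<open>Put y = 1/t. Differentiating \<open>poly p y * exp (- y)\<close> in y turns p into
  \<open>pderiv p - p\<close>, and the chain rule contributes -y^2, hence the factor
  \<open>[:0, 0, 1:]\<close>.\<close>

lemma flat_has_derivative:
  "(flat p has_real_derivative flat ((p - pderiv p) * [:0, 0, 1:]) t) (at t)"
proof -
  consider "t < 0" | "t = 0" | "t > 0" by linarith
  then show ?thesis
  proof cases
    case 1
    have "((\<lambda>_. 0) has_real_derivative 0) (at t)"
      by simp
    then have "(flat p has_real_derivative 0) (at t)"
      by (rule has_field_derivative_transform_within_open[of _ _ _ "{..<0}"]) (use 1 in \<open>auto simp: flat_def\<close>)
    with 1 show ?thesis by (simp add: flat_def)
  next
    case 3
    have "((\<lambda>t. poly p (1 / t) * exp (- (1 / t))) has_real_derivative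
        flat ((p - pderiv p) * [:0, 0, 1:]) t) (at t)"
      using 3
      by (auto intro!: derivative_eq_intros simp: flat_def power2_eq_square field_simps)
    then show ?thesis
      by (rule has_field_derivative_transform_within_open[of _ _ _ "{0<..}"]) (use 3 in \<open>auto simp: flat_def\<close>)
  next
    case 2
    have "((\<lambda>h. flat p h / h) \<longlongrightarrow> 0) (at 0)"
    proof (subst filterlim_at_split, intro conjI)
      show "((\<lambda>h. flat p h / h) \<longlongrightarrow> 0) (at_left 0)"
        by (rule tendsto_eventually) (auto simp: flat_def eventually_at_filter)
      \<comment> \<open>The division by \<open>h\<close> in the difference quotient is one more
        power of 1/h and is absorbed into the polynomial.\<close>
      have "((\<lambda>h. poly (p * [:0, 1:]) (inverse h) * exp (- inverse h)) \<longlongrightarrow> 0) (at_right 0)"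
        by (rule filterlim_compose[OF poly_times_exp_minus_tendsto_0 filterlim_inverse_at_top_right])
      then show "((\<lambda>h. flat p h / h) \<longlongrightarrow> 0) (at_right 0)"
        by (rule Lim_transform_eventually)
          (auto simp: flat_def field_simps eventually_at_filter)
    qed
    then show ?thesis
      using 2 by (simp add: DERIV_def flat_def)
  qed
qed

text \<open>A class of functions closed under partial derivatives, and rich enough to contain plateau functions.\<close>

inductive_set elem_smooth :: "(real ^ 'd \<Rightarrow> real) set" where
  flat: "(\<lambda>x. flat p (a \<bullet> x + t)) \<in> elem_smooth"
| cos: "(\<lambda>x. cos (a \<bullet> x + t)) \<in> elem_smooth"
| const: "(\<lambda>x. c) \<in> elem_smooth"
| add: "\<phi> \<in> elem_smooth \<Longrightarrow> \<psi> \<in> elem_smooth \<Longrightarrow> (\<lambda>x. \<phi> x + \<psi> x) \<in> elem_smooth"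
| mult: "\<phi> \<in> elem_smooth \<Longrightarrow> \<psi> \<in> elem_smooth \<Longrightarrow> (\<lambda>x. \<phi> x * \<psi> x) \<in> elem_smooth"
| inverse: "\<phi> \<in> elem_smooth \<Longrightarrow> (\<And>x. \<phi> x \<noteq> 0) \<Longrightarrow> (\<lambda>x. inverse (\<phi> x)) \<in> elem_smooth"

lemma inner_eq_sum_nth: "a \<bullet> v = (\<Sum>i\<in>UNIV. a $ i * v $ i)" for a v :: "real ^ 'd"
  by (simp add: inner_vec_def)

lemma has_derivative_ridge:
  fixes a :: "real ^ 'd"
  assumes "(h has_real_derivative h') (at (a \<bullet> x + t))"
  shows "((\<lambda>x. h (a \<bullet> x + t)) has_derivative (\<lambda>v. \<Sum>i\<in>UNIV. (a $ i * h') * v $ i)) (at x)"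
proof -
  have "((\<lambda>x. h (a \<bullet> x + t)) has_derivative (\<lambda>v. h' * (a \<bullet> v))) (at x)"
  proof -
    have "((\<lambda>x. a \<bullet> x + t) has_derivative (\<lambda>v. a \<bullet> v)) (at x)"
      by (auto intro!: derivative_eq_intros)
    from has_derivative_compose[OF this, of h "(*) h'"] assms show ?thesis
      unfolding has_field_derivative_def by blast
  qed
  then show ?thesis
    by (simp add: inner_eq_sum_nth sum_distrib_left mult_ac)
qed

lemma elem_smooth_has_derivative:
  assumes "\<phi> \<in> elem_smooth"
  shows "\<exists>\<psi>. (\<forall>i. \<psi> i \<in> elem_smooth) \<and>
    (\<forall>x. (\<phi> has_derivative (\<lambda>v. \<Sum>i\<in>UNIV. \<psi> i x * v $ i)) (at x))"
  using assms
proof induction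
  case (flat p a t)
  let ?q = "(p - pderiv p) * [:0, 0, 1:]"
  show ?case
    by (rule exI[of _ "\<lambda>i x. a $ i * flat ?q (a \<bullet> x + t)"])
      (intro conjI allI elem_smooth.intros has_derivative_ridge flat_has_derivative)
next
  case (cos a t)
  \<comment> \<open>Read as a cosine with advanced phase, the derivative stays inside the class, and
    iterated derivatives get a uniform formula.\<close>
  have "(cos has_real_derivative cos (u + pi / 2)) (at u)" for u :: real
    by (auto intro!: derivative_eq_intros simp: cos_add)
  then have "((\<lambda>x. cos (a \<bullet> x + t)) has_derivative
      (\<lambda>v. \<Sum>i\<in>UNIV. (a $ i * cos (a \<bullet> x + t + pi / 2)) * v $ i)) (at x)" for x
    by (intro has_derivative_ridge)
  then show ?case
    by (intro exI[of _ "\<lambda>i x. a $ i * cos (a \<bullet> x + t + pi / 2)"])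
      (auto simp: add.assoc intro: elem_smooth.intros)
next
  case (const c)
  show ?case
    by (rule exI[of _ "\<lambda>i x. 0"]) (simp add: elem_smooth.const)
next
  case (add \<phi> \<psi>)
  from add.IH(1) obtain \<phi>' where \<phi>': "\<forall>i. \<phi>' i \<in> elem_smooth"
    "\<forall>x. (\<phi> has_derivative (\<lambda>v. \<Sum>i\<in>UNIV. \<phi>' i x * v $ i)) (at x)"
    by (elim exE conjE)
  from add.IH(2) obtain \<psi>' where \<psi>': "\<forall>i. \<psi>' i \<in> elem_smooth"
    "\<forall>x. (\<psi> has_derivative (\<lambda>v. \<Sum>i\<in>UNIV. \<psi>' i x * v $ i)) (at x)"
    by (elim exE conjE)
  note d = \<phi>'(1)[rule_format] \<psi>'(1)[rule_format] \<phi>'(2)[rule_format] \<psi>'(2)[rule_format]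
  show ?case
  proof (intro exI[of _ "\<lambda>i x. \<phi>' i x + \<psi>' i x"] conjI allI)
    fix x
    show "((\<lambda>x. \<phi> x + \<psi> x) has_derivative (\<lambda>v. \<Sum>i\<in>UNIV. (\<phi>' i x + \<psi>' i x) * v $ i)) (at x)"
      using has_derivative_add[OF d(3,4)] by (simp add: distrib_right sum.distrib)
  qed (intro elem_smooth.intros d)
next
  case (mult \<phi> \<psi>)
  from mult.IH(1) obtain \<phi>' where \<phi>': "\<forall>i. \<phi>' i \<in> elem_smooth"
    "\<forall>x. (\<phi> has_derivative (\<lambda>v. \<Sum>i\<in>UNIV. \<phi>' i x * v $ i)) (at x)"
    by (elim exE conjE)
  from mult.IH(2) obtain \<psi>' where \<psi>': "\<forall>i. \<psi>' i \<in> elem_smooth"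
    "\<forall>x. (\<psi> has_derivative (\<lambda>v. \<Sum>i\<in>UNIV. \<psi>' i x * v $ i)) (at x)"
    by (elim exE conjE)
  note d = \<phi>'(1)[rule_format] \<psi>'(1)[rule_format] \<phi>'(2)[rule_format] \<psi>'(2)[rule_format]
  show ?case
  proof (intro exI[of _ "\<lambda>i x. \<phi> x * \<psi>' i x + \<phi>' i x * \<psi> x"] conjI allI)
    fix x
    show "((\<lambda>x. \<phi> x * \<psi> x) has_derivative
        (\<lambda>v. \<Sum>i\<in>UNIV. (\<phi> x * \<psi>' i x + \<phi>' i x * \<psi> x) * v $ i)) (at x)"
      using has_derivative_mult[OF d(3,4)]
      by (simp add: distrib_left distrib_right sum.distrib sum_distrib_left mult_ac)
  qed (intro elem_smooth.intros d mult.hyps)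
next
  case (inverse \<phi>)
  from inverse.IH obtain \<phi>' where \<phi>': "\<forall>i. \<phi>' i \<in> elem_smooth"
    "\<forall>x. (\<phi> has_derivative (\<lambda>v. \<Sum>i\<in>UNIV. \<phi>' i x * v $ i)) (at x)"
    by (elim exE conjE)
  note d = \<phi>'[rule_format]
  show ?case
  proof (intro exI[of _ "\<lambda>i x. (- 1) * (inverse (\<phi> x) * inverse (\<phi> x)) * \<phi>' i x"] conjI allI)
    fix x
    show "((\<lambda>x. inverse (\<phi> x)) has_derivative
        (\<lambda>v. \<Sum>i\<in>UNIV. ((- 1) * (inverse (\<phi> x) * inverse (\<phi> x)) * \<phi>' i x) * v $ i)) (at x)"
      using Deriv.has_derivative_inverse[OF inverse.hyps(2) d(2)]
      by (simp add: sum_distrib_left sum_negf mult_ac)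
  qed (intro elem_smooth.intros d inverse.hyps)
qed

lemma partial_deriv_eq:
  fixes \<phi> :: "real ^ 'd \<Rightarrow> real"
  assumes "(\<phi> has_derivative (\<lambda>v. \<Sum>i\<in>UNIV. \<psi> i * v $ i)) (at x)"
  shows "partial_deriv i \<phi> x = \<psi> i"
  unfolding partial_deriv_def frechet_derivative_at[OF assms, symmetric]
  by (simp add: axis_def if_distrib[of "(*) _"] cong: if_cong)

lemma elem_smooth_partial_deriv:
  assumes "\<phi> \<in> elem_smooth"
  shows "partial_deriv i \<phi> \<in> elem_smooth"
proof -
  from elem_smooth_has_derivative[OF assms] obtain \<psi> where \<psi>: "\<forall>i. \<psi> i \<in> elem_smooth"
    "\<forall>x. (\<phi> has_derivative (\<lambda>v. \<Sum>i\<in>UNIV. \<psi> i x * v $ i)) (at x)"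
    by (elim exE conjE)
  have "partial_deriv i \<phi> = \<psi> i"
    by (rule ext, rule partial_deriv_eq, rule \<psi>(2)[rule_format])
  with \<psi> show ?thesis by simp
qed

lemma elem_smooth_differentiable: "\<phi> \<in> elem_smooth \<Longrightarrow> \<phi> differentiable (at x)"
  using elem_smooth_has_derivative[of \<phi>] by (auto simp: differentiable_def)

lemma elem_smooth_imp_smooth_fun:
  assumes "\<phi> \<in> elem_smooth"
  shows "smooth_fun \<phi>"
proof -
  have "foldr partial_deriv is \<phi> \<in> elem_smooth" for "is"
    by (induction "is") (simp_all add: assms elem_smooth_partial_deriv)
  then show ?thesis
    by (simp add: smooth_fun_def elem_smooth_differentiable)
qed

lemma elem_smooth_prod:
  "finite I \<Longrightarrow> (\<And>i. i \<in> I \<Longrightarrow> \<phi> i \<in> elem_smooth) \<Longrightarrow> (\<lambda>x. \<Prod>i\<in>I. \<phi> i x) \<in> elem_smooth"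
  by (induction rule: finite_induct) (simp_all add: elem_smooth.const elem_smooth.mult)

section \<open>Plateau functions around the unit cube\<close>

definition smooth_step :: "real \<Rightarrow> real" where
  "smooth_step t = flat 1 t * inverse (flat 1 t + flat 1 (1 - t))"

lemma flat_1_nonneg: "flat 1 t \<ge> 0" and flat_1_pos: "t > 0 \<Longrightarrow> flat 1 t > 0"
  by (auto simp: flat_def)

lemma flat_1_sum_pos: "flat 1 t + flat 1 (1 - t) > 0"
proof (cases "t > 0")
  case True
  then show ?thesis by (intro add_pos_nonneg flat_1_pos flat_1_nonneg)
next
  case False
  then show ?thesis by (intro add_nonneg_pos flat_1_pos flat_1_nonneg) simp
qed

lemma smooth_step_0: "t \<le> 0 \<Longrightarrow> smooth_step t = 0"
  and smooth_step_1: "t \<ge> 1 \<Longrightarrow> smooth_step t = 1"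
  using flat_1_sum_pos[of t] by (auto simp: smooth_step_def flat_def)

lemma smooth_step_bounds: "0 \<le> smooth_step t" "smooth_step t \<le> 1"
  using flat_1_sum_pos[of t] flat_1_nonneg[of t] flat_1_nonneg[of "1 - t"]
  by (auto simp: smooth_step_def field_simps)

lemma elem_smooth_smooth_step: "(\<lambda>x. smooth_step (a \<bullet> x + t)) \<in> elem_smooth"
proof -
  have "(\<lambda>x. flat 1 ((- a) \<bullet> x + (1 - t))) \<in> elem_smooth"
    by (rule elem_smooth.flat)
  then have "(\<lambda>x. flat 1 (1 - (a \<bullet> x + t))) \<in> elem_smooth"
    by (simp add: algebra_simps)
  moreover have "flat 1 (a \<bullet> x + t) + flat 1 (1 - (a \<bullet> x + t)) \<noteq> 0" for x
    using flat_1_sum_pos by (metis less_irrefl)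
  ultimately show ?thesis
    unfolding smooth_step_def by (intro elem_smooth.intros)
qed

text \<open>The plateau of height 1 reaches \<epsilon> beyond the cube, and the function vanishes
  from distance 2\<epsilon> in any coordinate. Being constant on a neighbourhood of the closed cube,
  it does not disturb derivatives of a factor at any point of the cube, boundary included.\<close>

definition cube_cutoff :: "real \<Rightarrow> real ^ 'd \<Rightarrow> real" where
  "cube_cutoff \<epsilon> x =
     (\<Prod>j\<in>UNIV. smooth_step ((x $ j + 2 * \<epsilon>) / \<epsilon>) * smooth_step ((1 + 2 * \<epsilon> - x $ j) / \<epsilon>))"

lemma elem_smooth_cube_cutoff: "cube_cutoff \<epsilon> \<in> elem_smooth"
proof -
  have *: "(\<lambda>x. smooth_step (((1 / \<epsilon>) *\<^sub>R axis j 1) \<bullet> x + 2 * \<epsilon> / \<epsilon>) *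
      smooth_step (((- 1 / \<epsilon>) *\<^sub>R axis j 1) \<bullet> x + (1 + 2 * \<epsilon>) / \<epsilon>)) \<in> elem_smooth" for j
    by (intro elem_smooth.mult elem_smooth_smooth_step)
  have "(\<lambda>x. smooth_step ((x $ j + 2 * \<epsilon>) / \<epsilon>) * smooth_step ((1 + 2 * \<epsilon> - x $ j) / \<epsilon>)) \<in> elem_smooth" for j
    using *[of j] by (simp add: inner_axis' add_divide_distrib diff_divide_distrib algebra_simps)
  then show ?thesis
    unfolding cube_cutoff_def[abs_def] by (intro elem_smooth_prod) auto
qed

lemma cube_cutoff_eq_1:
  assumes "\<epsilon> > 0" "\<And>j. - \<epsilon> \<le> x $ j \<and> x $ j \<le> 1 + \<epsilon>"
  shows "cube_cutoff \<epsilon> x = 1"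
  unfolding cube_cutoff_def
proof (intro prod.neutral ballI)
  fix j
  have "(x $ j + 2 * \<epsilon>) / \<epsilon> \<ge> 1" "(1 + 2 * \<epsilon> - x $ j) / \<epsilon> \<ge> 1"
    using assms(1) assms(2)[of j] by (simp_all add: field_simps)
  then show "smooth_step ((x $ j + 2 * \<epsilon>) / \<epsilon>) * smooth_step ((1 + 2 * \<epsilon> - x $ j) / \<epsilon>) = 1"
    by (simp add: smooth_step_1)
qed

lemma cube_cutoff_eq_0:
  assumes "\<epsilon> > 0" "x $ j \<le> - 2 * \<epsilon> \<or> 1 + 2 * \<epsilon> \<le> x $ j"
  shows "cube_cutoff \<epsilon> x = 0"
  unfolding cube_cutoff_def
  using assms by (intro prod_zero bexI[of _ j]) (auto simp: smooth_step_0 divide_le_0_iff)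

lemma cube_cutoff_bounds: "0 \<le> cube_cutoff \<epsilon> x" "cube_cutoff \<epsilon> x \<le> 1"
  unfolding cube_cutoff_def
  by (auto intro!: prod_nonneg prod_le_1 mult_le_one simp: smooth_step_bounds)

lemma test_fun_cutoff_cos:
  assumes "\<epsilon> > 0"
  shows "test_fun (\<lambda>x :: real ^ 'd. cube_cutoff \<epsilon> x * cos (a \<bullet> x + t))"
proof -
  have "{x :: real ^ 'd. cube_cutoff \<epsilon> x * cos (a \<bullet> x + t) \<noteq> 0}
      \<subseteq> cbox (\<chi> j. - 2 * \<epsilon>) (\<chi> j. 1 + 2 * \<epsilon>)"
  proof (intro subsetI)
    fix x :: "real ^ 'd"
    assume "x \<in> {x. cube_cutoff \<epsilon> x * cos (a \<bullet> x + t) \<noteq> 0}"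
    then have "cube_cutoff \<epsilon> x \<noteq> 0"
      by simp
    then have "- 2 * \<epsilon> \<le> x $ j \<and> x $ j \<le> 1 + 2 * \<epsilon>" for j
      using cube_cutoff_eq_0[OF assms, of x j] by linarith
    then show "x \<in> cbox (\<chi> j. - 2 * \<epsilon>) (\<chi> j. 1 + 2 * \<epsilon>)"
      by (simp add: mem_box_cart)
  qed
  then have "bounded {x :: real ^ 'd. cube_cutoff \<epsilon> x * cos (a \<bullet> x + t) \<noteq> 0}"
    using bounded_cbox bounded_subset by blast
  then show ?thesis
    by (auto simp: test_fun_def compact_closure
        intro!: elem_smooth_imp_smooth_fun elem_smooth.intros elem_smooth_cube_cutoff)
qed

lemma partial_deriv_cong_open:
  assumes "open S" "x \<in> S" "\<And>y. y \<in> S \<Longrightarrow> \<phi> y = \<psi> y"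
  shows "partial_deriv i \<phi> x = partial_deriv i \<psi> x"
proof -
  have "(\<phi> has_derivative D) (at x) \<longleftrightarrow> (\<psi> has_derivative D) (at x)" for D
    using assms has_derivative_transform_within_open[of \<phi> D x UNIV S \<psi>]
      has_derivative_transform_within_open[of \<psi> D x UNIV S \<phi>] by auto
  then show ?thesis
    by (simp add: partial_deriv_def frechet_derivative_def)
qed

lemma funpow_partial_deriv_cos:
  "(partial_deriv j ^^ k) (\<lambda>x :: real ^ 'd. cos (a \<bullet> x + t))
     = (\<lambda>x :: real ^ 'd. (a $ j) ^ k * cos (a \<bullet> x + t + real k * (pi / 2)))"
proof (induction k)
  case (Suc k)
  have "partial_deriv j (\<lambda>x. a $ j ^ k * cos (a \<bullet> x + t + real k * (pi / 2))) (x :: real ^ 'd)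
      = a $ j * (a $ j ^ k * cos (a \<bullet> x + t + real k * (pi / 2) + pi / 2))" for x :: "real ^ 'd"
  proof (rule partial_deriv_eq[where \<psi> = "\<lambda>i. a $ i * (a $ j ^ k * cos (a \<bullet> x + t + real k * (pi / 2) + pi / 2))"])
    have "((\<lambda>u. a $ j ^ k * cos u) has_real_derivative a $ j ^ k * cos (u + pi / 2)) (at u)" for u
      by (auto intro!: derivative_eq_intros simp: cos_add)
    from has_derivative_ridge[OF this, where a = a and x = x and t = "t + real k * (pi / 2)"]
    show "((\<lambda>x. a $ j ^ k * cos (a \<bullet> x + t + real k * (pi / 2))) has_derivative
        (\<lambda>v. \<Sum>i\<in>UNIV. (a $ i * (a $ j ^ k * cos (a \<bullet> x + t + real k * (pi / 2) + pi / 2))) * v $ i)) (at x)"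
      by (simp add: add.assoc)
  qed
  then have "partial_deriv j (\<lambda>x. a $ j ^ k * cos (a \<bullet> x + t + real k * (pi / 2)))
      = (\<lambda>x :: real ^ 'd. a $ j ^ Suc k * cos (a \<bullet> x + t + real (Suc k) * (pi / 2)))"
    by (simp add: fun_eq_iff algebra_simps add_divide_distrib)
  then show ?case
    by (simp only: funpow.simps o_apply Suc.IH)
qed simp

lemma funpow_partial_deriv_cutoff_cos:
  fixes a :: "real ^ 'd"
  assumes "\<epsilon> > 0" and x: "x \<in> unit_cube"
  shows "(partial_deriv j ^^ k) (\<lambda>x. cube_cutoff \<epsilon> x * cos (a \<bullet> x + t)) x
     = (a $ j) ^ k * cos (a \<bullet> x + t + real k * (pi / 2))"
proof -
  \<comment> \<open>The induction differentiates at each step, so agreement is needed on an open set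
    around the cube and not just at \<open>x\<close>.\<close>
  let ?S = "box (\<chi> j. - \<epsilon>) (\<chi> j. 1 + \<epsilon>) :: (real ^ 'd) set"
  have "y \<in> ?S \<Longrightarrow> (partial_deriv j ^^ k) (\<lambda>x. cube_cutoff \<epsilon> x * cos (a \<bullet> x + t)) y
     = (partial_deriv j ^^ k) (\<lambda>x. cos (a \<bullet> x + t)) y" for y
  proof (induction k arbitrary: y)
    case 0
    then have "cube_cutoff \<epsilon> y = 1"
      using assms(1) by (intro cube_cutoff_eq_1) (auto simp: mem_box_cart less_imp_le)
    then show ?case by simp
  next
    case (Suc k)
    then show ?case
      by (auto intro!: partial_deriv_cong_open[of ?S])
  qed
  moreover have "- \<epsilon> < x $ i \<and> x $ i < 1 + \<epsilon>" for i
    using assms(1) x[unfolded mem_box_cart, rule_format, of i] by simp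
  then have "x \<in> ?S"
    by (simp add: mem_box_cart)
  ultimately show ?thesis
    by (simp add: funpow_partial_deriv_cos)
qed

text \<open>The multi-index k e_j. At a frequency whose largest coordinate is the j-th, the
  derivative in direction j alone gives the full decay.\<close>

definition pure_index :: "nat \<Rightarrow> 'd::finite \<Rightarrow> nat ^ 'd" where
  "pure_index k j = (\<chi> i. if i = j then k else 0)"

lemma multi_order_pure_index: "multi_order (pure_index k j) = k"
  by (simp add: multi_order_def pure_index_def)

text \<open>Whatever enumeration \<open>SOME\<close> picks, \<open>j\<close> occurs in it exactly
  once, and every other direction is iterated 0 times.\<close>

lemma mixed_partial_pure_index: "mixed_partial (pure_index k j) \<phi> = (partial_deriv j ^^ k) \<phi>"
proof -
  have *: "distinct is \<Longrightarrow> foldr (\<lambda>i. partial_deriv i ^^ (pure_index k j $ i)) is \<phi>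
      = (if j \<in> set is then (partial_deriv j ^^ k) \<phi> else \<phi>)" for "is"
    by (induction "is") (auto simp: pure_index_def)
  have "\<exists>is :: 'a list. distinct is \<and> set is = UNIV"
    using finite_distinct_list[of "UNIV :: 'a set"] by auto
  from someI_ex[OF this] show ?thesis
    unfolding mixed_partial_def by (subst *) auto
qed

section \<open>The Fourier transform and a localising kernel\<close>

lemma integral_lborel_prod_vec:
  fixes h :: "'d::finite \<Rightarrow> real \<Rightarrow> complex"
  assumes h: "\<And>i. integrable lborel (h i)"
  shows "(LINT x|lborel. (\<Prod>i\<in>UNIV. h i (x $ i))) = (\<Prod>i\<in>UNIV. LINT t|lborel. h i t)"
proof -
  define H where "H = (\<lambda>b :: real ^ 'd. h (SOME i. b = axis i 1))"
  have H: "H (axis i 1) = h i" for i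
    by (simp add: H_def axis_eq_axis)
  have H_int: "integrable lborel (H b)" for b
    by (simp add: H_def h)
  have [measurable]: "h i \<in> borel_measurable borel" for i
    using borel_measurable_integrable[OF h[of i]] by simp
  let ?T = "\<lambda>f :: real ^ 'd \<Rightarrow> real. \<Sum>b\<in>Basis. f b *\<^sub>R b"
  have T: "?T f $ i = f (axis i 1)" for f i
    by (simp add: sum_Basis_vec axis_def if_distrib[of "(*) _"] cong: if_cong)
  interpret product_sigma_finite "\<lambda>_ :: real ^ 'd. lborel :: real measure" ..
  have "(LINT x|lborel. (\<Prod>i\<in>UNIV. h i (x $ i)))
      = (LINT x|distr (\<Pi>\<^sub>M b\<in>Basis. lborel) borel ?T. (\<Prod>i\<in>UNIV. h i (x $ i)))"
    by (subst lborel_eq) simp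
  also have "\<dots> = (LINT f|(\<Pi>\<^sub>M b\<in>Basis. lborel). (\<Prod>i\<in>UNIV. h i (?T f $ i)))"
    by (rule integral_distr) measurable
  also have "\<dots> = (LINT f|(\<Pi>\<^sub>M b\<in>Basis. lborel). (\<Prod>b\<in>Basis. H b (f b)))"
    by (simp only: T prod_Basis_vec H)
  also have "\<dots> = (\<Prod>b\<in>Basis. LINT t|lborel. H b t)"
    by (rule product_integral_prod) (auto intro: H_int)
  finally show ?thesis
    by (simp add: prod_Basis_vec H)
qed

lemma integrable_indicator_scaleR_bounded:
  fixes f :: "'a::euclidean_space \<Rightarrow> 'b::{banach, second_countable_topology}"
  assumes [measurable]: "S \<in> sets borel" "f \<in> borel_measurable borel"
    and S: "emeasure lborel S < \<infinity>" and f: "\<And>x. norm (f x) \<le> C"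
  shows "integrable lborel (\<lambda>x. indicator S x *\<^sub>R f x)"
proof (rule integrableI_bounded_set_indicator)
  show "AE x in lborel. x \<in> S \<longrightarrow> norm (f x) \<le> C"
    using f by simp
qed (use S in auto)

lemma measurable_cis [measurable]: "cis \<in> borel_measurable borel"
  unfolding cis_conv_exp[abs_def] by measurable

lemma prod_cis: "(\<Prod>i\<in>I. cis (f i)) = cis (\<Sum>i\<in>I. f i)"
  by (induction I rule: infinite_finite_induct) (simp_all add: cis_mult)

definition wave :: "real ^ 'd \<Rightarrow> real ^ 'd \<Rightarrow> complex" where
  "wave \<xi> x = cis (2 * pi * (\<xi> \<bullet> x))"

lemma norm_wave [simp]: "cmod (wave \<xi> x) = 1"
  by (simp add: wave_def)

lemma measurable_wave [measurable]:
  assumes [measurable]: "f \<in> borel_measurable M" "g \<in> borel_measurable M"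
  shows "(\<lambda>x. wave (f x) (g x)) \<in> borel_measurable M"
  unfolding wave_def by measurable

lemma wave_diff_left: "wave (\<xi> - \<eta>) x = wave \<xi> x * cnj (wave \<eta> x)"
  by (simp add: wave_def inner_diff_left algebra_simps cis_cnj cis_mult)

lemma wave_add_right: "wave \<xi> (x + y) = wave \<xi> x * wave \<xi> y"
  by (simp add: wave_def inner_add_right algebra_simps flip: cis_mult)

lemma wave_zero_left [simp]: "wave 0 x = 1"
  by (simp add: wave_def)

lemma cis_2pi_int: "cis (2 * pi * of_int k) = 1"
  using cis_multiple_2pi[of "of_int k"] by simp

lemma wave_int_int [simp]: "wave (int_vec k) (int_vec m) = 1"
proof -
  have "int_vec k \<bullet> int_vec m = of_int (\<Sum>i\<in>UNIV. k $ i * m $ i)"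
    by (simp add: inner_eq_sum_nth int_vec_def)
  then show ?thesis
    by (simp only: wave_def cis_2pi_int)
qed

text \<open>The set \<open>A\<close> is fixed only up to its end points, so that one statement
  serves both the half-open cells that tile the space and the closed unit cube that carries the
  functions.\<close>

lemma integral_unit_interval_cis:
  fixes k :: int
  assumes [measurable]: "A \<in> sets borel" and A: "{a<..<a + 1} \<subseteq> A" "A \<subseteq> {a..a + 1}"
  shows "(LINT t|lborel. indicator A t *\<^sub>R cis (2 * pi * (of_int k * t))) = of_bool (k = 0)"
proof -
  let ?f = "\<lambda>t. cis (2 * pi * (of_int k * t))"
  have "(LINT t|lborel. indicator A t *\<^sub>R ?f t) = (LINT t|lborel. indicator {a..a + 1} t *\<^sub>R ?f t)"
  proof (rule integral_cong_AE)
    have ae: "AE t in lborel. t \<noteq> a" "AE t in lborel. t \<noteq> a + 1"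
      by (rule AE_lborel_singleton)+
    have "t \<in> A \<longleftrightarrow> t \<in> {a..a + 1}" if "t \<noteq> a" "t \<noteq> a + 1" for t
      using A that by (auto simp: subset_eq)
    with ae show "AE t in lborel. indicator A t *\<^sub>R ?f t = indicator {a..a + 1} t *\<^sub>R ?f t"
      by (auto simp: indicator_def)
  qed measurable
  also have "\<dots> = of_bool (k = 0)"
  proof (cases "k = 0")
    case True
    then show ?thesis by simp
  next
    case False
    define w where "w = 2 * pi * of_int k * \<i>"
    have w: "w \<noteq> 0"
      using False by (simp add: w_def)
    have f: "?f t = exp (w * of_real t)" for t
      by (simp add: cis_conv_exp w_def mult_ac)
    let ?F = "\<lambda>t. ?f t / w"
    have "(LINT t|lborel. indicator {a..a + 1} t *\<^sub>R ?f t) = ?F (a + 1) - ?F a"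
    proof (rule integral_FTC_atLeastAtMost)
      fix t
      have "((\<lambda>z. exp (w * z) / w) has_field_derivative exp (w * of_real t)) (at (of_real t))"
        using w by (auto intro!: derivative_eq_intros)
      then show "(?F has_vector_derivative ?f t) (at t within {a..a + 1})"
        unfolding f by (rule has_vector_derivative_real_field)
    qed (auto intro!: continuous_intros simp: cis_conv_exp)
    also have "?f (a + 1) = ?f a"
      using cis_2pi_int[of k] by (simp add: distrib_left flip: cis_mult)
    finally show ?thesis
      using False by simp
  qed
  finally show ?thesis .
qed

lemma indicator_box_wave:
  "indicator {x. \<forall>i. x $ i \<in> A} x *\<^sub>R wave \<xi> x
     = (\<Prod>i\<in>UNIV. indicator A (x $ i) *\<^sub>R cis (2 * pi * (\<xi> $ i * x $ i)))"
proof -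
  have "(\<Prod>i\<in>UNIV. cis (2 * pi * (\<xi> $ i * x $ i))) = wave \<xi> x"
    by (simp add: prod_cis wave_def inner_eq_sum_nth sum_distrib_left)
  moreover have "(\<Prod>i\<in>UNIV. indicator A (x $ i) :: complex) = indicator {x. \<forall>i. x $ i \<in> A} x"
    by (auto simp: indicator_def prod.neutral)
  ultimately show ?thesis
    by (simp add: scaleR_conv_of_real prod.distrib of_real_indicator)
qed

lemma integral_unit_box_wave:
  fixes k :: "int ^ 'd"
  assumes [measurable]: "A \<in> sets borel" and A: "{a<..<a + 1} \<subseteq> A" "A \<subseteq> {a..a + 1}"
  shows "(LINT x|lborel. indicator {x. \<forall>i. x $ i \<in> A} x *\<^sub>R wave (int_vec k) x) = of_bool (k = 0)"
proof -
  have "(LINT x|lborel. indicator {x. \<forall>i. x $ i \<in> A} x *\<^sub>R wave (int_vec k) x)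
      = (\<Prod>i\<in>UNIV. LINT t|lborel. indicator A t *\<^sub>R cis (2 * pi * (of_int (k $ i) * t)))"
    unfolding indicator_box_wave int_vec_def vec_lambda_beta
  proof (rule integral_lborel_prod_vec)
    fix i
    have "emeasure lborel A \<le> emeasure lborel {a..a + 1}"
      using A by (intro emeasure_mono) auto
    also have "\<dots> < \<infinity>"
      by simp
    finally have "emeasure lborel A < \<infinity>" .
    then show "integrable lborel (\<lambda>t. indicator A t *\<^sub>R cis (2 * pi * (of_int (k $ i) * t)))"
      by (intro integrable_indicator_scaleR_bounded[where C = 1]) auto
  qed
  also have "\<dots> = (\<Prod>i\<in>UNIV. of_bool (k $ i = 0))"
    by (simp add: integral_unit_interval_cis[OF assms])
  also have "\<dots> = of_bool (k = 0)"
    by (auto simp: vec_eq_iff of_bool_def)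
  finally show ?thesis .
qed

section \<open>The cosine-power kernel\<close>

definition kernel_coeff :: "nat \<Rightarrow> int \<Rightarrow> real" where
  "kernel_coeff N k = real ((2 * N) choose nat (k + int N)) / real ((2 * N) choose N)"

text \<open>This is cos^(2N)(pi t), written with the half-angle formula, times the factor that makes
  its mean over a period equal to 1. Its Fourier coefficients are the
  \<open>kernel_coeff N k\<close> with |k| \<le> N.\<close>

definition kernel1 :: "nat \<Rightarrow> real \<Rightarrow> real" where
  "kernel1 N t = 4 ^ N / real ((2 * N) choose N) * ((1 + cos (2 * pi * t)) / 2) ^ N"

text \<open>The central binomial coefficient is the largest. For \<open>k < - N\<close> the
  truncation by \<open>nat\<close> gives a small positive value instead of 0; it obeys the same
  bounds, and the expansions only use |k| \<le> N.\<close>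

lemma kernel_coeff_bounds: "0 \<le> kernel_coeff N k" "kernel_coeff N k \<le> 1"
  using binomial_maximum'[of N "nat (k + int N)"]
  by (auto simp: kernel_coeff_def divide_le_eq_1 zero_less_binomial_iff)

lemma kernel_coeff_0: "kernel_coeff N 0 = 1"
  by (simp add: kernel_coeff_def)

lemma half_one_plus_cos_nonneg: "0 \<le> (1 + cos u) / (2 :: real)"
  using add_mono[OF order_refl[of 1] cos_ge_minus_one[of u]] by (intro divide_nonneg_pos) simp_all

lemma kernel1_nonneg: "kernel1 N t \<ge> 0"
  unfolding kernel1_def
  by (intro mult_nonneg_nonneg zero_le_power half_one_plus_cos_nonneg) simp_all

text \<open>Binomial expansion of (e^(i pi t) + e^(-i pi t))^(2N): the \<open>j\<close>-th term has
  frequency \<open>j - N\<close>, and \<open>4 ^ N\<close> cancels the denominator 2^(2N) of the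
  cosine power.\<close>

lemma kernel1_expansion:
  "complex_of_real (kernel1 N t)
     = (\<Sum>k\<in>{- int N..int N}. of_real (kernel_coeff N k) * cis (2 * pi * (of_int k * t)))"
proof -
  let ?C = "of_nat ((2 * N) choose N) :: complex"
  have half: "complex_of_real ((1 + cos (2 * pi * t)) / 2) = ((cis (pi * t) + cis (- (pi * t))) / 2)\<^sup>2"
  proof -
    have "(1 + cos (2 * pi * t)) / 2 = (cos (pi * t))\<^sup>2"
      using cos_double_cos[of "pi * t"] by (simp add: mult_ac)
    moreover have "(cis (pi * t) + cis (- (pi * t))) / 2 = of_real (cos (pi * t))"
      by (simp add: complex_eq_iff)
    ultimately show ?thesis by simp
  qed
  have "complex_of_real (kernel1 N t) = 4 ^ N / ?C * ((cis (pi * t) + cis (- (pi * t))) / 2) ^ (2 * N)"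
    unfolding kernel1_def of_real_mult of_real_power half by (simp add: power_mult)
  also have "\<dots> = (cis (pi * t) + cis (- (pi * t))) ^ (2 * N) / ?C"
    by (simp add: power_divide power_mult)
  also have "\<dots> = (\<Sum>j\<le>2 * N. of_nat ((2 * N) choose j) * cis (pi * t) ^ j * cis (- (pi * t)) ^ (2 * N - j)) / ?C"
    by (simp add: binomial_ring)
  also have "\<dots> = (\<Sum>j\<le>2 * N. of_real (kernel_coeff N (int j - int N)) * cis (2 * pi * (of_int (int j - int N) * t)))"
    unfolding sum_divide_distrib
  proof (rule sum.cong)
    fix j
    assume "j \<in> {..2 * N}"
    then have "cis (pi * t) ^ j * cis (- (pi * t)) ^ (2 * N - j) = cis (2 * pi * (of_int (int j - int N) * t))"
      by (simp add: Complex.DeMoivre cis_mult of_nat_diff algebra_simps)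
    then show "of_nat ((2 * N) choose j) * cis (pi * t) ^ j * cis (- (pi * t)) ^ (2 * N - j) / ?C
      = of_real (kernel_coeff N (int j - int N)) * cis (2 * pi * (of_int (int j - int N) * t))"
      by (simp add: kernel_coeff_def mult.assoc)
  qed simp
  also have "\<dots> = (\<Sum>k\<in>{- int N..int N}. of_real (kernel_coeff N k) * cis (2 * pi * (of_int k * t)))"
    by (rule sum.reindex_bij_witness[of _ "\<lambda>k. nat (k + int N)" "\<lambda>j. int j - int N"]) auto
  finally show ?thesis .
qed

definition lattice_box :: "nat \<Rightarrow> (int ^ 'd) set" where
  "lattice_box N = {k. \<forall>i. \<bar>k $ i\<bar> \<le> int N}"

lemma lattice_box_eq_image: "lattice_box N = vec_lambda ` (UNIV \<rightarrow>\<^sub>E {- int N..int N})"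
proof (intro equalityI subsetI)
  fix k :: "int ^ 'd"
  assume "k \<in> lattice_box N"
  then have "vec_nth k \<in> UNIV \<rightarrow>\<^sub>E {- int N..int N}"
    by (auto simp: lattice_box_def abs_le_iff) (metis minus_le_iff)
  then show "k \<in> vec_lambda ` (UNIV \<rightarrow>\<^sub>E {- int N..int N})"
    by (metis imageI vec_nth_inverse)
next
  fix k :: "int ^ 'd"
  assume "k \<in> vec_lambda ` (UNIV \<rightarrow>\<^sub>E {- int N..int N})"
  then show "k \<in> lattice_box N"
    by (auto simp: lattice_box_def PiE_iff abs_le_iff) (metis minus_le_iff)
qed

lemma finite_lattice_box [simp]: "finite (lattice_box N)"
  unfolding lattice_box_eq_image by (intro finite_imageI finite_PiE) auto

definition kernel :: "nat \<Rightarrow> real ^ 'd \<Rightarrow> real" where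
  "kernel N x = (\<Prod>i\<in>UNIV. kernel1 N (x $ i))"

lemma kernel_nonneg: "kernel N x \<ge> 0"
  by (auto simp: kernel_def intro!: prod_nonneg kernel1_nonneg)

lemma kernel_expansion:
  "complex_of_real (kernel N x)
     = (\<Sum>k\<in>lattice_box N. of_real (\<Prod>i\<in>UNIV. kernel_coeff N (k $ i)) * wave (int_vec k) x)"
proof -
  have "complex_of_real (kernel N x) = (\<Sum>g\<in>UNIV \<rightarrow>\<^sub>E {- int N..int N}.
      \<Prod>i\<in>UNIV. of_real (kernel_coeff N (g i)) * cis (2 * pi * (of_int (g i) * x $ i)))"
    unfolding kernel_def of_real_prod kernel1_expansion by (rule prod_sum_PiE) auto
  also have "\<dots> = (\<Sum>k\<in>lattice_box N.
      \<Prod>i\<in>UNIV. of_real (kernel_coeff N (k $ i)) * cis (2 * pi * (of_int (k $ i) * x $ i)))"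
    unfolding lattice_box_eq_image
    by (subst sum.reindex) (auto simp: inj_on_def vec_lambda_inject)
  also have "\<dots> = (\<Sum>k\<in>lattice_box N. of_real (\<Prod>i\<in>UNIV. kernel_coeff N (k $ i)) * wave (int_vec k) x)"
    by (simp add: prod.distrib prod_cis wave_def int_vec_def inner_eq_sum_nth sum_distrib_left)
  finally show ?thesis .
qed

lemma measurable_kernel [measurable]: "kernel N \<in> borel_measurable borel"
  unfolding kernel_def[abs_def] kernel1_def by measurable

lemma kernel_add_int: "kernel N (x + int_vec m) = kernel N x"
proof -
  have "complex_of_real (kernel N (x + int_vec m)) = of_real (kernel N x)"
    by (simp only: kernel_expansion wave_add_right wave_int_int mult_1_right)
  then show ?thesis
    by (simp only: of_real_eq_iff)
qed

text \<open>Half-open, so that its integer translates partition the space; centred, so that the peak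
  of the kernel at 0 lies in the interior and no other peak comes near.\<close>

definition centered_cube :: "(real ^ 'd) set" where
  "centered_cube = {x. \<forall>i. x $ i \<in> {- (1 / 2)..<1 / 2}}"

lemma emeasure_centered_cube_finite: "emeasure lborel (centered_cube :: (real ^ 'd) set) < \<infinity>"
proof -
  have "emeasure lborel (centered_cube :: (real ^ 'd) set)
      \<le> emeasure lborel (cbox (\<chi> i. - 1) (\<chi> i. 1) :: (real ^ 'd) set)"
  proof (intro emeasure_mono subsetI)
    fix x :: "real ^ 'd"
    assume "x \<in> centered_cube"
    then have "- (1 / 2) \<le> x $ i \<and> x $ i < 1 / 2" for i
      by (simp add: centered_cube_def)
    then have "- 1 \<le> x $ i \<and> x $ i \<le> 1" for i
      by (smt (verit) field_sum_of_halves)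
    then show "x \<in> cbox (\<chi> i. - 1) (\<chi> i. 1)"
      by (simp add: mem_box_cart)
  qed simp
  then show ?thesis
    using emeasure_lborel_cbox_finite by (rule le_less_trans)
qed

lemma sets_centered_cube [measurable]: "(centered_cube :: (real ^ 'd) set) \<in> sets borel"
  unfolding centered_cube_def by measurable

text \<open>The normalisation grows only linearly in \<open>N\<close>, by the lower bound 4^N / (2N)
  for the central binomial coefficient, so it cannot compensate the geometric decay away from the
  peaks.\<close>

lemma kernel1_le:
  assumes "N > 0" "(1 + cos (2 * pi * t)) / 2 \<le> q"
  shows "kernel1 N t \<le> 2 * real N * q ^ N"
  unfolding kernel1_def
proof (rule mult_mono)
  show "4 ^ N / real ((2 * N) choose N) \<le> 2 * real N"
    using central_binomial_lower_bound[OF assms(1)] assms(1) by (simp add: field_simps)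
  show "((1 + cos (2 * pi * t)) / 2) ^ N \<le> q ^ N"
    using assms half_one_plus_cos_nonneg by (intro power_mono) auto
  show "0 \<le> ((1 + cos (2 * pi * t)) / 2) ^ N"
    by (intro zero_le_power half_one_plus_cos_nonneg)
qed (use assms in auto)

text \<open>A single coordinate away from its peak supplies \<open>q ^ N\<close>; every other factor
  is at most \<open>2 * real N\<close>.\<close>

lemma kernel_le:
  fixes x :: "real ^ 'd"
  assumes "N > 0" "(1 + cos (2 * pi * x $ i)) / 2 \<le> q" "0 \<le> q"
  shows "kernel N x \<le> (2 * real N) ^ CARD('d) * q ^ N"
proof -
  have "kernel N x = kernel1 N (x $ i) * (\<Prod>j\<in>UNIV - {i}. kernel1 N (x $ j))"
    by (simp add: kernel_def prod.remove[of UNIV i])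
  also have "\<dots> \<le> (2 * real N * q ^ N) * (\<Prod>j\<in>UNIV - {i}. 2 * real N)"
  proof (rule mult_mono)
    show "(\<Prod>j\<in>UNIV - {i}. kernel1 N (x $ j)) \<le> (\<Prod>j\<in>UNIV - {i}. 2 * real N)"
    proof (rule prod_mono)
      fix j
      show "0 \<le> kernel1 N (x $ j) \<and> kernel1 N (x $ j) \<le> 2 * real N"
        using kernel1_le[OF assms(1), of "x $ j" 1] kernel1_nonneg by simp
    qed
  qed (use assms in \<open>auto intro!: kernel1_le prod_nonneg kernel1_nonneg\<close>)
  also have "\<dots> = (2 * real N) ^ CARD('d) * q ^ N"
    by (simp add: card_Diff_singleton power_eq_if[of _ "CARD('d)"])
  finally show ?thesis .
qed

text \<open>The \<open>+ 1\<close> covers \<open>N = 0\<close>, where the kernel is constantly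
  1.\<close>

lemma kernel_le_const: "kernel N x \<le> (2 * real N + 1) ^ CARD('d)" for x :: "real ^ 'd"
proof -
  have "kernel1 N t \<le> 2 * real N + 1" for t
    using kernel1_le[of N t 1] by (cases "N > 0") (auto simp: kernel1_def)
  then have "kernel N x \<le> (\<Prod>i\<in>(UNIV :: 'd set). 2 * real N + 1)"
    unfolding kernel_def by (intro prod_mono conjI kernel1_nonneg)
  then show ?thesis by simp
qed

lemma integrable_cube_kernel:
  "integrable lborel (\<lambda>x :: real ^ 'd. indicator centered_cube x * kernel N x)"
proof -
  have "norm (kernel N x) \<le> (2 * real N + 1) ^ CARD('d)" for x :: "real ^ 'd"
    using kernel_nonneg[of N x] kernel_le_const[of N x] by simp
  from integrable_indicator_scaleR_bounded[OF sets_centered_cube measurable_kernel emeasure_centered_cube_finite this]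
  show ?thesis
    by simp
qed

lemma integral_cube_kernel:
  "(LINT x|lborel. indicator centered_cube x * kernel N (x :: real ^ 'd)) = 1"
proof -
  have int: "integrable lborel (\<lambda>x :: real ^ 'd. indicator centered_cube x *\<^sub>R wave (int_vec k) x)" for k
    by (rule integrable_indicator_scaleR_bounded[OF _ _ emeasure_centered_cube_finite, where C = 1]) auto
  define c where "c = (\<lambda>k :: int ^ 'd. complex_of_real (\<Prod>i\<in>UNIV. kernel_coeff N (k $ i)))"
  have wave: "(LINT x|lborel. indicator centered_cube x *\<^sub>R wave (int_vec k) x) = of_bool (k = 0)" for k :: "int ^ 'd"
    unfolding centered_cube_def
    by (rule integral_unit_box_wave[where a = "- (1 / 2)"]) (auto simp: subset_eq)
  have "complex_of_real (LINT x|lborel. indicator centered_cube x * kernel N (x :: real ^ 'd))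
      = (LINT x|lborel. complex_of_real (indicator centered_cube x * kernel N (x :: real ^ 'd)))"
    by (rule integral_complex_of_real[symmetric])
  also have "\<dots> = (LINT x|lborel. (\<Sum>k\<in>lattice_box N. c k * (indicator centered_cube x *\<^sub>R wave (int_vec k) x)))"
    unfolding of_real_mult kernel_expansion sum_distrib_left c_def
    by (intro Bochner_Integration.integral_cong sum.cong) (simp_all add: scaleR_conv_of_real mult_ac)
  also have "\<dots> = (\<Sum>k\<in>lattice_box N. (LINT x|lborel. c k * (indicator centered_cube x *\<^sub>R wave (int_vec k) x)))"
    by (intro Bochner_Integration.integral_sum integrable_mult_right int)
  also have "\<dots> = (\<Sum>k\<in>lattice_box N. c k * of_bool (k = 0))"
    by (simp only: integral_mult_right_zero wave)
  also have "\<dots> = (\<Sum>k\<in>(lattice_box N :: (int ^ 'd) set). if k = 0 then 1 else 0)"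
    by (intro sum.cong) (auto simp: c_def kernel_coeff_0)
  also have "\<dots> = 1"
    by (subst sum.delta[OF finite_lattice_box]) (auto simp: lattice_box_def)
  finally show ?thesis
    by (simp only: of_real_eq_1_iff)
qed

lemma power_times_geometric_tendsto_0:
  fixes q :: real
  assumes "0 < q" "q < 1"
  shows "(\<lambda>N. (c * real N) ^ k * q ^ N) \<longlonglongrightarrow> 0"
proof -
  let ?L = "- ln q"
  have L: "?L > 0"
    using assms by simp
  have "filterlim (\<lambda>N. ?L * real N) at_top sequentially"
    using L by (intro filterlim_tendsto_pos_mult_at_top[OF tendsto_const _ filterlim_real_sequentially])
  then have "(\<lambda>N. (c / ?L) ^ k * ((?L * real N) ^ k / exp (?L * real N))) \<longlonglongrightarrow> (c / ?L) ^ k * 0"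
    by (intro tendsto_intros filterlim_compose[OF tendsto_power_div_exp_0])
  moreover have "(c / ?L) ^ k * ((?L * real N) ^ k / exp (?L * real N)) = (c * real N) ^ k * q ^ N" for N
  proof -
    have "exp (?L * real N) = inverse (q ^ N)"
      using assms by (simp add: exp_minus mult.commute[of "ln q"] exp_of_nat_mult)
    moreover have "(c / ?L) ^ k * (?L * real N) ^ k = (c * real N) ^ k"
      using L by (simp flip: power_mult_distrib)
    ultimately show ?thesis
      by (simp add: divide_inverse mult.assoc[symmetric])
  qed
  ultimately show ?thesis by simp
qed

text \<open>An approximate identity on one cell. Near 0 the continuity of \<open>\<phi>\<close>
  makes the integrand small against the unit mass of the kernel; elsewhere in the cell some
  coordinate is at least \<eta>, and the kernel itself tends to 0 uniformly.\<close>

lemma kernel_concentration: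
  fixes \<phi> :: "real ^ 'd \<Rightarrow> real"
  assumes [measurable]: "\<phi> \<in> borel_measurable borel" and cont: "isCont \<phi> 0" and bound: "\<And>x. \<bar>\<phi> x\<bar> \<le> M"
  shows "(\<lambda>N. LINT x|lborel. indicator centered_cube x * (\<phi> x * kernel N x)) \<longlonglongrightarrow> \<phi> 0"
proof (rule LIMSEQ_I)
  fix r :: real
  assume r: "r > 0"
  let ?Q = "centered_cube :: (real ^ 'd) set"
  obtain \<delta> where \<delta>: "\<delta> > 0" "\<And>x. norm x < \<delta> \<Longrightarrow> \<bar>\<phi> x - \<phi> 0\<bar> < r / 2"
    using cont r unfolding continuous_at_eps_delta dist_norm
    by (metis diff_zero half_gt_zero real_norm_def)
  \<comment> \<open>The divisor \<open>2 * CARD('d)\<close> makes coordinates below \<eta> force a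
    norm below \<delta> through the l1 norm; the bound 1/2 keeps \<open>2 * pi * \<eta>\<close> in
    the range where the cosine decreases.\<close>
  define \<eta> where "\<eta> = min (\<delta> / (2 * CARD('d))) (1 / 2)"
  have \<eta>: "0 < \<eta>" "\<eta> \<le> 1 / 2" "real CARD('d) * \<eta> < \<delta>"
  proof -
    have "real CARD('d) * \<eta> \<le> real CARD('d) * (\<delta> / (2 * CARD('d)))"
      by (intro mult_left_mono) (auto simp: \<eta>_def)
    also have "\<dots> < \<delta>"
      using \<delta> by simp
    finally show "real CARD('d) * \<eta> < \<delta>" .
  qed (use \<delta> in \<open>auto simp: \<eta>_def\<close>)
  \<comment> \<open>The maximum with 1/2 secures \<open>q > 0\<close>: for \<eta> = 1/2 the second
    term is 0.\<close>
  define q where "q = max (1 / 2) ((1 + cos (2 * pi * \<eta>)) / 2)"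
  have "cos (2 * pi * \<eta>) < cos 0"
    using \<eta> by (intro cos_monotone_0_pi) auto
  then have q: "0 < q" "q < 1"
    by (auto simp: q_def)
  have M: "M \<ge> 0"
    using bound[of 0] by linarith
  define b where "b = (\<lambda>N. (2 * real N) ^ CARD('d) * q ^ N)"
  define V where "V = measure lborel ?Q"
  have "(\<lambda>N. 2 * M * b N * V) \<longlonglongrightarrow> 2 * M * 0 * V"
    unfolding b_def by (intro tendsto_intros power_times_geometric_tendsto_0 q)
  then have "\<forall>\<^sub>F N in sequentially. 2 * M * b N * V < r / 2"
    using r by (intro order_tendstoD(2)[of _ 0]) auto
  then have "\<forall>\<^sub>F N in sequentially.
      norm ((LINT x|lborel. indicator ?Q x * (\<phi> x * kernel N x)) - \<phi> 0) < r"
    using eventually_gt_at_top[of 0]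
  proof eventually_elim
    case (elim N)
    have pt: "\<bar>(\<phi> x - \<phi> 0) * kernel N x\<bar> \<le> r / 2 * kernel N x + 2 * M * b N" if "x \<in> ?Q" for x
    proof (cases "\<exists>i. \<bar>x $ i\<bar> \<ge> \<eta>")
      case True
      then obtain i where i: "\<bar>x $ i\<bar> \<ge> \<eta>" by blast
      have "\<bar>x $ i\<bar> \<le> 1 / 2"
        using that by (auto simp: centered_cube_def abs_le_iff dest!: spec[of _ i])
      then have "cos (2 * pi * \<bar>x $ i\<bar>) \<le> cos (2 * pi * \<eta>)"
        using i \<eta> by (intro cos_monotone_0_pi_le) auto
      moreover have "cos (2 * pi * \<bar>x $ i\<bar>) = cos (2 * pi * x $ i)"
        by (simp add: abs_if)
      ultimately have "(1 + cos (2 * pi * x $ i)) / 2 \<le> q"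
        by (simp add: q_def max_def)
      then have "kernel N x \<le> b N"
        unfolding b_def using elim q by (intro kernel_le[of _ _ i]) auto
      moreover have "\<bar>\<phi> x - \<phi> 0\<bar> \<le> 2 * M"
        using bound[of x] bound[of 0] by linarith
      ultimately have "\<bar>\<phi> x - \<phi> 0\<bar> * kernel N x \<le> 2 * M * b N"
        using M kernel_nonneg[of N x] by (intro mult_mono) auto
      then show ?thesis
        using kernel_nonneg[of N x] r by (simp add: abs_mult add_increasing)
    next
      case False
      have "norm x \<le> (\<Sum>i\<in>UNIV. \<bar>x $ i\<bar>)"
        by (rule norm_le_l1_cart)
      also have "\<dots> \<le> (\<Sum>i\<in>(UNIV :: 'd set). \<eta>)"
        using False by (intro sum_mono) (auto simp: not_le intro: less_imp_le)
      also have "\<dots> < \<delta>"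
        using \<eta> by simp
      finally have "\<bar>\<phi> x - \<phi> 0\<bar> \<le> r / 2"
        using \<delta>(2) less_imp_le by blast
      then have "\<bar>\<phi> x - \<phi> 0\<bar> * kernel N x \<le> r / 2 * kernel N x"
        by (intro mult_right_mono kernel_nonneg)
      moreover have "0 \<le> 2 * M * b N"
        using M q by (simp add: b_def)
      ultimately show ?thesis
        using kernel_nonneg[of N x] by (simp add: abs_mult)
    qed
    have int1: "integrable lborel (\<lambda>x. indicator ?Q x * (\<phi> x * kernel N x))"
    proof (rule Bochner_Integration.integrable_bound)
      show "integrable lborel (\<lambda>x. M * (indicator ?Q x * kernel N x))"
        by (intro integrable_mult_right integrable_cube_kernel)
      show "AE x in lborel. norm (indicator ?Q x * (\<phi> x * kernel N x)) \<le> norm (M * (indicator ?Q x * kernel N x))"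
        using bound M kernel_nonneg
        by (intro AE_I2) (auto simp: abs_mult indicator_def intro!: mult_right_mono order_trans[OF bound])
    qed measurable
    have intV: "integrable lborel (indicator ?Q :: real ^ 'd \<Rightarrow> real)"
      using emeasure_centered_cube_finite by (intro integrable_real_indicator) auto
    have "(LINT x|lborel. indicator ?Q x * (\<phi> x * kernel N x)) - \<phi> 0
        = (LINT x|lborel. indicator ?Q x * (\<phi> x * kernel N x)) - \<phi> 0 * (LINT x|lborel. indicator ?Q x * kernel N x)"
      by (simp add: integral_cube_kernel)
    also have "\<dots> = (LINT x|lborel. indicator ?Q x * (\<phi> x * kernel N x) - \<phi> 0 * (indicator ?Q x * kernel N x))"
      by (subst Bochner_Integration.integral_diff) (auto intro: int1 integrable_cube_kernel)
    also have "norm \<dots> \<le> (LINT x|lborel. norm (indicator ?Q x * (\<phi> x * kernel N x) - \<phi> 0 * (indicator ?Q x * kernel N x)))"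
      by (rule integral_norm_bound)
    also have "\<dots> \<le> (LINT x|lborel. r / 2 * (indicator ?Q x * kernel N x) + 2 * M * b N * indicator ?Q x)"
    proof (rule integral_mono)
      show "norm (indicator ?Q x * (\<phi> x * kernel N x) - \<phi> 0 * (indicator ?Q x * kernel N x))
          \<le> r / 2 * (indicator ?Q x * kernel N x) + 2 * M * b N * indicator ?Q x" for x
        using pt[of x] by (auto simp: indicator_def left_diff_distrib)
    qed (intro integrable_norm Bochner_Integration.integrable_diff Bochner_Integration.integrable_add
        integrable_mult_right int1 integrable_cube_kernel intV)+
    also have "\<dots> = r / 2 + 2 * M * b N * V"
      by (subst Bochner_Integration.integral_add) (auto simp: integral_cube_kernel V_def intro!: integrable_cube_kernel intV)
    finally show ?case
      using elim(1) by linarith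
  qed
  then show "\<exists>no. \<forall>N\<ge>no. norm ((LINT x|lborel. indicator ?Q x * (\<phi> x * kernel N x)) - \<phi> 0) < r"
    by (simp add: eventually_sequentially)
qed

section \<open>Poisson summation as an inequality\<close>

lemma integral_lborel_translation:
  fixes f :: "'a::euclidean_space \<Rightarrow> 'b::{banach, second_countable_topology}"
  assumes [measurable]: "f \<in> borel_measurable borel"
  shows "(LINT x|lborel. f (t + x)) = (LINT x|lborel. f x)"
proof -
  have "(LINT x|lborel. f x) = (LINT x|distr lborel borel ((+) t). f x)"
    by (simp add: lborel_distr_plus)
  also have "\<dots> = (LINT x|lborel. f (t + x))"
    by (subst integral_distr) auto
  finally show ?thesis ..
qed

lemma diff_int_vec_in_centered_cube:
  "x - int_vec m \<in> centered_cube \<longleftrightarrow> m = (\<chi> i. \<lfloor>x $ i + 1 / 2\<rfloor>)"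
proof -
  have "- (1 / 2) \<le> x $ i - of_int (m $ i) \<and> x $ i - of_int (m $ i) < 1 / 2 \<longleftrightarrow> m $ i = \<lfloor>x $ i + 1 / 2\<rfloor>" for i
    by linarith
  then show ?thesis
    by (simp add: centered_cube_def int_vec_def vec_eq_iff)
qed

lemma sum_tiles:
  assumes "\<And>i. \<bar>x $ i\<bar> \<le> real R"
  shows "(\<Sum>m\<in>lattice_box (Suc R). indicator centered_cube (x - int_vec m) :: real) = 1"
proof -
  let ?m = "\<chi> i. \<lfloor>x $ i + 1 / 2\<rfloor>"
  have "\<bar>\<lfloor>x $ i + 1 / 2\<rfloor>\<bar> \<le> int (Suc R)" for i
    using assms[of i] by linarith
  then have "?m \<in> lattice_box (Suc R)"
    by (simp add: lattice_box_def)
  then show ?thesis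
    by (simp add: indicator_def diff_int_vec_in_centered_cube)
qed

lemma continuous_compact_support_bounded:
  fixes F :: "real ^ 'd \<Rightarrow> real"
  assumes cont: "continuous_on UNIV F" and supp: "\<And>x. F x \<noteq> 0 \<Longrightarrow> x \<in> K" and K: "compact K"
  obtains M where "\<And>x. \<bar>F x\<bar> \<le> M"
proof -
  have "compact (F ` K)"
    using cont K by (intro compact_continuous_image continuous_on_subset[OF cont]) auto
  then obtain M where M: "\<And>y. y \<in> F ` K \<Longrightarrow> norm y \<le> M"
    using compact_imp_bounded bounded_iff by metis
  have "\<bar>F x\<bar> \<le> max M 0" for x
    using M[of "F x"] supp[of x] by (cases "F x = 0") (auto simp: image_def intro: max.coboundedI1)
  then show ?thesis
    by (rule that)
qed

lemma integrable_continuous_compact_support: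
  fixes F :: "real ^ 'd \<Rightarrow> real"
  assumes cont: "continuous_on UNIV F" and supp: "\<And>x. F x \<noteq> 0 \<Longrightarrow> x \<in> K" and K: "compact K"
  shows "integrable lborel F"
proof -
  have "integrable lborel (\<lambda>x. indicator K x *\<^sub>R F x)"
    by (intro borel_integrable_compact K continuous_on_subset[OF cont]) auto
  also have "(\<lambda>x. indicator K x *\<^sub>R F x) = F"
    using supp by (auto simp: fun_eq_iff indicator_def)
  finally show ?thesis .
qed

text \<open>The exponent carries a plus sign. As \<open>f\<close> is real, this is the complex
  conjugate of the transform with a minus sign, and only moduli enter the estimates.\<close>

definition fourier :: "(real ^ 'd \<Rightarrow> real) \<Rightarrow> real ^ 'd \<Rightarrow> complex" where
  "fourier f \<xi> = (LINT x|lborel. f x *\<^sub>R wave \<xi> x)"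

lemma integrable_scaleR_wave:
  assumes "integrable lborel f"
  shows "integrable lborel (\<lambda>x. f x *\<^sub>R wave \<xi> x)"
proof -
  have [measurable]: "f \<in> borel_measurable borel"
    using borel_measurable_integrable[OF assms] by simp
  show ?thesis
    by (rule Bochner_Integration.integrable_bound[OF assms]) auto
qed

text \<open>The integral of \<open>F\<close> against the kernel is evaluated twice. Expanding the
  kernel gives \<open>LINT x|lborel. F x\<close> from frequency 0 plus Fourier coefficients with
  weights in [0, 1], so the bound holds for every \<open>N\<close>, possibly with an infinite right
  side. Letting \<open>N\<close> grow gives the lattice sum.\<close>

proposition poisson_bound:
  fixes F :: "real ^ 'd \<Rightarrow> real"
  assumes cont: "continuous_on UNIV F" and supp: "\<And>x i. F x \<noteq> 0 \<Longrightarrow> \<bar>x $ i\<bar> \<le> real R"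
  shows "ennreal \<bar>(\<Sum>m\<in>lattice_box (Suc R). F (int_vec m)) - (LINT x|lborel. F x)\<bar>
    \<le> (\<integral>\<^sup>+k. ennreal (cmod (fourier F (int_vec k))) \<partial>count_space (UNIV - {0}))"
proof -
  have supp': "F x \<noteq> 0 \<Longrightarrow> x \<in> cbox (\<chi> i. - real R) (\<chi> i. real R)" for x
    using supp[of x] by (auto simp: mem_box_cart abs_le_iff) (metis minus_le_iff)
  obtain M where M: "\<And>x. \<bar>F x\<bar> \<le> M"
    using continuous_compact_support_bounded[OF cont supp' compact_cbox] by blast
  have int: "integrable lborel F"
    by (rule integrable_continuous_compact_support[OF cont supp' compact_cbox])
  then have [measurable]: "F \<in> borel_measurable borel"
    using borel_measurable_integrable by fastforce
  have intK: "integrable lborel (\<lambda>x. F x * kernel N x)" for N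
  proof (rule Bochner_Integration.integrable_bound)
    show "integrable lborel (\<lambda>x. F x * (2 * real N + 1) ^ CARD('d))"
      using int by simp
    show "AE x in lborel. norm (F x * kernel N x) \<le> norm (F x * (2 * real N + 1) ^ CARD('d))"
    proof (intro AE_I2)
      fix x :: "real ^ 'd"
      show "norm (F x * kernel N x) \<le> norm (F x * (2 * real N + 1) ^ CARD('d))"
        using kernel_le_const[of N x] kernel_nonneg[of N x] by (auto simp: abs_mult intro!: mult_left_mono)
    qed
  qed measurable
  define I where "I = (\<lambda>N. LINT x|lborel. F x * kernel N x)"
  define T where "T = (\<integral>\<^sup>+k. ennreal (cmod (fourier F (int_vec k))) \<partial>count_space (UNIV - {0 :: int ^ 'd}))"
  have le: "ennreal \<bar>I N - (LINT x|lborel. F x)\<bar> \<le> T" for N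
  proof -
    define c where "c = (\<lambda>k :: int ^ 'd. \<Prod>i\<in>UNIV. kernel_coeff N (k $ i))"
    have c: "0 \<le> c k" "c k \<le> 1" for k
      by (auto simp: c_def intro!: prod_nonneg prod_le_1 kernel_coeff_bounds)
    have c0: "c 0 = 1"
      by (simp add: c_def kernel_coeff_0)
    have zero: "0 \<in> (lattice_box N :: (int ^ 'd) set)"
      by (simp add: lattice_box_def)
    have "complex_of_real (I N) = (LINT x|lborel. complex_of_real (F x * kernel N x))"
      unfolding I_def by (rule integral_complex_of_real[symmetric])
    also have "\<dots> = (LINT x|lborel. (\<Sum>k\<in>lattice_box N. of_real (c k) * (F x *\<^sub>R wave (int_vec k) x)))"
      unfolding of_real_mult kernel_expansion sum_distrib_left c_def
      by (intro Bochner_Integration.integral_cong sum.cong) (simp_all add: scaleR_conv_of_real mult_ac)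
    also have "\<dots> = (\<Sum>k\<in>lattice_box N. (LINT x|lborel. of_real (c k) * (F x *\<^sub>R wave (int_vec k) x)))"
      by (intro Bochner_Integration.integral_sum integrable_mult_right integrable_scaleR_wave int)
    also have "\<dots> = (\<Sum>k\<in>lattice_box N. of_real (c k) * fourier F (int_vec k))"
      by (simp only: integral_mult_right_zero fourier_def)
    also have "\<dots> = fourier F (int_vec 0) + (\<Sum>k\<in>lattice_box N - {0}. of_real (c k) * fourier F (int_vec k))"
      using zero by (simp add: sum.remove[of _ 0] c0)
    also have "fourier F (int_vec (0 :: int ^ 'd)) = (LINT x|lborel. complex_of_real (F x))"
    proof -
      have "int_vec (0 :: int ^ 'd) = 0"
        by (simp add: int_vec_def vec_eq_iff)
      then show ?thesis
        by (simp add: fourier_def scaleR_conv_of_real)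
    qed
    finally have eq: "complex_of_real (I N - (LINT x|lborel. F x))
        = (\<Sum>k\<in>lattice_box N - {0}. of_real (c k) * fourier F (int_vec k))"
      by simp
    have "\<bar>I N - (LINT x|lborel. F x)\<bar> = cmod (complex_of_real (I N - (LINT x|lborel. F x)))"
      by (simp only: norm_of_real)
    also have "\<dots> \<le> (\<Sum>k\<in>lattice_box N - {0}. cmod (of_real (c k) * fourier F (int_vec k)))"
      unfolding eq by (rule norm_sum)
    also have "\<dots> \<le> (\<Sum>k\<in>lattice_box N - {0}. cmod (fourier F (int_vec k)))"
      using c by (intro sum_mono) (auto simp: norm_mult intro!: mult_left_le_one_le)
    finally have "ennreal \<bar>I N - (LINT x|lborel. F x)\<bar>
        \<le> (\<Sum>k\<in>lattice_box N - {0}. ennreal (cmod (fourier F (int_vec k))))"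
      by (simp add: sum_ennreal ennreal_leI)
    also have "\<dots> = (\<integral>\<^sup>+k. ennreal (cmod (fourier F (int_vec k))) \<partial>count_space (lattice_box N - {0}))"
      by (simp add: nn_integral_count_space_finite)
    also have "\<dots> \<le> T"
      unfolding T_def nn_integral_count_space_indicator[of "_ - _"]
      by (subst (1 2) nn_integral_count_space_indicator) (auto intro!: nn_integral_mono simp: indicator_def)
    finally show ?thesis .
  qed
  \<comment> \<open>Second evaluation: cut the integral into integer translates of the cell. By
    periodicity each piece sees the same kernel, which concentrates at the lattice point in its
    centre; finitely many pieces meet the support.\<close>
  have "I \<longlonglongrightarrow> (\<Sum>m\<in>lattice_box (Suc R). F (int_vec m))"
  proof -
    have I: "I N = (\<Sum>m\<in>lattice_box (Suc R).
        LINT x|lborel. indicator centered_cube x * (F (int_vec m + x) * kernel N x))" for N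
    proof -
      have tile: "F x = (\<Sum>m\<in>lattice_box (Suc R). indicator centered_cube (x - int_vec m) * F x)" for x
        using sum_tiles[of x R] supp[of x] by (cases "F x = 0") (auto simp flip: sum_distrib_right)
      have "I N = (LINT x|lborel. (\<Sum>m\<in>lattice_box (Suc R).
          indicator centered_cube (x - int_vec m) * (F x * kernel N x)))"
        unfolding I_def by (subst tile) (simp add: sum_distrib_right mult.assoc)
      also have "\<dots> = (\<Sum>m\<in>lattice_box (Suc R). LINT x|lborel.
          indicator centered_cube (x - int_vec m) * (F x * kernel N x))"
      proof (rule Bochner_Integration.integral_sum)
        fix m :: "int ^ 'd"
        have [measurable]: "(\<lambda>x :: real ^ 'd. indicator centered_cube (x - int_vec m) :: real) \<in> borel_measurable borel"
          by measurable
        show "integrable lborel (\<lambda>x. indicator centered_cube (x - int_vec m) * (F x * kernel N x))"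
          by (rule Bochner_Integration.integrable_bound[OF intK[of N]]) (auto simp: indicator_def)
      qed
      also have "\<dots> = (\<Sum>m\<in>lattice_box (Suc R).
        LINT x|lborel. indicator centered_cube x * (F (int_vec m + x) * kernel N x))"
      proof (rule sum.cong)
        fix m :: "int ^ 'd"
        show "(LINT x|lborel. indicator centered_cube (x - int_vec m) * (F x * kernel N x))
            = (LINT x|lborel. indicator centered_cube x * (F (int_vec m + x) * kernel N x))"
          by (subst integral_lborel_translation[symmetric, where t = "int_vec m"])
            (auto simp: add.commute[of "int_vec m"] kernel_add_int)
      qed simp
      finally show ?thesis .
    qed
    have "(\<lambda>N. LINT x|lborel. indicator centered_cube x * (F (int_vec m + x) * kernel N x)) \<longlonglongrightarrow> F (int_vec m + 0)" for m :: "int ^ 'd"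
    proof (rule kernel_concentration)
      have "continuous_on UNIV (\<lambda>x. F (int_vec m + x))"
        by (rule continuous_on_compose2[OF cont]) (auto intro!: continuous_intros)
      then show "isCont (\<lambda>x. F (int_vec m + x)) 0"
        by (simp add: continuous_on_eq_continuous_at)
      show "\<bar>F (int_vec m + x)\<bar> \<le> M" for x
        by (rule M)
      show "(\<lambda>x. F (int_vec m + x)) \<in> borel_measurable borel"
        by measurable
    qed
    then show ?thesis
      unfolding I by (intro tendsto_sum) simp
  qed
  then have "(\<lambda>N. ennreal \<bar>I N - (LINT x|lborel. F x)\<bar>)
      \<longlonglongrightarrow> ennreal \<bar>(\<Sum>m\<in>lattice_box (Suc R). F (int_vec m)) - (LINT x|lborel. F x)\<bar>"
    by (intro tendsto_ennrealI tendsto_intros)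
  then show ?thesis
    unfolding T_def[symmetric] by (rule LIMSEQ_le_const2) (use le in blast)
qed

section \<open>The quadrature error\<close>

text \<open>As a rewrite rule this turns \<open>transpose A *v x\<close> into a row-vector product
  and would destroy the form in which the quadrature nodes are stated.\<close>

declare transpose_matrix_vector [simp del]

lemma wave_matrix: "wave \<xi> (transpose S *v y) = wave (S *v \<xi>) y"
  unfolding wave_def dot_lmul_matrix[symmetric] vector_transpose_matrix ..

lemma
  fixes S :: "real ^ 'd ^ 'd"
  assumes "det S \<noteq> 0"
  shows transpose_mult_inv_transpose: "transpose S *v (transpose (matrix_inv S) *v z) = z"
    and inv_transpose_mult_transpose: "transpose (matrix_inv S) *v (transpose S *v z) = z"
    and det_transpose_matrix_inv: "det (transpose (matrix_inv S)) = 1 / det S"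
proof -
  have inv: "invertible S"
    using assms by (simp add: invertible_det_nz)
  have eq: "matrix_inv S ** S = mat 1" "S ** matrix_inv S = mat 1"
    using someI_ex[OF inv[unfolded invertible_def]] by (simp_all add: matrix_inv_def)
  then show "transpose S *v (transpose (matrix_inv S) *v z) = z"
    "transpose (matrix_inv S) *v (transpose S *v z) = z"
    by (simp_all add: matrix_vector_mul_assoc flip: matrix_transpose_mul)
  have "det (matrix_inv S) * det S = 1"
    unfolding det_mul[symmetric] eq by simp
  then show "det (transpose (matrix_inv S)) = 1 / det S"
    using assms by (simp add: field_simps)
qed

lemma infsum_eq_sum_lattice_box:
  fixes F :: "real ^ 'd \<Rightarrow> real"
  assumes supp: "\<And>x i. F x \<noteq> 0 \<Longrightarrow> \<bar>x $ i\<bar> \<le> real R" and "R \<le> N"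
  shows "(\<Sum>\<^sub>\<infinity>m\<in>UNIV. F (int_vec m)) = (\<Sum>m\<in>lattice_box N. F (int_vec m))"
proof -
  have "F (int_vec m) = 0" if "m \<notin> lattice_box N" for m
  proof (rule ccontr)
    assume "F (int_vec m) \<noteq> 0"
    then have "\<bar>int_vec m $ i\<bar> \<le> real R" for i
      by (rule supp)
    then have "real_of_int \<bar>m $ i\<bar> \<le> real_of_int (int R)" for i
      by (simp add: int_vec_def)
    then have "\<bar>m $ i\<bar> \<le> int N" for i
      using \<open>R \<le> N\<close> unfolding of_int_le_iff by (meson of_nat_mono order_trans)
    then show False
      using that by (simp add: lattice_box_def)
  qed
  then have "(\<Sum>\<^sub>\<infinity>m\<in>UNIV. F (int_vec m)) = (\<Sum>\<^sub>\<infinity>m\<in>lattice_box N. F (int_vec m))"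
    by (intro infsum_cong_neutral) auto
  then show ?thesis by simp
qed

lemma transformed_support:
  fixes f :: "real ^ 'd \<Rightarrow> real"
  assumes supp: "\<And>x. f x \<noteq> 0 \<Longrightarrow> x \<in> unit_cube" and S: "det S \<noteq> 0"
  obtains R where "\<And>x i. f (transpose (matrix_inv S) *v (x + v)) \<noteq> 0 \<Longrightarrow> \<bar>x $ i\<bar> \<le> real R"
proof -
  have "bounded ((\<lambda>y. transpose S *v y - v) ` unit_cube)"
    by (intro compact_imp_bounded compact_continuous_image continuous_intros
        matrix_vector_mult_linear_continuous_on compact_cbox)
  then obtain C where C: "\<And>y. y \<in> unit_cube \<Longrightarrow> norm (transpose S *v y - v) \<le> C"
    by (auto simp: bounded_iff)
  obtain R where R: "C \<le> real R"
    using real_arch_simple by blast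
  show ?thesis
  proof (rule that)
    fix x i
    assume "f (transpose (matrix_inv S) *v (x + v)) \<noteq> 0"
    then have "transpose (matrix_inv S) *v (x + v) \<in> unit_cube"
      by (rule supp)
    from C[OF this] have "norm x \<le> C"
      by (simp add: transpose_mult_inv_transpose[OF S])
    then show "\<bar>x $ i\<bar> \<le> real R"
      using R component_le_norm_cart[of x i] by linarith
  qed
qed

lemma continuous_transformed:
  fixes f :: "real ^ 'd \<Rightarrow> real" and A :: "real ^ 'd ^ 'd"
  assumes "continuous_on UNIV f"
  shows "continuous_on UNIV (\<lambda>x. f (A *v (x + v)))"
proof (rule continuous_on_compose2[OF assms])
  have "continuous_on UNIV (\<lambda>x. A *v x + A *v v)"
    by (intro continuous_intros matrix_vector_mult_linear_continuous_on)
  then show "continuous_on UNIV (\<lambda>x. A *v (x + v))"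
    by (simp add: matrix_vector_right_distrib)
qed simp

text \<open>The rule is a lattice sum of \<open>F x = f (A *v (x + v))\<close> with \<open>A\<close>
  the inverse transpose of \<open>S\<close>, so \<open>poisson_bound\<close> applies to
  \<open>F\<close>. The prefactor \<open>1 / D\<close> cancels the Jacobian in the Fourier
  coefficients of \<open>F\<close>.\<close>

proposition quadrature_error_le:
  fixes f :: "real ^ 'd \<Rightarrow> real"
  assumes cont: "continuous_on UNIV f" and supp: "\<And>x. f x \<noteq> 0 \<Longrightarrow> x \<in> unit_cube" and S: "det S \<noteq> 0"
  shows "ennreal \<bar>quadrature S v f - (LINT x|lborel. f x)\<bar>
    \<le> (\<integral>\<^sup>+k. ennreal (cmod (fourier f (S *v int_vec k))) \<partial>count_space (UNIV - {0}))"
proof -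
  define A where "A = transpose (matrix_inv S)"
  define F where "F = (\<lambda>x. f (A *v (x + v)))"
  define D where "D = \<bar>det S\<bar>"
  have D: "D > 0"
    using S by (simp add: D_def)
  have [measurable]: "f \<in> borel_measurable borel"
    using cont by (rule borel_measurable_continuous_onI)
  obtain R where R: "\<And>x i. F x \<noteq> 0 \<Longrightarrow> \<bar>x $ i\<bar> \<le> real R"
    unfolding F_def A_def using transformed_support[OF supp S, where v = v] by blast
  have contF: "continuous_on UNIV F"
    unfolding F_def by (rule continuous_transformed[OF cont])
  have change: "(LINT x|lborel. g (A *v (x + v))) = D *\<^sub>R (LINT x|lborel. g x)"
    if [measurable]: "g \<in> borel_measurable borel" for g :: "real ^ 'd \<Rightarrow> 'b::{banach, second_countable_topology}"
  proof -
    have "(LINT x|lborel. g (A *v (x + v))) = (LINT x|lborel. g (A *v x))"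
      using integral_lborel_translation[of "\<lambda>x. g (A *v x)" v] by (simp add: add.commute)
    moreover have "(LINT x|lborel. g x) = \<bar>det A\<bar> *\<^sub>R (LINT x|lborel. g (A *v x))"
      by (rule integral_lborel_linear) (use S in \<open>simp_all add: A_def det_transpose_matrix_inv[OF S] del: det_transpose\<close>)
    moreover have "\<bar>det A\<bar> = 1 / D"
      by (simp add: A_def D_def det_transpose_matrix_inv[OF S] del: det_transpose)
    ultimately show ?thesis
      using D by simp
  qed
  \<comment> \<open>The phase of the shift is multiplied onto the left side, where the modulus
    removes it; the transpose moves \<open>S\<close> onto the frequency.\<close>
  have Fk: "cmod (fourier F (int_vec k)) = D * cmod (fourier f (S *v int_vec k))" for k
  proof -
    have "wave (int_vec k) v * fourier F (int_vec k)
        = (LINT x|lborel. wave (int_vec k) v * (F x *\<^sub>R wave (int_vec k) x))"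
      unfolding fourier_def integral_mult_right_zero ..
    also have "\<dots> = (LINT x|lborel. f (A *v (x + v)) *\<^sub>R wave (S *v int_vec k) (A *v (x + v)))"
      by (intro Bochner_Integration.integral_cong refl)
        (simp add: F_def A_def transpose_mult_inv_transpose[OF S] wave_add_right flip: wave_matrix)
    also have "\<dots> = D *\<^sub>R fourier f (S *v int_vec k)"
      unfolding fourier_def by (rule change) measurable
    finally have "cmod (wave (int_vec k) v * fourier F (int_vec k)) = cmod (D *\<^sub>R fourier f (S *v int_vec k))"
      by simp
    then show ?thesis
      using D by (simp add: norm_mult)
  qed
  have "quadrature S v f = 1 / D * (\<Sum>m\<in>lattice_box (Suc R). F (int_vec m))"
    unfolding quadrature_def D_def
    using infsum_eq_sum_lattice_box[of F R "Suc R", OF R] by (simp add: F_def A_def)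
  moreover have "(LINT x|lborel. f x) = 1 / D * (LINT x|lborel. F x)"
    unfolding F_def using change[of f] D by simp
  ultimately have "\<bar>quadrature S v f - (LINT x|lborel. f x)\<bar>
      = 1 / D * \<bar>(\<Sum>m\<in>lattice_box (Suc R). F (int_vec m)) - (LINT x|lborel. F x)\<bar>"
    using D by (simp flip: diff_divide_distrib)
  then have "ennreal \<bar>quadrature S v f - (LINT x|lborel. f x)\<bar>
      = ennreal (1 / D) * ennreal \<bar>(\<Sum>m\<in>lattice_box (Suc R). F (int_vec m)) - (LINT x|lborel. F x)\<bar>"
    using D by (simp only: ennreal_mult zero_le_divide_iff zero_le_one abs_ge_zero less_imp_le simp_thms)
  also have "\<dots> \<le> ennreal (1 / D) * (\<integral>\<^sup>+k. ennreal (cmod (fourier F (int_vec k))) \<partial>count_space (UNIV - {0}))"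
    by (intro mult_left_mono poisson_bound contF R) auto
  also have "\<dots> = (\<integral>\<^sup>+k. ennreal (1 / D) * ennreal (cmod (fourier F (int_vec k))) \<partial>count_space (UNIV - {0}))"
    by (simp add: nn_integral_cmult)
  also have "\<dots> = (\<integral>\<^sup>+k. ennreal (cmod (fourier f (S *v int_vec k))) \<partial>count_space (UNIV - {0}))"
    using D by (intro nn_integral_cong) (simp add: Fk flip: ennreal_mult)
  finally show ?thesis .
qed

section \<open>Dependence of the rule on the dilation\<close>

lemma diag_mat_mult_vec: "(diag_mat w ** B) *v x = (\<chi> i. w $ i * (B *v x) $ i)"
  by (simp add: matrix_vector_mult_def matrix_matrix_mult_def diag_mat_def vec_eq_iff
      if_distrib[of "\<lambda>x. x * _"] sum_distrib_left mult.assoc cong: if_cong)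

lemma det_diag_mat_mult: "det (diag_mat w ** B) = (\<Prod>i\<in>UNIV. w $ i) * det B"
proof -
  have "det (diag_mat w) = (\<Prod>i\<in>UNIV. diag_mat w $ i $ i)"
    by (rule det_diagonal) (simp add: diag_mat_def)
  then show ?thesis
    by (simp add: det_mul diag_mat_def)
qed

lemma scaleR_diag_mat_mult: "r *\<^sub>R (diag_mat u ** B) = diag_mat (r *\<^sub>R u) ** B"
  by (simp add: matrix_matrix_mult_def diag_mat_def vec_eq_iff sum_distrib_left
      if_distrib[of "\<lambda>x. x * _"] if_distrib[of "(*) _"] mult.assoc cong: if_cong)

text \<open>Diagonal factors pass through the inverse transpose as coordinatewise division. This
  exhibits the nodes as explicit measurable functions of \<open>w\<close>.\<close>

lemma inv_transpose_diag_mat_mult: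
  fixes B :: "real ^ 'd ^ 'd"
  assumes w: "\<And>i. w $ i \<noteq> 0" and B: "det B \<noteq> 0"
  shows "transpose (matrix_inv (diag_mat w ** B)) *v z
    = (\<chi> i. (transpose (matrix_inv B) *v z) $ i / w $ i)"
proof -
  let ?S = "diag_mat w ** B"
  define y where "y = (\<chi> i. (transpose (matrix_inv B) *v z) $ i / w $ i)"
  have S: "det ?S \<noteq> 0"
    using w B by (simp add: det_diag_mat_mult)
  have "diag_mat w *v y = transpose (matrix_inv B) *v z"
    using diag_mat_mult_vec[of w "mat 1" y] w by (simp add: y_def vec_eq_iff)
  moreover have "transpose (diag_mat w) = diag_mat w"
    by (simp add: transpose_def diag_mat_def vec_eq_iff)
  ultimately have "transpose ?S *v y = z"
    by (simp add: matrix_transpose_mul transpose_mult_inv_transpose[OF B] flip: matrix_vector_mul_assoc)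
  then show ?thesis
    using inv_transpose_mult_transpose[OF S, of y] by (simp add: y_def)
qed

text \<open>The number of nodes that hit the support depends on \<open>w\<close> and is unbounded
  over all \<open>w\<close>, so no single finite sum represents the rule. It is instead a pointwise
  limit of truncated sums, each sequence being eventually constant.\<close>

lemma measurable_quadrature_diag:
  fixes f :: "real ^ 'd \<Rightarrow> real"
  assumes cont: "continuous_on UNIV f" and supp: "\<And>x. f x \<noteq> 0 \<Longrightarrow> x \<in> unit_cube"
    and B: "det B \<noteq> 0"
  shows "(\<lambda>w. quadrature (diag_mat w ** B) v f) \<in> borel_measurable borel"
proof -
  have [measurable]: "f \<in> borel_measurable borel"
    using cont by (rule borel_measurable_continuous_onI)
  define h where "h = (\<lambda>N w. if \<forall>i. w $ i \<noteq> 0 then 1 / \<bar>(\<Prod>i\<in>UNIV. w $ i) * det B\<bar> *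
      (\<Sum>m\<in>lattice_box N. f (\<chi> i. (transpose (matrix_inv B) *v (int_vec m + v)) $ i / w $ i)) else 0)"
  show ?thesis
  proof (rule borel_measurable_LIMSEQ_real)
    fix w :: "real ^ 'd"
    show "(\<lambda>N. h N w) \<longlonglongrightarrow> quadrature (diag_mat w ** B) v f"
    proof (cases "\<forall>i. w $ i \<noteq> 0")
      case True
      then have S: "det (diag_mat w ** B) \<noteq> 0"
        using B by (simp add: det_diag_mat_mult)
      obtain R where R: "\<And>x i. f (transpose (matrix_inv (diag_mat w ** B)) *v (x + v)) \<noteq> 0 \<Longrightarrow> \<bar>x $ i\<bar> \<le> real R"
        using transformed_support[OF supp S, where v = v] by blast
      have "h N w = quadrature (diag_mat w ** B) v f" if "N \<ge> R" for N
        using True B infsum_eq_sum_lattice_box[where N = N and R = R and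
          F = "\<lambda>x. f (transpose (matrix_inv (diag_mat w ** B)) *v (x + v))", OF R that]
        by (simp add: h_def quadrature_def det_diag_mat_mult inv_transpose_diag_mat_mult)
      then show ?thesis
        by (intro tendsto_eventually eventually_sequentiallyI[of R])
    next
      case False
      then have "h N w = 0" for N
        unfolding h_def by (rule if_not_P)
      moreover have "det (diag_mat w ** B) = 0"
        using False by (auto simp: det_diag_mat_mult)
      \<comment> \<open>Division by the zero determinant yields 0, which matches the
        \<open>else\<close> branch of \<open>h\<close>.\<close>
      then have "quadrature (diag_mat w ** B) v f = 0"
        by (simp add: quadrature_def)
      ultimately show ?thesis
        by simp
    qed
  next
    fix N
    show "h N \<in> borel_measurable borel"
      unfolding h_def by measurable
  qed
qed

section \<open>Weak derivatives and Bessel's inequality\<close>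

text \<open>Weak derivatives are tested against real functions, so the transform is reduced to
  cosine integrals. The free rotation \<open>cis t\<close> provides for the phase that
  differentiation adds.\<close>

lemma Re_cis_fourier:
  assumes "integrable lborel h"
  shows "Re (cis t * fourier h \<xi>) = (LINT x|lborel. h x * cos ((2 * pi) *\<^sub>R \<xi> \<bullet> x + t))"
    and "Im (cis t * fourier h \<xi>) = (LINT x|lborel. h x * cos ((2 * pi) *\<^sub>R \<xi> \<bullet> x + (t - pi / 2)))"
proof -
  have eq: "cis t * fourier h \<xi> = (LINT x|lborel. cis t * (h x *\<^sub>R wave \<xi> x))"
    unfolding fourier_def integral_mult_right_zero ..
  have *: "cis t * (h x *\<^sub>R wave \<xi> x) = h x *\<^sub>R cis (2 * pi * (\<xi> \<bullet> x) + t)" for x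
    by (simp add: wave_def cis_mult add.commute)
  have "integrable lborel (\<lambda>x. cis t * (h x *\<^sub>R wave \<xi> x))"
    by (intro integrable_mult_right integrable_scaleR_wave assms)
  then have int: "integrable lborel (\<lambda>x. h x *\<^sub>R cis (2 * pi * (\<xi> \<bullet> x) + t))"
    by (simp only: *)
  show "Re (cis t * fourier h \<xi>) = (LINT x|lborel. h x * cos ((2 * pi) *\<^sub>R \<xi> \<bullet> x + t))"
    unfolding eq * integral_Re[OF int, symmetric] by simp
  have sin: "sin (y + t) = cos (y + (t - pi / 2))" for y
    by (simp add: cos_add sin_add cos_diff sin_diff)
  show "Im (cis t * fourier h \<xi>) = (LINT x|lborel. h x * cos ((2 * pi) *\<^sub>R \<xi> \<bullet> x + (t - pi / 2)))"
    unfolding eq * integral_Im[OF int, symmetric] by (simp add: sin)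
qed

text \<open>Rotation by \<open>cis t\<close> does not change the modulus, so any two cosines a
  quarter period apart compute it.\<close>

lemma cmod_fourier_squared:
  assumes "integrable lborel h"
  shows "(cmod (fourier h \<xi>))\<^sup>2 = (LINT x|lborel. h x * cos ((2 * pi) *\<^sub>R \<xi> \<bullet> x + t))\<^sup>2
    + (LINT x|lborel. h x * cos ((2 * pi) *\<^sub>R \<xi> \<bullet> x + (t - pi / 2)))\<^sup>2"
  using Re_cis_fourier[OF assms, of t \<xi>] cmod_power2[of "cis t * fourier h \<xi>"]
  by (simp add: norm_mult)

lemma cube_cutoff_tendsto:
  "(\<lambda>n. cube_cutoff (1 / Suc n) x) \<longlonglongrightarrow> indicator unit_cube x"
proof (cases "x \<in> unit_cube")
  case True
  then have "cube_cutoff (1 / Suc n) x = 1" for n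
    by (intro cube_cutoff_eq_1) (auto simp: mem_box_cart intro: order_trans[of _ "0 :: real"] order_trans[of _ "1 :: real"])
  with True show ?thesis by simp
next
  case False
  then obtain j where j: "x $ j < 0 \<or> 1 < x $ j"
    by (auto simp: mem_box_cart not_le)
  define \<delta> where "\<delta> = max (- x $ j) (x $ j - 1)"
  have \<delta>: "\<delta> > 0"
    using j by (auto simp: \<delta>_def)
  have "(\<lambda>n. 2 * inverse (real (Suc n))) \<longlonglongrightarrow> 2 * 0"
    by (intro tendsto_intros LIMSEQ_inverse_real_of_nat)
  then have "\<forall>\<^sub>F n in sequentially. 2 * inverse (real (Suc n)) < \<delta>"
    using \<delta> by (intro order_tendstoD(2)[of _ 0]) auto
  then have "\<forall>\<^sub>F n in sequentially. cube_cutoff (1 / Suc n) x = indicator unit_cube x"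
  proof eventually_elim
    case (elim n)
    then have "cube_cutoff (1 / Suc n) x = 0"
      by (intro cube_cutoff_eq_0[of _ _ j]) (auto simp: \<delta>_def divide_inverse less_max_iff_disj)
    with False show ?case by simp
  qed
  then show ?thesis
    by (rule tendsto_eventually)
qed

lemma locally_integrable_imp_set_integrable:
  "locally_integrable g \<Longrightarrow> compact K \<Longrightarrow> integrable lborel (\<lambda>x. indicator K x * g x)"
  by (auto simp: locally_integrable_def set_integrable_def)

text \<open>The cutoffs shrink to the indicator of the closed cube, so one need not know that the weak
  derivative vanishes outside of it.\<close>

lemma weak_deriv_cos:
  fixes f :: "real ^ 'd \<Rightarrow> real"
  assumes weak: "has_weak_deriv f (pure_index s j) g" and g: "g \<in> borel_measurable borel"
    and supp: "\<And>x. f x \<noteq> 0 \<Longrightarrow> x \<in> unit_cube"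
  shows "(a $ j) ^ s * (LINT x|lborel. f x * cos (a \<bullet> x + (t + real s * (pi / 2))))
    = (- 1) ^ s * (LINT x|lborel. indicator unit_cube x * g x * cos (a \<bullet> x + t))"
proof -
  note [measurable] = g
  have [measurable]: "cube_cutoff \<epsilon> \<in> borel_measurable borel" for \<epsilon> :: real
    using elem_smooth_differentiable[OF elem_smooth_cube_cutoff]
    by (intro borel_measurable_continuous_onI continuous_at_imp_continuous_on)
      (auto intro: differentiable_imp_continuous_within)
  \<comment> \<open>On the support of \<open>f\<close> the derivative of the test function is that
    of the plain cosine, so the left side is free of \<open>n\<close>. The integrals on the right
    thus form a constant sequence, and each of them equals the limit found below.\<close>
  have eq: "(a $ j) ^ s * (LINT x|lborel. f x * cos (a \<bullet> x + (t + real s * (pi / 2))))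
      = (- 1) ^ s * (LINT x|lborel. g x * (cube_cutoff (1 / Suc n) x * cos (a \<bullet> x + t)))" for n
  proof -
    let ?\<phi> = "\<lambda>x. cube_cutoff (1 / Suc n) x * cos (a \<bullet> x + t)"
    have "test_fun ?\<phi>"
      by (rule test_fun_cutoff_cos) simp
    then have test: "(LINT x|lborel. f x * mixed_partial (pure_index s j) ?\<phi> x)
        = (- 1) ^ s * (LINT x|lborel. g x * ?\<phi> x)"
      using weak by (simp add: has_weak_deriv_def multi_order_pure_index)
    have "f x * mixed_partial (pure_index s j) ?\<phi> x
        = (a $ j) ^ s * (f x * cos (a \<bullet> x + (t + real s * (pi / 2))))" for x
      using supp[of x] funpow_partial_deriv_cutoff_cos[where \<epsilon> = "1 / real (Suc n)" and x = x and j = j and k = s and a = a and t = t]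
      by (cases "f x = 0") (simp_all add: mixed_partial_pure_index add.assoc)
    from test[unfolded this integral_mult_right_zero] show ?thesis .
  qed
  have "(\<lambda>n. LINT x|lborel. g x * (cube_cutoff (1 / Suc n) x * cos (a \<bullet> x + t)))
      \<longlonglongrightarrow> (LINT x|lborel. g x * (indicator unit_cube x * cos (a \<bullet> x + t)))"
  proof (rule integral_dominated_convergence)
    \<comment> \<open>All cutoffs have width parameter at most 1 and hence vanish outside [-2, 3]^d;
      local integrability of \<open>g\<close> there provides the dominating function.\<close>
    let ?K = "cbox (\<chi> j. - 2) (\<chi> j. 3) :: (real ^ 'd) set"
    have "integrable lborel (\<lambda>x. indicator ?K x * g x)"
      using weak by (intro locally_integrable_imp_set_integrable) (auto simp: has_weak_deriv_def)
    then show "integrable lborel (\<lambda>x. \<bar>indicator ?K x * g x\<bar>)"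
      by (rule integrable_abs)
    show "AE x in lborel. (\<lambda>n. g x * (cube_cutoff (1 / Suc n) x * cos (a \<bullet> x + t)))
        \<longlonglongrightarrow> g x * (indicator unit_cube x * cos (a \<bullet> x + t))"
      by (intro AE_I2 tendsto_intros cube_cutoff_tendsto)
    fix n
    show "AE x in lborel. norm (g x * (cube_cutoff (1 / Suc n) x * cos (a \<bullet> x + t))) \<le> \<bar>indicator ?K x * g x\<bar>"
    proof (intro AE_I2)
      fix x
      show "norm (g x * (cube_cutoff (1 / Suc n) x * cos (a \<bullet> x + t))) \<le> \<bar>indicator ?K x * g x\<bar>"
      proof (cases "x \<in> ?K")
        case True
        have "\<bar>cube_cutoff (1 / Suc n) x * cos (a \<bullet> x + t)\<bar> \<le> 1 * 1"
          unfolding abs_mult using cube_cutoff_bounds[of "1 / real (Suc n)" x]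
          by (intro mult_mono) auto
        then show ?thesis
          using True by (simp add: abs_mult[of "g x"] mult_left_le)
      next
        case False
        then obtain i where i: "x $ i < - 2 \<or> 3 < x $ i"
          by (auto simp: mem_box_cart not_le)
        have "1 / real (Suc n) \<le> 1"
          by simp
        then have "x $ i \<le> - 2 * (1 / real (Suc n)) \<or> 1 + 2 * (1 / real (Suc n)) \<le> x $ i"
          using i by linarith
        then have "cube_cutoff (1 / Suc n) x = 0"
          by (intro cube_cutoff_eq_0[of _ _ i]) simp_all
        then show ?thesis by simp
      qed
    qed
  qed measurable
  moreover have "(\<lambda>n. LINT x|lborel. g x * (cube_cutoff (1 / Suc n) x * cos (a \<bullet> x + t)))
      = (\<lambda>n. LINT x|lborel. g x * (cube_cutoff (1 / Suc 0) x * cos (a \<bullet> x + t)))"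
    using eq[of 0] eq by (auto simp: fun_eq_iff)
  ultimately have "(LINT x|lborel. g x * (cube_cutoff (1 / Suc 0) x * cos (a \<bullet> x + t)))
      = (LINT x|lborel. g x * (indicator unit_cube x * cos (a \<bullet> x + t)))"
    by (simp add: LIMSEQ_const_iff)
  then show ?thesis
    using eq[of 0] by (simp add: mult_ac)
qed

text \<open>Integration by parts against cosines of phases 0 and -pi/2 multiplies both by the same
  power of \<open>2 * pi * \<xi> $ j\<close> and advances both phases by \<open>s * pi / 2\<close>.
  They stay a quarter period apart, so the squares again add up to the squared modulus.\<close>

proposition fourier_weak_deriv:
  fixes f :: "real ^ 'd \<Rightarrow> real"
  assumes weak: "has_weak_deriv f (pure_index s j) g" and g: "g \<in> borel_measurable borel"
    and supp: "\<And>x. f x \<noteq> 0 \<Longrightarrow> x \<in> unit_cube" and f: "integrable lborel f"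
  shows "\<bar>2 * pi * \<xi> $ j\<bar> ^ s * cmod (fourier f \<xi>) = cmod (fourier (\<lambda>x. indicator unit_cube x * g x) \<xi>)"
proof -
  let ?a = "(2 * pi) *\<^sub>R \<xi>" and ?g = "\<lambda>x. indicator unit_cube x * g x"
  let ?F = "\<lambda>t. LINT x|lborel. f x * cos (?a \<bullet> x + t)" and ?G = "\<lambda>t. LINT x|lborel. ?g x * cos (?a \<bullet> x + t)"
  have int_g: "integrable lborel ?g"
    using weak by (intro locally_integrable_imp_set_integrable) (auto simp: has_weak_deriv_def)
  have w: "(?a $ j) ^ s * ?F (t + real s * (pi / 2)) = (- 1) ^ s * ?G t" for t
    using weak g supp by (rule weak_deriv_cos)
  from int_g have "(cmod (fourier ?g \<xi>))\<^sup>2 = (?G 0)\<^sup>2 + (?G (0 - pi / 2))\<^sup>2"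
    by (rule cmod_fourier_squared)
  also have "\<dots> = ((- 1) ^ s * ?G 0)\<^sup>2 + ((- 1) ^ s * ?G (0 - pi / 2))\<^sup>2"
    by (simp add: power_mult_distrib flip: power_mult)
  also have "\<dots> = ((?a $ j) ^ s * ?F (0 + real s * (pi / 2)))\<^sup>2
      + ((?a $ j) ^ s * ?F ((0 - pi / 2) + real s * (pi / 2)))\<^sup>2"
    by (simp only: w[of 0] w[of "0 - pi / 2"])
  also have "\<dots> = ((?a $ j) ^ s)\<^sup>2 * ((?F (real s * (pi / 2)))\<^sup>2 + (?F (real s * (pi / 2) - pi / 2))\<^sup>2)"
    by (simp add: power_mult_distrib distrib_left)
  also have "\<dots> = (\<bar>2 * pi * \<xi> $ j\<bar> ^ s * cmod (fourier f \<xi>))\<^sup>2"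
    unfolding cmod_fourier_squared[OF f, symmetric]
    by (simp add: power_mult_distrib flip: power_mult) (simp add: power_mult abs_mult power_mult_distrib mult.commute[of s])
  finally show ?thesis
    by (simp add: power2_eq_iff_nonneg)
qed

section \<open>Bessel's inequality and the Plancherel bound\<close>

lemma measurable_fourier [measurable]:
  assumes [measurable]: "f \<in> borel_measurable borel"
  shows "fourier f \<in> borel_measurable borel"
proof -
  have "(\<lambda>\<xi>. LINT x|lborel. f x *\<^sub>R wave \<xi> x) \<in> borel_measurable (borel :: (real ^ 'a) measure)"
    by (rule lborel.borel_measurable_lebesgue_integral) measurable
  then show ?thesis
    by (simp add: fourier_def[abs_def])
qed

text \<open>The squared distance of \<open>g\<close> from its projection is nonnegative. The shift
  \<theta> cancels in \<open>e k x * cnj (e l x)\<close>, so the shifted characters stay orthonormal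
  on the unit cube. As \<open>fourier\<close> has no conjugation, the \<open>c k\<close> are
  coefficients with respect to the functions \<open>cnj (e k x)\<close>.\<close>

lemma bessel_finite:
  fixes g :: "real ^ 'd \<Rightarrow> real"
  assumes g: "integrable lborel g" and g2: "integrable lborel (\<lambda>x. (g x)\<^sup>2)"
    and supp: "\<And>x. g x \<noteq> 0 \<Longrightarrow> x \<in> unit_cube" and K: "finite K"
  shows "(\<Sum>k\<in>K. (cmod (fourier g (int_vec k + \<theta>)))\<^sup>2) \<le> (LINT x|lborel. (g x)\<^sup>2)"
proof -
  let ?Q = "unit_cube :: (real ^ 'd) set"
  define e where "e = (\<lambda>k :: int ^ 'd. wave (int_vec k + \<theta>))"
  define c where "c = (\<lambda>k. fourier g (int_vec k + \<theta>))"
  have Q: "?Q = {x. \<forall>i. x $ i \<in> {0..0 + 1}}"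
    by (auto simp: mem_box_cart)
    have ee: "e k x * cnj (e l x) = wave (int_vec (k - l)) x" for k l x
    proof -
      have "int_vec (k - l) = (int_vec k + \<theta>) - (int_vec l + \<theta>)"
        by (simp add: int_vec_def vec_eq_iff)
      then show ?thesis
        by (simp only: wave_diff_left e_def)
    qed
  have int_e: "integrable lborel (\<lambda>x. indicator ?Q x *\<^sub>R (e k x * cnj (e l x)))" for k l
    unfolding ee
    by (rule integrable_indicator_scaleR_bounded[where C = 1, OF _ _ emeasure_lborel_cbox_finite]) auto
  have orth: "(LINT x|lborel. indicator ?Q x *\<^sub>R (e k x * cnj (e l x))) = of_bool (k = l)" for k l
  proof -
    show ?thesis
      using integral_unit_box_wave[of "{0..0 + 1}" 0 "k - l"] unfolding Q ee by (simp add: subset_eq)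
  qed
  have int_ge: "integrable lborel (\<lambda>x. g x *\<^sub>R e k x)" for k
    unfolding e_def by (rule integrable_scaleR_wave[OF g])
  have ge: "(LINT x|lborel. g x *\<^sub>R e k x) = c k" for k
    by (simp add: c_def e_def fourier_def)
  define h where "h = (\<lambda>x. indicator ?Q x *\<^sub>R (of_real (g x) - (\<Sum>k\<in>K. c k * cnj (e k x))))"
  \<comment> \<open>The expanded square of \<open>cmod (h x)\<close>, written as a complex function
    so that it can be integrated term by term. The indicator stays only in the last sum, since
    \<open>g\<close> vanishes outside the cube.\<close>
  define H where "H = (\<lambda>x. of_real ((g x)\<^sup>2) - (\<Sum>k\<in>K. cnj (c k) * (g x *\<^sub>R e k x))
      - (\<Sum>k\<in>K. c k * cnj (g x *\<^sub>R e k x))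
      + (\<Sum>l\<in>K. \<Sum>k\<in>K. (c k * cnj (c l)) * (indicator ?Q x *\<^sub>R (e l x * cnj (e k x)))))"
  have hH: "of_real ((cmod (h x))\<^sup>2) = H x" for x
  proof (cases "x \<in> ?Q")
    case True
    have "of_real ((cmod (h x))\<^sup>2) = h x * cnj (h x)"
      by (rule complex_norm_square)
    also have "\<dots> = (of_real (g x) - (\<Sum>k\<in>K. c k * cnj (e k x))) * (of_real (g x) - (\<Sum>k\<in>K. cnj (c k) * e k x))"
      using True by (simp add: h_def)
    also have "\<dots> = H x"
      unfolding H_def using True
      by (simp add: algebra_simps power2_eq_square sum_distrib_left sum_distrib_right scaleR_conv_of_real)
    finally show ?thesis .
  next
    case False
    then have "g x = 0"
      using supp by blast
    with False show ?thesis
      by (simp add: h_def H_def)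
  qed
  have "(LINT x|lborel. H x) = of_real (LINT x|lborel. (g x)\<^sup>2) - (\<Sum>k\<in>K. cnj (c k) * c k)
      - (\<Sum>k\<in>K. c k * cnj (c k)) + (\<Sum>l\<in>K. \<Sum>k\<in>K. (c k * cnj (c l)) * of_bool (l = k))"
  proof -
    have i1: "integrable lborel (\<lambda>x. complex_of_real ((g x)\<^sup>2))"
      by (intro integrable_of_real g2)
    have i2: "integrable lborel (\<lambda>x. \<Sum>k\<in>K. cnj (c k) * (g x *\<^sub>R e k x))"
      by (intro Bochner_Integration.integrable_sum integrable_mult_right int_ge)
    have i3: "integrable lborel (\<lambda>x. \<Sum>k\<in>K. c k * cnj (g x *\<^sub>R e k x))"
      by (intro Bochner_Integration.integrable_sum integrable_mult_right integrable_cnj int_ge)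
    have i4: "integrable lborel (\<lambda>x. \<Sum>l\<in>K. \<Sum>k\<in>K. (c k * cnj (c l)) * (indicator ?Q x *\<^sub>R (e l x * cnj (e k x))))"
      by (intro Bochner_Integration.integrable_sum integrable_mult_right int_e)
    have "(LINT x|lborel. H x) = (LINT x|lborel. complex_of_real ((g x)\<^sup>2))
        - (LINT x|lborel. (\<Sum>k\<in>K. cnj (c k) * (g x *\<^sub>R e k x)))
        - (LINT x|lborel. (\<Sum>k\<in>K. c k * cnj (g x *\<^sub>R e k x)))
        + (LINT x|lborel. (\<Sum>l\<in>K. \<Sum>k\<in>K. (c k * cnj (c l)) * (indicator ?Q x *\<^sub>R (e l x * cnj (e k x)))))"
      unfolding H_def using i1 i2 i3 i4
      by (simp only: Bochner_Integration.integral_add Bochner_Integration.integral_diff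
          Bochner_Integration.integrable_diff Bochner_Integration.integrable_add)
    also have "(LINT x|lborel. (\<Sum>k\<in>K. cnj (c k) * (g x *\<^sub>R e k x))) = (\<Sum>k\<in>K. cnj (c k) * c k)"
      by (subst Bochner_Integration.integral_sum)
        (intro integrable_mult_right int_ge, simp only: integral_mult_right_zero ge)
    also have "(LINT x|lborel. (\<Sum>k\<in>K. c k * cnj (g x *\<^sub>R e k x))) = (\<Sum>k\<in>K. c k * cnj (c k))"
      by (subst Bochner_Integration.integral_sum)
        (intro integrable_mult_right integrable_cnj int_ge, simp only: integral_mult_right_zero Bochner_Integration.integral_cnj ge)
    also have "(LINT x|lborel. (\<Sum>l\<in>K. \<Sum>k\<in>K. (c k * cnj (c l)) * (indicator ?Q x *\<^sub>R (e l x * cnj (e k x)))))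
        = (\<Sum>l\<in>K. \<Sum>k\<in>K. (c k * cnj (c l)) * of_bool (l = k))"
      by (subst Bochner_Integration.integral_sum, intro Bochner_Integration.integrable_sum integrable_mult_right int_e,
          subst Bochner_Integration.integral_sum, intro integrable_mult_right int_e,
          simp only: integral_mult_right_zero orth)
    finally show ?thesis
      unfolding integral_complex_of_real .
  qed
  also have "(\<Sum>l\<in>K. \<Sum>k\<in>K. (c k * cnj (c l)) * of_bool (l = k)) = (\<Sum>l\<in>K. c l * cnj (c l))"
  proof (rule sum.cong)
    fix l
    assume "l \<in> K"
    then show "(\<Sum>k\<in>K. (c k * cnj (c l)) * of_bool (l = k)) = c l * cnj (c l)"
      using K by (simp add: of_bool_def if_distrib[of "(*) _"] cong: if_cong)
  qed simp
  finally have "(LINT x|lborel. H x) = of_real (LINT x|lborel. (g x)\<^sup>2) - (\<Sum>k\<in>K. cnj (c k) * c k)"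
    by simp
  also have "(\<Sum>k\<in>K. cnj (c k) * c k) = of_real (\<Sum>k\<in>K. (cmod (c k))\<^sup>2)"
    unfolding of_real_sum complex_norm_square by (simp only: mult.commute)
  finally have "complex_of_real (LINT x|lborel. (cmod (h x))\<^sup>2) = of_real ((LINT x|lborel. (g x)\<^sup>2) - (\<Sum>k\<in>K. (cmod (c k))\<^sup>2))"
    unfolding hH[symmetric] integral_complex_of_real by simp
  then have "(LINT x|lborel. (cmod (h x))\<^sup>2) = (LINT x|lborel. (g x)\<^sup>2) - (\<Sum>k\<in>K. (cmod (c k))\<^sup>2)"
    by (simp only: of_real_eq_iff)
  moreover have "(LINT x|lborel. (cmod (h x))\<^sup>2) \<ge> 0"
    by (rule integral_nonneg_AE) simp
  ultimately show ?thesis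
    by (simp add: c_def)
qed

lemma nn_integral_count_space_lattice_le:
  fixes \<Psi> :: "int ^ 'd \<Rightarrow> ennreal"
  assumes "\<And>N. (\<Sum>k\<in>lattice_box N. \<Psi> k) \<le> C"
  shows "(\<integral>\<^sup>+k. \<Psi> k \<partial>count_space UNIV) \<le> C"
proof -
  have ex: "\<exists>N. k \<in> lattice_box N" for k :: "int ^ 'd"
  proof
    have "\<bar>k $ i\<bar> \<le> (\<Sum>i\<in>UNIV. \<bar>k $ i\<bar>)" for i
      by (rule member_le_sum) auto
    then show "k \<in> lattice_box (nat (\<Sum>i\<in>UNIV. \<bar>k $ i\<bar>))"
      by (simp add: lattice_box_def sum_nonneg)
  qed
  have mono: "lattice_box N \<subseteq> (lattice_box M :: (int ^ 'd) set)" if "N \<le> M" for N M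
    using that by (auto simp: lattice_box_def intro: order_trans)
  have "\<Psi> k = (SUP N. \<Psi> k * indicator (lattice_box N) k)" for k
  proof (rule antisym)
    obtain N where "k \<in> lattice_box N"
      using ex by blast
    then show "\<Psi> k \<le> (SUP N. \<Psi> k * indicator (lattice_box N) k)"
      by (intro SUP_upper2[of N]) auto
    show "(SUP N. \<Psi> k * indicator (lattice_box N) k) \<le> \<Psi> k"
      by (intro SUP_least) (auto simp: indicator_def)
  qed
  then have "(\<integral>\<^sup>+k. \<Psi> k \<partial>count_space UNIV) = (\<integral>\<^sup>+k. (SUP N. \<Psi> k * indicator (lattice_box N) k) \<partial>count_space UNIV)"
    by simp
  also have "\<dots> = (SUP N. \<integral>\<^sup>+k. \<Psi> k * indicator (lattice_box N) k \<partial>count_space UNIV)"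
    by (intro nn_integral_monotone_convergence_SUP)
      (auto simp: incseq_def le_fun_def indicator_def dest: subsetD[OF mono])
  also have "\<dots> \<le> C"
    using assms by (intro SUP_least)
      (simp add: nn_integral_count_space_indicator[symmetric] nn_integral_count_space_finite)
  finally show ?thesis .
qed

lemma nn_integral_tiles:
  fixes \<Phi> :: "real ^ 'd \<Rightarrow> ennreal"
  assumes [measurable]: "\<Phi> \<in> borel_measurable borel"
  shows "(\<integral>\<^sup>+x. \<Phi> x \<partial>lborel)
    = (\<integral>\<^sup>+x. (\<integral>\<^sup>+k. \<Phi> (int_vec k + x) \<partial>count_space UNIV) * indicator centered_cube x \<partial>lborel)"
proof -
  have [measurable]: "(\<lambda>x. indicator centered_cube (x - int_vec k) :: ennreal) \<in> borel_measurable borel" for k :: "int ^ 'd"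
    by measurable
  have "\<Phi> x = (\<integral>\<^sup>+k. \<Phi> x * indicator centered_cube (x - int_vec k) \<partial>count_space UNIV)" for x
  proof -
    have "(\<integral>\<^sup>+k. \<Phi> x * indicator centered_cube (x - int_vec k) \<partial>count_space UNIV)
        = (\<integral>\<^sup>+k. \<Phi> x * indicator {\<chi> i. \<lfloor>x $ i + 1 / 2\<rfloor>} k \<partial>count_space UNIV)"
      by (intro nn_integral_cong) (simp add: indicator_def diff_int_vec_in_centered_cube)
    also have "\<dots> = \<Phi> x"
      by (simp add: nn_integral_cmult)
    finally show ?thesis ..
  qed
  then have "(\<integral>\<^sup>+x. \<Phi> x \<partial>lborel)
      = (\<integral>\<^sup>+x. (\<integral>\<^sup>+k. \<Phi> x * indicator centered_cube (x - int_vec k) \<partial>count_space UNIV) \<partial>lborel)"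
    by simp
  also have "\<dots> = (\<integral>\<^sup>+k. (\<integral>\<^sup>+x. \<Phi> x * indicator centered_cube (x - int_vec k) \<partial>lborel) \<partial>count_space UNIV)"
    by (intro nn_integral_count_space_nn_integral) auto
  also have "\<dots> = (\<integral>\<^sup>+k. (\<integral>\<^sup>+x. \<Phi> (int_vec k + x) * indicator centered_cube x \<partial>lborel) \<partial>count_space UNIV)"
  proof (rule nn_integral_cong)
    fix k :: "int ^ 'd"
    show "(\<integral>\<^sup>+x. \<Phi> x * indicator centered_cube (x - int_vec k) \<partial>lborel)
        = (\<integral>\<^sup>+x. \<Phi> (int_vec k + x) * indicator centered_cube x \<partial>lborel)"
      using nn_integral_lborel_translation[of "\<lambda>x. \<Phi> x * indicator centered_cube (x - int_vec k)" "int_vec k"] by simp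
  qed
  also have "\<dots> = (\<integral>\<^sup>+x. (\<integral>\<^sup>+k. \<Phi> (int_vec k + x) * indicator centered_cube x \<partial>count_space UNIV) \<partial>lborel)"
    by (intro nn_integral_count_space_nn_integral[symmetric]) auto
  also have "\<dots> = (\<integral>\<^sup>+x. (\<integral>\<^sup>+k. \<Phi> (int_vec k + x) \<partial>count_space UNIV) * indicator centered_cube x \<partial>lborel)"
    by (simp add: nn_integral_multc)
  finally show ?thesis .
qed

proposition nn_integral_fourier_squared_le:
  fixes g :: "real ^ 'd \<Rightarrow> real"
  assumes g: "integrable lborel g" and g2: "integrable lborel (\<lambda>x. (g x)\<^sup>2)"
    and supp: "\<And>x. g x \<noteq> 0 \<Longrightarrow> x \<in> unit_cube"
  shows "(\<integral>\<^sup>+\<xi>. ennreal ((cmod (fourier g \<xi>))\<^sup>2) \<partial>lborel) \<le> ennreal (LINT x|lborel. (g x)\<^sup>2)"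
proof -
  let ?C = "ennreal (LINT x|lborel. (g x)\<^sup>2)"
  have [measurable]: "g \<in> borel_measurable borel"
    using borel_measurable_integrable[OF g] by simp
  have "(\<integral>\<^sup>+\<xi>. ennreal ((cmod (fourier g \<xi>))\<^sup>2) \<partial>lborel)
      = (\<integral>\<^sup>+\<xi>. (\<integral>\<^sup>+k. ennreal ((cmod (fourier g (int_vec k + \<xi>)))\<^sup>2) \<partial>count_space UNIV) * indicator centered_cube \<xi> \<partial>lborel)"
    by (rule nn_integral_tiles) measurable
  also have "\<dots> \<le> (\<integral>\<^sup>+\<xi>. ?C * indicator centered_cube (\<xi> :: real ^ 'd) \<partial>lborel)"
    by (intro nn_integral_mono mult_right_mono nn_integral_count_space_lattice_le)
      (auto intro!: ennreal_leI bessel_finite assms)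
  also have "\<dots> = ?C * emeasure lborel (centered_cube :: (real ^ 'd) set)"
    by (simp add: nn_integral_cmult_indicator)
  also have "emeasure lborel (centered_cube :: (real ^ 'd) set) = 1"
  proof -
    \<comment> \<open>The kernel with \<open>N = 0\<close> is constantly 1, so its normalisation
      gives the volume of the cell.\<close>
    have "measure lborel (centered_cube :: (real ^ 'd) set) = 1"
      using integral_cube_kernel[of 0, where 'd = 'd] by (simp add: kernel_def kernel1_def)
    then show ?thesis
      using emeasure_centered_cube_finite[where 'd = 'd] by (simp add: emeasure_eq_ennreal_measure)
  qed
  finally show ?thesis by simp
qed

section \<open>The tail of the Fourier transform\<close>

text \<open>Here one coordinate controls all of \<xi>: where \<open>|\<xi> $ j|\<close> is of size
  R, the point lies in a cube of side of order R. Decay in that single coordinate therefore suffices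
  for integrability.\<close>

definition dominant_region :: "'d::finite \<Rightarrow> real \<Rightarrow> (real ^ 'd) set" where
  "dominant_region j T = {\<xi>. T \<le> \<bar>\<xi> $ j\<bar> \<and> (\<forall>i. \<bar>\<xi> $ i\<bar> \<le> \<bar>\<xi> $ j\<bar>)}"

lemma sets_dominant_region [measurable]: "dominant_region j T \<in> sets borel"
  unfolding dominant_region_def by measurable

text \<open>The largest modulus of a coordinate is at least the geometric mean of all of
  them.\<close>

lemma hyperbolic_region_cover:
  fixes \<xi> :: "real ^ 'd"
  assumes "T \<ge> 0" "T ^ CARD('d) \<le> \<bar>\<Prod>i\<in>UNIV. \<xi> $ i\<bar>"
  shows "\<exists>j. \<xi> \<in> dominant_region j T"
proof -
  have "Max (range (\<lambda>i. \<bar>\<xi> $ i\<bar>)) \<in> range (\<lambda>i. \<bar>\<xi> $ i\<bar>)"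
    by (intro Max_in) auto
  then obtain j where j: "\<bar>\<xi> $ j\<bar> = Max (range (\<lambda>i. \<bar>\<xi> $ i\<bar>))"
    by (metis imageE)
  then have le: "\<bar>\<xi> $ i\<bar> \<le> \<bar>\<xi> $ j\<bar>" for i
    by simp
  have "T ^ CARD('d) \<le> (\<Prod>i\<in>UNIV. \<bar>\<xi> $ i\<bar>)"
    using assms(2) by (simp add: abs_prod)
  also have "\<dots> \<le> (\<Prod>i\<in>(UNIV :: 'd set). \<bar>\<xi> $ j\<bar>)"
    using le by (intro prod_mono) auto
  finally have "T ^ CARD('d) \<le> \<bar>\<xi> $ j\<bar> ^ CARD('d)"
    by simp
  then have "T \<le> \<bar>\<xi> $ j\<bar>"
    by (subst (asm) power_mono_iff) (use assms in auto)
  with le show ?thesis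
    by (auto simp: dominant_region_def)
qed

lemma exists_dyadic:
  fixes x T :: real
  assumes "0 < T" "T \<le> x"
  obtains k where "2 ^ k * T \<le> x" "x \<le> 2 ^ Suc k * T"
proof -
  have ex: "\<exists>k. x < 2 ^ k * T"
    using real_arch_pow[of 2 "x / T"] assms by (auto simp: field_simps)
  define m where "m = (LEAST k. x < 2 ^ k * T)"
  have m: "x < 2 ^ m * T"
    unfolding m_def using ex by (rule LeastI_ex)
  have "m \<noteq> 0"
    using m assms by (intro notI) simp
  then obtain k where k: "m = Suc k"
    by (cases m) auto
  have "\<not> x < 2 ^ k * T"
    using not_less_Least[of k "\<lambda>k. x < 2 ^ k * T"] k by (simp add: m_def)
  with m k show ?thesis
    by (intro that[of k]) auto
qed

lemma emeasure_symmetric_cube: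
  assumes "0 \<le> r"
  shows "emeasure lborel (cbox (\<chi> i. - r) (\<chi> i. r) :: (real ^ 'd) set) = ennreal ((2 * r) ^ CARD('d))"
proof -
  have "emeasure lborel (cbox (\<chi> i. - r) (\<chi> i. r) :: (real ^ 'd) set)
      = (\<Prod>b\<in>Basis. ((\<chi> i. r) - (\<chi> i. - r) :: real ^ 'd) \<bullet> b)"
    using assms by (intro emeasure_lborel_cbox) (auto simp: Basis_vec_def inner_axis)
  then show ?thesis
    by (simp add: prod_Basis_vec inner_axis)
qed

text \<open>The sum over the dyadic shells is geometric with ratio \<open>2\<^sup>d / 2\<^sup>2\<^sup>s < 1\<close>.\<close>

lemma nn_integral_dominant_region_le:
  assumes s: "CARD('d) < 2 * s" and T: "T > 0"
  shows "(\<integral>\<^sup>+\<xi>. ennreal (1 / \<bar>\<xi> $ j\<bar> ^ (2 * s)) * indicator (dominant_region j T) (\<xi> :: real ^ 'd) \<partial>lborel)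
    \<le> ennreal (4 ^ CARD('d) / (1 - 2 ^ CARD('d) / 2 ^ (2 * s)) * (T ^ CARD('d) / T ^ (2 * s)))"
proof -
  let ?d = "CARD('d)"
  let ?Q = "\<lambda>k. cbox (\<chi> i. - (2 ^ Suc k * T)) (\<chi> i. 2 ^ Suc k * T) :: (real ^ 'd) set"
  define \<rho> :: real where "\<rho> = 2 ^ ?d / 2 ^ (2 * s)"
  have \<rho>: "0 \<le> \<rho>" "\<rho> < 1"
    using s by (auto simp: \<rho>_def)
  define w where "w = (\<lambda>k. 1 / (2 ^ k * T) ^ (2 * s))"
  have w: "w k \<ge> 0" for k
    using T by (simp add: w_def)
  have "ennreal (1 / \<bar>\<xi> $ j\<bar> ^ (2 * s)) * indicator (dominant_region j T) \<xi>
      \<le> (\<Sum>k. ennreal (w k) * indicator (?Q k) \<xi>)" for \<xi> :: "real ^ 'd"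
  proof (cases "\<xi> \<in> dominant_region j T")
    case True
    then have j: "T \<le> \<bar>\<xi> $ j\<bar>" "\<And>i. \<bar>\<xi> $ i\<bar> \<le> \<bar>\<xi> $ j\<bar>"
      by (auto simp: dominant_region_def)
    obtain k where k: "2 ^ k * T \<le> \<bar>\<xi> $ j\<bar>" "\<bar>\<xi> $ j\<bar> \<le> 2 ^ Suc k * T"
      using exists_dyadic[OF T j(1)] .
    have "\<bar>\<xi> $ i\<bar> \<le> 2 ^ Suc k * T" for i
      using j(2)[of i] k(2) by linarith
    then have "\<xi> \<in> ?Q k"
      by (auto simp: mem_box_cart abs_le_iff) (metis minus_le_iff)
    moreover have "1 / \<bar>\<xi> $ j\<bar> ^ (2 * s) \<le> w k"
      unfolding w_def using k(1) T j(1) by (intro divide_left_mono power_mono mult_pos_pos zero_less_power) auto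
    ultimately have "ennreal (1 / \<bar>\<xi> $ j\<bar> ^ (2 * s)) * indicator (dominant_region j T) \<xi>
        \<le> ennreal (w k) * indicator (?Q k) \<xi>"
      using True by (simp add: ennreal_leI)
    also have "\<dots> \<le> (\<Sum>k. ennreal (w k) * indicator (?Q k) \<xi>)"
    proof -
      define F where "F = (\<lambda>k. ennreal (w k) * indicator (?Q k) \<xi>)"
      have "F k \<le> suminf F"
        using sum_le_suminf[of F "{k}"] by simp
      then show ?thesis
        by (simp only: F_def)
    qed
    finally show ?thesis .
  qed simp
  then have "(\<integral>\<^sup>+\<xi>. ennreal (1 / \<bar>\<xi> $ j\<bar> ^ (2 * s)) * indicator (dominant_region j T) (\<xi> :: real ^ 'd) \<partial>lborel)
      \<le> (\<integral>\<^sup>+\<xi>. (\<Sum>k. ennreal (w k) * indicator (?Q k) \<xi>) \<partial>lborel)"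
    by (rule nn_integral_mono)
  also have "\<dots> = (\<Sum>k. \<integral>\<^sup>+\<xi>. ennreal (w k) * indicator (?Q k) \<xi> \<partial>lborel)"
    by (rule nn_integral_suminf) measurable
  also have "\<dots> = (\<Sum>k. ennreal (w k) * ennreal ((2 * (2 ^ Suc k * T)) ^ ?d))"
    using T by (subst nn_integral_cmult_indicator) (auto simp: emeasure_symmetric_cube)
  also have "\<dots> = (\<Sum>k. ennreal (4 ^ ?d * (T ^ ?d / T ^ (2 * s)) * \<rho> ^ k))"
  proof (intro suminf_cong)
    fix k
    \<comment> \<open>The cube containing the k-th shell has side 2 * 2^(k+1) T = 4 * 2^k T, the
      origin of the constant \<open>4 ^ ?d\<close>.\<close>
    have "w k * (2 * (2 ^ Suc k * T)) ^ ?d = 4 ^ ?d * (T ^ ?d / T ^ (2 * s)) * \<rho> ^ k"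
    proof -
      have "(2 * (2 ^ Suc k * T)) ^ ?d = 4 ^ ?d * (2 ^ ?d) ^ k * T ^ ?d"
        by (simp add: power_mult_distrib flip: power_mult)
      moreover have "w k = 1 / ((2 ^ (2 * s)) ^ k * T ^ (2 * s))"
        by (simp add: w_def power_mult_distrib mult_ac flip: power_mult)
      ultimately show ?thesis
        by (simp add: \<rho>_def power_divide mult_ac)
    qed
    then show "ennreal (w k) * ennreal ((2 * (2 ^ Suc k * T)) ^ ?d) = ennreal (4 ^ ?d * (T ^ ?d / T ^ (2 * s)) * \<rho> ^ k)"
      using w T by (simp flip: ennreal_mult)
  qed
  also have "\<dots> = ennreal (\<Sum>k. 4 ^ ?d * (T ^ ?d / T ^ (2 * s)) * \<rho> ^ k)"
    using \<rho> T by (intro suminf_ennreal2 summable_mult summable_geometric) auto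
  also have "(\<Sum>k. 4 ^ ?d * (T ^ ?d / T ^ (2 * s)) * \<rho> ^ k) = 4 ^ ?d * (T ^ ?d / T ^ (2 * s)) * (1 / (1 - \<rho>))"
    using \<rho> by (subst suminf_mult) (auto intro!: summable_geometric simp: suminf_geometric)
  finally show ?thesis
    by (simp add: \<rho>_def mult_ac)
qed

lemma ennreal_le_of_square_le:
  assumes "X ^ 2 \<le> ennreal (c ^ 2)" "c \<ge> 0"
  shows "X \<le> ennreal c"
proof (cases X)
  case (real x)
  with assms have "ennreal (x ^ 2) \<le> ennreal (c ^ 2)"
    by (simp add: ennreal_power)
  then have "x ^ 2 \<le> c ^ 2"
    using assms by (simp add: ennreal_le_iff)
  then have "x \<le> c"
    using assms(2) by (rule power2_le_imp_le)
  with real show ?thesis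
    by (simp add: ennreal_leI)
next
  case top
  with assms show ?thesis
    by (simp add: power2_eq_square ennreal_mult_top top_unique)
qed

section \<open>Bounds by the Sobolev norm\<close>

lemma sobolev0_cubeD:
  assumes "f \<in> sobolev0_cube s"
  shows "continuous_on UNIV f" "\<And>x. f x \<noteq> 0 \<Longrightarrow> x \<in> unit_cube" "integrable lborel f"
proof -
  show cont: "continuous_on UNIV f"
    using assms by (simp add: sobolev0_cube_def)
  have "closure {x. f x \<noteq> 0} \<subseteq> unit_cube"
    using assms by (simp add: sobolev0_cube_def)
  then show supp: "x \<in> unit_cube" if "f x \<noteq> 0" for x
    using that closure_subset[of "{x. f x \<noteq> 0}"] by blast
  show "integrable lborel f"
    by (rule integrable_continuous_compact_support[OF cont supp compact_cbox])
qed

lemma sobolev_norm_nonneg: "sobolev_norm s f \<ge> 0"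
proof -
  have "0 \<le> (LINT x:unit_cube|lborel. (weak_deriv \<alpha> f x)\<^sup>2)" for \<alpha>
    unfolding set_lebesgue_integral_def by (rule integral_nonneg_AE) simp
  then show ?thesis
    by (auto simp: sobolev_norm_def intro!: sum_nonneg)
qed

text \<open>The norm sees derivatives only on the cube, so it is the restriction of \<open>g\<close>
  to the cube that gets bounded. As the norm uses the same chosen representative, its square
  contains this integral as one of its nonnegative summands.\<close>

lemma pure_weak_deriv:
  fixes f :: "real ^ 'd \<Rightarrow> real" and j :: 'd
  assumes "f \<in> sobolev0_cube s"
  defines "g \<equiv> weak_deriv (pure_index s j) f"
  shows "has_weak_deriv f (pure_index s j) g" "g \<in> borel_measurable borel"
    "integrable lborel (\<lambda>x. indicator unit_cube x * g x)"
    "integrable lborel (\<lambda>x. (indicator unit_cube x * g x)\<^sup>2)"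
    "(LINT x|lborel. (indicator unit_cube x * g x)\<^sup>2) \<le> (sobolev_norm s f)\<^sup>2"
proof -
  have "\<exists>g. square_integrable g \<and> has_weak_deriv f (pure_index s j) g"
    using assms(1) by (simp add: sobolev0_cube_def sobolev_def multi_order_pure_index)
  from someI_ex[OF this] have g: "square_integrable g" "has_weak_deriv f (pure_index s j) g"
    by (simp_all add: g_def weak_deriv_def)
  then show "has_weak_deriv f (pure_index s j) g" "g \<in> borel_measurable borel"
    by (simp_all add: square_integrable_def)
  note [measurable] = this(2)
  show "integrable lborel (\<lambda>x. indicator unit_cube x * g x)"
    using g(2) by (intro locally_integrable_imp_set_integrable) (auto simp: has_weak_deriv_def)
  show "integrable lborel (\<lambda>x. (indicator unit_cube x * g x)\<^sup>2)"
  proof (rule Bochner_Integration.integrable_bound)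
    show "integrable lborel (\<lambda>x. (g x)\<^sup>2)"
      using g(1) by (simp add: square_integrable_def)
    show "AE x in lborel. norm ((indicator unit_cube x * g x)\<^sup>2) \<le> norm ((g x)\<^sup>2)"
      by (intro AE_I2) (auto simp: indicator_def)
  qed measurable
  have nonneg: "0 \<le> (LINT x:unit_cube|lborel. (weak_deriv \<alpha> f x)\<^sup>2)" for \<alpha>
    unfolding set_lebesgue_integral_def by (rule integral_nonneg_AE) simp
  have "(LINT x|lborel. (indicator unit_cube x * g x)\<^sup>2) = (LINT x:unit_cube|lborel. (weak_deriv (pure_index s j) f x)\<^sup>2)"
    unfolding set_lebesgue_integral_def g_def
    by (intro Bochner_Integration.integral_cong) (auto simp: indicator_def)
  also have "\<dots> \<le> (\<Sum>\<alpha> | multi_order \<alpha> \<le> s. LINT x:unit_cube|lborel. (weak_deriv \<alpha> f x)\<^sup>2)"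
    using nonneg by (intro member_le_sum finite_multi_order_le) (auto simp: multi_order_pure_index)
  also have "\<dots> = (sobolev_norm s f)\<^sup>2"
    unfolding sobolev_norm_def using nonneg by (subst real_sqrt_pow2) (auto intro: sum_nonneg)
  finally show "(LINT x|lborel. (indicator unit_cube x * g x)\<^sup>2) \<le> (sobolev_norm s f)\<^sup>2" .
qed

text \<open>The value of the geometric series over the dyadic shells, apart from the power of
  \<open>T\<close>; \<open>d < 2 * s\<close> keeps its ratio below 1.\<close>

definition tail_const :: "nat \<Rightarrow> nat \<Rightarrow> real" where
  "tail_const d s = 4 ^ d / (1 - 2 ^ d / 2 ^ (2 * s))"

lemma tail_const_pos: "d < 2 * s \<Longrightarrow> tail_const d s > 0"
  by (simp add: tail_const_def)

lemma nn_integral_fourier_dominant_region_le: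
  fixes f :: "real ^ 'd \<Rightarrow> real"
  assumes f: "f \<in> sobolev0_cube s" and s: "CARD('d) < 2 * s" and T: "T > 0"
  shows "(\<integral>\<^sup>+\<xi>. ennreal (cmod (fourier f \<xi>)) * indicator (dominant_region j T) \<xi> \<partial>lborel)
    \<le> ennreal (sqrt (tail_const CARD('d) s * (T ^ CARD('d) / T ^ (2 * s))) * sobolev_norm s f)"
proof (rule ennreal_le_of_square_le)
  let ?E = "tail_const CARD('d) s * (T ^ CARD('d) / T ^ (2 * s))"
  define g where "g = (\<lambda>x. indicator unit_cube x * weak_deriv (pure_index s j) f x)"
  note weak = pure_weak_deriv[OF f, of j, folded g_def]
  have [measurable]: "f \<in> borel_measurable borel" "g \<in> borel_measurable borel"
    using borel_measurable_integrable[OF sobolev0_cubeD(3)[OF f]] borel_measurable_integrable[OF weak(3)] by simp_all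
  have E: "?E \<ge> 0"
    using tail_const_pos[OF s] T by simp
  define \<Phi> where "\<Phi> = (\<lambda>\<xi>. ennreal (1 / \<bar>\<xi> $ j\<bar> ^ s) * indicator (dominant_region j T) (\<xi> :: real ^ 'd))"
  have [measurable]: "\<Phi> \<in> borel_measurable borel"
    unfolding \<Phi>_def by measurable
  \<comment> \<open>Trades \<open>fourier f\<close> for the transform of its derivative divided by
    \<open>|\<xi> $ j| ^ s\<close>; the factor (2 pi)^s \<ge> 1 is discarded. Cauchy-Schwarz then
    separates the Bessel bound from the tail integral.\<close>
  have "ennreal (cmod (fourier f \<xi>)) * indicator (dominant_region j T) \<xi> \<le> ennreal (cmod (fourier g \<xi>)) * \<Phi> \<xi>" for \<xi>
  proof (cases "\<xi> \<in> dominant_region j T")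
    case True
    then have pos: "\<bar>\<xi> $ j\<bar> > 0"
      using T by (auto simp: dominant_region_def)
    have "\<bar>\<xi> $ j\<bar> ^ s * cmod (fourier f \<xi>) \<le> \<bar>2 * pi * \<xi> $ j\<bar> ^ s * cmod (fourier f \<xi>)"
    proof (intro mult_right_mono power_mono)
      have "1 * \<bar>\<xi> $ j\<bar> \<le> (2 * pi) * \<bar>\<xi> $ j\<bar>"
        using pi_gt3 by (intro mult_right_mono) auto
      then show "\<bar>\<xi> $ j\<bar> \<le> \<bar>2 * pi * \<xi> $ j\<bar>"
        by (simp add: abs_mult)
    qed auto
    also have "\<dots> = cmod (fourier g \<xi>)"
      unfolding g_def by (rule fourier_weak_deriv[OF weak(1,2) sobolev0_cubeD(2,3)[OF f]])
    finally have "cmod (fourier f \<xi>) \<le> cmod (fourier g \<xi>) * (1 / \<bar>\<xi> $ j\<bar> ^ s)"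
      using pos by (simp add: field_simps)
    then show ?thesis
      using True by (simp add: \<Phi>_def ennreal_leI flip: ennreal_mult)
  qed simp
  then have "(\<integral>\<^sup>+\<xi>. ennreal (cmod (fourier f \<xi>)) * indicator (dominant_region j T) \<xi> \<partial>lborel)
      \<le> (\<integral>\<^sup>+\<xi>. ennreal (cmod (fourier g \<xi>)) * \<Phi> \<xi> \<partial>lborel)"
    by (rule nn_integral_mono)
  then have "(\<integral>\<^sup>+\<xi>. ennreal (cmod (fourier f \<xi>)) * indicator (dominant_region j T) \<xi> \<partial>lborel)\<^sup>2
      \<le> (\<integral>\<^sup>+\<xi>. ennreal (cmod (fourier g \<xi>)) * \<Phi> \<xi> \<partial>lborel)\<^sup>2"
    by (rule power_mono) simp
  also have "\<dots> \<le> (\<integral>\<^sup>+\<xi>. (ennreal (cmod (fourier g \<xi>)))\<^sup>2 \<partial>lborel) * (\<integral>\<^sup>+\<xi>. (\<Phi> \<xi>)\<^sup>2 \<partial>lborel)"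
    by (rule Cauchy_Schwarz_nn_integral) measurable
  also have "\<dots> \<le> ennreal ((sobolev_norm s f)\<^sup>2) * ennreal ?E"
  proof (rule mult_mono)
    have "(\<integral>\<^sup>+\<xi>. (ennreal (cmod (fourier g \<xi>)))\<^sup>2 \<partial>lborel) = (\<integral>\<^sup>+\<xi>. ennreal ((cmod (fourier g \<xi>))\<^sup>2) \<partial>lborel)"
      by (simp add: ennreal_power)
    also have "\<dots> \<le> ennreal (LINT x|lborel. (g x)\<^sup>2)"
      by (rule nn_integral_fourier_squared_le)
        (use weak(3,4) in \<open>auto simp: g_def indicator_def split: if_splits\<close>)
    also have "\<dots> \<le> ennreal ((sobolev_norm s f)\<^sup>2)"
      unfolding g_def using weak(5) by (rule ennreal_leI)
    finally show "(\<integral>\<^sup>+\<xi>. (ennreal (cmod (fourier g \<xi>)))\<^sup>2 \<partial>lborel) \<le> ennreal ((sobolev_norm s f)\<^sup>2)" .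
    have "(\<Phi> \<xi>)\<^sup>2 = ennreal (1 / \<bar>\<xi> $ j\<bar> ^ (2 * s)) * indicator (dominant_region j T) \<xi>" for \<xi>
      by (auto simp: \<Phi>_def indicator_def ennreal_power power_divide mult.commute[of s] simp flip: power_mult)
    then have "(\<integral>\<^sup>+\<xi>. (\<Phi> \<xi>)\<^sup>2 \<partial>lborel)
        = (\<integral>\<^sup>+\<xi>. ennreal (1 / \<bar>\<xi> $ j\<bar> ^ (2 * s)) * indicator (dominant_region j T) \<xi> \<partial>lborel)"
      by simp
    also have "\<dots> \<le> ennreal ?E"
      unfolding tail_const_def by (rule nn_integral_dominant_region_le[OF s T])
    finally show "(\<integral>\<^sup>+\<xi>. (\<Phi> \<xi>)\<^sup>2 \<partial>lborel) \<le> ennreal ?E" .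
  qed auto
  also have "\<dots> = ennreal ((sqrt ?E * sobolev_norm s f)\<^sup>2)"
    using E by (simp add: power_mult_distrib mult.commute flip: ennreal_mult)
  finally show "(\<integral>\<^sup>+\<xi>. ennreal (cmod (fourier f \<xi>)) * indicator (dominant_region j T) \<xi> \<partial>lborel)\<^sup>2
      \<le> ennreal ((sqrt ?E * sobolev_norm s f)\<^sup>2)" .
  show "0 \<le> sqrt ?E * sobolev_norm s f"
    using E by (intro mult_nonneg_nonneg sobolev_norm_nonneg) simp_all
qed

proposition nn_integral_fourier_hyperbolic_le:
  fixes f :: "real ^ 'd \<Rightarrow> real"
  assumes f: "f \<in> sobolev0_cube s" and s: "CARD('d) < 2 * s" and n: "n \<ge> 1"
  shows "(\<integral>\<^sup>+\<xi>. ennreal (cmod (fourier f \<xi>)) * indicator {\<xi>. real n \<le> \<bar>\<Prod>i\<in>UNIV. \<xi> $ i\<bar>} \<xi> \<partial>lborel)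
    \<le> ennreal (CARD('d) * sqrt (tail_const CARD('d) s) * real n powr (1 / 2 - s / CARD('d)) * sobolev_norm s f)"
proof -
  let ?d = "CARD('d)"
  \<comment> \<open>With \<open>T ^ ?d = real n\<close> the hyperbolic region is covered by the
    dominant regions of level \<open>T\<close>, one for each coordinate, which costs the factor
    \<open>CARD('d)\<close>.\<close>
  define T where "T = real n powr (1 / ?d)"
  have T: "T > 0"
    using n by (simp add: T_def)
  have Td: "T ^ ?d = real n"
    using n by (simp add: T_def powr_realpow[symmetric] powr_powr)
  have "T ^ (2 * s) = real n powr (2 * s / ?d)"
    using n by (simp add: T_def powr_realpow[symmetric] powr_powr)
  then have "T ^ ?d / T ^ (2 * s) = real n powr (1 - 2 * s / ?d)"
    using n by (simp add: Td powr_diff)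
  then have E: "sqrt (tail_const ?d s * (T ^ ?d / T ^ (2 * s))) = sqrt (tail_const ?d s) * real n powr (1 / 2 - s / ?d)"
    using n by (simp add: real_sqrt_mult powr_half_sqrt[symmetric] powr_powr diff_divide_distrib)
  have [measurable]: "f \<in> borel_measurable borel"
    using borel_measurable_integrable[OF sobolev0_cubeD(3)[OF f]] by simp
  have "ennreal (cmod (fourier f \<xi>)) * indicator {\<xi>. real n \<le> \<bar>\<Prod>i\<in>UNIV. \<xi> $ i\<bar>} \<xi>
      \<le> (\<Sum>j\<in>UNIV. ennreal (cmod (fourier f \<xi>)) * indicator (dominant_region j T) \<xi>)" for \<xi>
  proof (cases "real n \<le> \<bar>\<Prod>i\<in>UNIV. \<xi> $ i\<bar>")
    case True
    then obtain j where "\<xi> \<in> dominant_region j T"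
      using hyperbolic_region_cover[of T \<xi>] T Td by auto
    then have "ennreal (cmod (fourier f \<xi>)) \<le> ennreal (cmod (fourier f \<xi>)) * indicator (dominant_region j T) \<xi>"
      by simp
    also have "\<dots> \<le> (\<Sum>j\<in>UNIV. ennreal (cmod (fourier f \<xi>)) * indicator (dominant_region j T) \<xi>)"
      by (rule member_le_sum) auto
    finally show ?thesis
      using True by simp
  qed simp
  then have "(\<integral>\<^sup>+\<xi>. ennreal (cmod (fourier f \<xi>)) * indicator {\<xi>. real n \<le> \<bar>\<Prod>i\<in>UNIV. \<xi> $ i\<bar>} \<xi> \<partial>lborel)
      \<le> (\<integral>\<^sup>+\<xi>. (\<Sum>j\<in>UNIV. ennreal (cmod (fourier f \<xi>)) * indicator (dominant_region j T) \<xi>) \<partial>lborel)"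
    by (rule nn_integral_mono)
  also have "\<dots> = (\<Sum>j\<in>UNIV. \<integral>\<^sup>+\<xi>. ennreal (cmod (fourier f \<xi>)) * indicator (dominant_region j T) \<xi> \<partial>lborel)"
    by (rule nn_integral_sum) measurable
  also have "\<dots> \<le> (\<Sum>j\<in>(UNIV :: 'd set). ennreal (sqrt (tail_const ?d s) * real n powr (1 / 2 - s / ?d) * sobolev_norm s f))"
    using nn_integral_fourier_dominant_region_le[OF f s T] unfolding E by (intro sum_mono)
  also have "\<dots> = ennreal (\<Sum>j\<in>(UNIV :: 'd set). sqrt (tail_const ?d s) * real n powr (1 / 2 - s / ?d) * sobolev_norm s f)"
    using tail_const_pos[OF s] by (intro sum_ennreal mult_nonneg_nonneg sobolev_norm_nonneg) auto
  finally show ?thesis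
    by (simp add: mult.assoc)
qed

section \<open>Averaging over the dilations\<close>

lemma scaled_diag_mult_vec:
  "(r *\<^sub>R (diag_mat u ** B)) *v x = (\<chi> i. (r * (B *v x) $ i) * u $ i)"
  by (simp add: scaleR_diag_mat_mult diag_mat_mult_vec mult_ac)

lemma inj_int_vec: "inj int_vec"
  by (auto simp: inj_def int_vec_def vec_eq_iff)

lemma inj_frolov:
  assumes "invertible (B :: real ^ 'd ^ 'd)"
  shows "inj (\<lambda>m. B *v int_vec m)"
proof -
  have "inj ((*v) B)"
    using assms by (rule inj_matrix_vector_mult)
  then show ?thesis
    using inj_compose[OF _ inj_int_vec, of "(*v) B"] by (simp add: o_def)
qed

text \<open>For \<open>y = B *v int_vec m\<close> the relation between \<open>x\<close> and
  \<open>u\<close> gives \<open>x $ i / r = y $ i * u $ i\<close> and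
  \<open>x $ i / (r * b) = y $ i * (u $ i / b)\<close>. Since
  \<open>u $ i / b \<le> 1 \<le> u $ i\<close>, the point \<open>y\<close> lies in the box between
  \<open>q\<close> and \<open>p\<close>, whatever the sign of \<open>y $ i\<close>. That box has
  volume at most the product of the \<open>|x $ i| / r\<close>.\<close>

lemma frolov_count:
  fixes B :: "real ^ 'd ^ 'd"
  assumes B: "frolov_matrix B" and b: "b \<ge> 1" and r: "r > 0" and x: "r ^ CARD('d) \<le> \<bar>\<Prod>i\<in>UNIV. x $ i\<bar>"
    and M: "\<And>m. m \<in> M \<Longrightarrow> \<exists>u. (\<forall>i. 1 \<le> u $ i \<and> u $ i \<le> b) \<and> (\<forall>i. x $ i = r * (B *v int_vec m) $ i * u $ i)"
  shows "finite M" "real (card M) \<le> 2 * \<bar>\<Prod>i\<in>UNIV. x $ i\<bar> / r ^ CARD('d)"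
proof -
  define p where "p = (\<chi> i. x $ i / r)"
  define q where "q = (\<chi> i. x $ i / (r * b))"
  let ?L = "\<lambda>m. B *v int_vec m"
  have inj: "inj ?L"
    using B by (intro inj_frolov) (simp add: frolov_matrix_def)
  have fin: "finite (range ?L \<inter> box_between p q)"
    and card: "real (card (range ?L \<inter> box_between p q)) \<le> (\<Prod>i\<in>UNIV. \<bar>p $ i - q $ i\<bar>) + 1"
    using B by (auto simp: frolov_matrix_def)
  have sub: "?L ` M \<subseteq> range ?L \<inter> box_between p q"
  proof
    fix y
    assume "y \<in> ?L ` M"
    then obtain m where m: "m \<in> M" "y = ?L m"
      by auto
    then obtain u where u: "\<And>i. 1 \<le> u $ i \<and> u $ i \<le> b" "\<And>i. x $ i = r * y $ i * u $ i"
      using M by blast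
    have "min (p $ i) (q $ i) \<le> y $ i \<and> y $ i \<le> max (p $ i) (q $ i)" for i
    proof -
      have p: "p $ i = y $ i * u $ i" and q: "q $ i = y $ i * (u $ i / b)"
        using r u(2)[of i] by (simp_all add: p_def q_def)
      have ub: "1 \<le> u $ i" "u $ i / b \<le> 1"
        using u(1)[of i] b by auto
      show ?thesis
      proof (cases "y $ i \<ge> 0")
        case True
        then have "y $ i * (u $ i / b) \<le> y $ i * 1" "y $ i * 1 \<le> y $ i * u $ i"
          using ub by (intro mult_left_mono; simp)+
        then show ?thesis
          by (simp add: p q)
      next
        case False
        then have "y $ i * (u $ i / b) \<ge> y $ i * 1" "y $ i * 1 \<ge> y $ i * u $ i"
          using ub by (intro mult_left_mono_neg; simp)+
        then show ?thesis
          by (simp add: p q)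
      qed
    qed
    then show "y \<in> range ?L \<inter> box_between p q"
      using m by (auto simp: box_between_def)
  qed
  then have "finite (?L ` M)"
    using fin finite_subset by blast
  then show "finite M"
    using inj inj_on_subset[OF inj] by (auto dest: finite_imageD)
  have "card M = card (?L ` M)"
    using inj by (intro card_image[symmetric]) (rule inj_on_subset, auto)
  also have "\<dots> \<le> card (range ?L \<inter> box_between p q)"
    using fin sub by (rule card_mono)
  finally have "real (card M) \<le> (\<Prod>i\<in>UNIV. \<bar>p $ i - q $ i\<bar>) + 1"
    using card by linarith
  also have "(\<Prod>i\<in>UNIV. \<bar>p $ i - q $ i\<bar>) \<le> (\<Prod>i\<in>UNIV. \<bar>x $ i\<bar> / r)"
  proof (intro prod_mono conjI)
    fix i
    have "p $ i - q $ i = x $ i / r * (1 - 1 / b)"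
      using r b by (simp add: p_def q_def field_simps)
    then have "\<bar>p $ i - q $ i\<bar> = \<bar>x $ i\<bar> / r * (1 - 1 / b)"
      using r b by (simp add: abs_mult)
    also have "\<dots> \<le> \<bar>x $ i\<bar> / r"
      using r b by (intro mult_left_le) auto
    finally show "\<bar>p $ i - q $ i\<bar> \<le> \<bar>x $ i\<bar> / r" .
  qed simp
  also have "(\<Prod>i\<in>UNIV. \<bar>x $ i\<bar> / r) = \<bar>\<Prod>i\<in>UNIV. x $ i\<bar> / r ^ CARD('d)"
    by (simp add: prod_dividef abs_prod)
  \<comment> \<open>Outside the hyperbolic cross the volume bound is at least 1, so the additive 1
    of the Frolov count is absorbed by a factor 2.\<close>
  also have "1 \<le> \<bar>\<Prod>i\<in>UNIV. x $ i\<bar> / r ^ CARD('d)"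
    using x r by simp
  finally show "real (card M) \<le> 2 * \<bar>\<Prod>i\<in>UNIV. x $ i\<bar> / r ^ CARD('d)"
    by simp
qed

text \<open>For each \<open>m\<close> the substitution \<open>x $ i = y m i * u $ i\<close> turns
  the average over \<open>u\<close> into an integral over \<open>x\<close>. Coordinates
  \<open>u $ i \<ge> 1\<close> keep \<open>x\<close> in \<open>?H\<close>, because the lattice
  products are at least 1. The constant 4 is 2 from comparing the weights, by
  \<open>b ^ CARD('d) = 2\<close>, times 2 from the count.\<close>

proposition frolov_averaging:
  fixes B :: "real ^ 'd ^ 'd" and \<Phi> :: "real ^ 'd \<Rightarrow> ennreal"
  assumes B: "frolov_matrix B" and [measurable]: "\<Phi> \<in> borel_measurable borel"
    and b: "b \<ge> 1" "b ^ CARD('d) = 2" and r: "r > 0"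
  shows "(\<integral>\<^sup>+u. (\<integral>\<^sup>+m. \<Phi> ((r *\<^sub>R (diag_mat u ** B)) *v int_vec m) \<partial>count_space (UNIV - {0}))
        * indicator (cbox (\<chi> i. 1) (\<chi> i. b)) u \<partial>lborel)
    \<le> ennreal (4 / r ^ CARD('d)) * (\<integral>\<^sup>+x. \<Phi> x * indicator {x. r ^ CARD('d) \<le> \<bar>\<Prod>i\<in>UNIV. x $ i\<bar>} x \<partial>lborel)"
proof -
  let ?d = "CARD('d)"
  let ?C = "cbox (\<chi> i. 1) (\<chi> i. b) :: (real ^ 'd) set"
  let ?H = "{x :: real ^ 'd. r ^ ?d \<le> \<bar>\<Prod>i\<in>UNIV. x $ i\<bar>}"
  define y where "y = (\<lambda>m i. r * (B *v int_vec m) $ i)"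
  define q where "q = (\<lambda>m x. \<chi> i. x $ i / y m i)"
  have [measurable]: "q m \<in> borel_measurable borel" for m
    unfolding q_def by measurable
  have [measurable]: "?C \<in> sets borel" "?H \<in> sets borel"
    by measurable
  have meas_S: "(\<lambda>u. (r *\<^sub>R (diag_mat u ** B)) *v int_vec m) \<in> borel_measurable borel" for m
    unfolding scaled_diag_mult_vec by measurable
  have y_prod: "r ^ ?d \<le> (\<Prod>i\<in>UNIV. \<bar>y m i\<bar>)" if "m \<noteq> 0" for m
  proof -
    have "1 \<le> \<bar>\<Prod>i\<in>UNIV. (B *v int_vec m) $ i\<bar>"
      using B that by (simp add: frolov_matrix_def)
    then have "r ^ ?d * 1 \<le> r ^ ?d * \<bar>\<Prod>i\<in>UNIV. (B *v int_vec m) $ i\<bar>"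
      using r by (intro mult_left_mono) auto
    also have "\<dots> = (\<Prod>i\<in>UNIV. \<bar>y m i\<bar>)"
      using r by (simp add: y_def abs_mult prod.distrib abs_prod)
    finally show ?thesis by simp
  qed
  have y_pos: "(\<Prod>i\<in>UNIV. \<bar>y m i\<bar>) > 0" and y_nz: "y m i \<noteq> 0" if "m \<noteq> 0" for m i
  proof -
    show pos: "(\<Prod>i\<in>UNIV. \<bar>y m i\<bar>) > 0"
      using y_prod[OF that] r by (intro less_le_trans[OF _ y_prod[OF that]]) simp
    show "y m i \<noteq> 0"
      using pos by (metis UNIV_I abs_zero finite less_irrefl prod_zero_iff)
  qed
  \<comment> \<open>The exact weight \<open>1 / ?Y\<close> depends on \<open>m\<close>. Its majorant
    \<open>2 / |\<Prod>i\<in>UNIV. x $ i|\<close> does not and can be taken out of the sum over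
    \<open>m\<close>.\<close>
  have single: "(\<integral>\<^sup>+u. \<Phi> ((r *\<^sub>R (diag_mat u ** B)) *v int_vec m) * indicator ?C u \<partial>lborel)
      \<le> (\<integral>\<^sup>+x. ennreal (2 / \<bar>\<Prod>i\<in>UNIV. x $ i\<bar>) * \<Phi> x * indicator ?H x * indicator ?C (q m x) \<partial>lborel)"
    if m: "m \<noteq> 0" for m
  proof -
    let ?Y = "\<Prod>i\<in>UNIV. \<bar>y m i\<bar>"
    have "(\<integral>\<^sup>+x. \<Phi> x * indicator ?C (q m x) \<partial>lborel)
        = ennreal ?Y * (\<integral>\<^sup>+u. \<Phi> (\<chi> i. y m i * u $ i) * indicator ?C (q m (\<chi> i. y m i * u $ i)) \<partial>lborel)"
      by (rule nn_integral_lborel_diag) (use y_nz[OF m] in auto)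
    also have "(\<lambda>u. \<Phi> (\<chi> i. y m i * u $ i) * indicator ?C (q m (\<chi> i. y m i * u $ i)))
        = (\<lambda>u. \<Phi> ((r *\<^sub>R (diag_mat u ** B)) *v int_vec m) * indicator ?C u)"
      using y_nz[OF m] by (simp add: q_def scaled_diag_mult_vec y_def)
    finally have "ennreal (1 / ?Y) * (\<integral>\<^sup>+x. \<Phi> x * indicator ?C (q m x) \<partial>lborel)
        = ennreal (1 / ?Y) * ennreal ?Y * (\<integral>\<^sup>+u. \<Phi> ((r *\<^sub>R (diag_mat u ** B)) *v int_vec m) * indicator ?C u \<partial>lborel)"
      by (simp add: mult.assoc)
    also have "ennreal (1 / ?Y) * ennreal ?Y = 1"
      using y_pos[OF m] y_nz[OF m] by (simp flip: ennreal_mult)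
    finally have "(\<integral>\<^sup>+u. \<Phi> ((r *\<^sub>R (diag_mat u ** B)) *v int_vec m) * indicator ?C u \<partial>lborel)
        = (\<integral>\<^sup>+x. ennreal (1 / ?Y) * (\<Phi> x * indicator ?C (q m x)) \<partial>lborel)"
      by (simp add: nn_integral_cmult)
    also have "\<dots> \<le> (\<integral>\<^sup>+x. ennreal (2 / \<bar>\<Prod>i\<in>UNIV. x $ i\<bar>) * \<Phi> x * indicator ?H x * indicator ?C (q m x) \<partial>lborel)"
    proof (rule nn_integral_mono)
      fix x :: "real ^ 'd"
      show "ennreal (1 / ?Y) * (\<Phi> x * indicator ?C (q m x))
          \<le> ennreal (2 / \<bar>\<Prod>i\<in>UNIV. x $ i\<bar>) * \<Phi> x * indicator ?H x * indicator ?C (q m x)"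
      proof (cases "q m x \<in> ?C")
        case True
        then have u: "1 \<le> q m x $ i \<and> q m x $ i \<le> b" for i
          by (simp add: mem_box_cart)
        have "\<bar>\<Prod>i\<in>UNIV. x $ i\<bar> = (\<Prod>i\<in>UNIV. \<bar>y m i\<bar> * q m x $ i)"
        proof -
          have "\<bar>x $ i\<bar> = \<bar>y m i\<bar> * q m x $ i" for i
          proof -
            have "x $ i = y m i * q m x $ i"
              using y_nz[OF m] by (simp add: q_def)
            then show ?thesis
              using u[of i] by (simp add: abs_mult)
          qed
          then show ?thesis
            by (simp add: abs_prod)
        qed
        then have X: "\<bar>\<Prod>i\<in>UNIV. x $ i\<bar> = ?Y * (\<Prod>i\<in>UNIV. q m x $ i)"
          by (simp add: prod.distrib)
        have "(\<Prod>i\<in>UNIV. q m x $ i) \<le> (\<Prod>i\<in>(UNIV :: 'd set). b)"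
          using u by (intro prod_mono) (auto intro: order_trans[of 0 1])
        then have U2: "(\<Prod>i\<in>UNIV. q m x $ i) \<le> 2"
          using b by simp
        have U1: "1 \<le> (\<Prod>i\<in>UNIV. q m x $ i)"
          using u by (intro prod_ge_1) auto
        have le1: "?Y \<le> \<bar>\<Prod>i\<in>UNIV. x $ i\<bar>"
          unfolding X using U1 y_pos[OF m] by simp
        have le2: "\<bar>\<Prod>i\<in>UNIV. x $ i\<bar> \<le> 2 * ?Y"
          unfolding X using U2 y_pos[OF m] by (simp add: mult.commute)
        have "x \<in> ?H"
          using y_prod[OF m] le1 by simp
        moreover have "1 / ?Y \<le> 2 / \<bar>\<Prod>i\<in>UNIV. x $ i\<bar>"
        proof -
          have "1 / Y \<le> 2 / X" if "0 < Y" "Y \<le> X" "X \<le> 2 * Y" for X Y :: real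
            using that by (simp add: divide_le_eq le_divide_eq)
          from this[OF y_pos[OF m] le1 le2] show ?thesis .
        qed
        then have "ennreal (1 / ?Y) * \<Phi> x \<le> ennreal (2 / \<bar>\<Prod>i\<in>UNIV. x $ i\<bar>) * \<Phi> x"
          by (intro mult_right_mono ennreal_leI) auto
        ultimately show ?thesis
          using True by simp
      qed simp
    qed
    finally show ?thesis .
  qed
  \<comment> \<open>The only \<open>u\<close> that moves the frequency of \<open>m\<close> to
    \<open>x\<close> is \<open>q m x\<close>, so the integral counts the smeared boxes containing
    \<open>x\<close>.\<close>
  have count: "(\<integral>\<^sup>+m. indicator ?C (q m x) \<partial>count_space (UNIV - {0})) \<le> ennreal (2 * \<bar>\<Prod>i\<in>UNIV. x $ i\<bar> / r ^ ?d)"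
    if x: "x \<in> ?H" for x
  proof -
    define M where "M = {m. m \<noteq> 0 \<and> q m x \<in> ?C}"
    have ex: "\<exists>u. (\<forall>i. 1 \<le> u $ i \<and> u $ i \<le> b) \<and> (\<forall>i. x $ i = r * (B *v int_vec m) $ i * u $ i)" if "m \<in> M" for m
      using that y_nz[of m] by (intro exI[of _ "q m x"]) (auto simp: M_def mem_box_cart q_def y_def)
    have x': "r ^ ?d \<le> \<bar>\<Prod>i\<in>UNIV. x $ i\<bar>"
      using x by simp
    have M: "finite M" "real (card M) \<le> 2 * \<bar>\<Prod>i\<in>UNIV. x $ i\<bar> / r ^ ?d"
      by (rule frolov_count[OF B b(1) r x' ex], assumption)+
    have "(\<integral>\<^sup>+m. indicator ?C (q m x) \<partial>count_space (UNIV - {0})) = (\<integral>\<^sup>+m. indicator M m \<partial>count_space (UNIV - {0}))"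
      by (intro nn_integral_cong) (auto simp: M_def indicator_def)
    also have "\<dots> = emeasure (count_space (UNIV - {0})) M"
      by (intro nn_integral_indicator) (auto simp: M_def)
    also have "\<dots> = ennreal (real (card M))"
    proof (subst emeasure_count_space_finite)
      show "M \<subseteq> UNIV - {0}"
        by (auto simp: M_def)
    qed (use M(1) in \<open>simp_all add: ennreal_of_nat_eq_real_of_nat\<close>)
    also have "\<dots> \<le> ennreal (2 * \<bar>\<Prod>i\<in>UNIV. x $ i\<bar> / r ^ ?d)"
      using M(2) by (intro ennreal_leI)
    finally show ?thesis .
  qed
  have "(\<integral>\<^sup>+u. (\<integral>\<^sup>+m. \<Phi> ((r *\<^sub>R (diag_mat u ** B)) *v int_vec m) \<partial>count_space (UNIV - {0})) * indicator ?C u \<partial>lborel)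
      = (\<integral>\<^sup>+u. (\<integral>\<^sup>+m. \<Phi> ((r *\<^sub>R (diag_mat u ** B)) *v int_vec m) * indicator ?C u \<partial>count_space (UNIV - {0})) \<partial>lborel)"
    by (simp add: nn_integral_multc)
  also have "\<dots> = (\<integral>\<^sup>+m. (\<integral>\<^sup>+u. \<Phi> ((r *\<^sub>R (diag_mat u ** B)) *v int_vec m) * indicator ?C u \<partial>lborel) \<partial>count_space (UNIV - {0}))"
    by (intro nn_integral_count_space_nn_integral) (auto intro!: borel_measurable_times_ennreal measurable_compose[OF meas_S])
  also have "\<dots> \<le> (\<integral>\<^sup>+m. (\<integral>\<^sup>+x. ennreal (2 / \<bar>\<Prod>i\<in>UNIV. x $ i\<bar>) * \<Phi> x * indicator ?H x * indicator ?C (q m x) \<partial>lborel) \<partial>count_space (UNIV - {0}))"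
    by (intro nn_integral_mono single) auto
  also have "\<dots> = (\<integral>\<^sup>+x. (\<integral>\<^sup>+m. ennreal (2 / \<bar>\<Prod>i\<in>UNIV. x $ i\<bar>) * \<Phi> x * indicator ?H x * indicator ?C (q m x) \<partial>count_space (UNIV - {0})) \<partial>lborel)"
    by (intro nn_integral_count_space_nn_integral[symmetric]) auto
  also have "\<dots> = (\<integral>\<^sup>+x. ennreal (2 / \<bar>\<Prod>i\<in>UNIV. x $ i\<bar>) * \<Phi> x * indicator ?H x * (\<integral>\<^sup>+m. indicator ?C (q m x) \<partial>count_space (UNIV - {0})) \<partial>lborel)"
    by (simp add: nn_integral_cmult)
  also have "\<dots> \<le> (\<integral>\<^sup>+x. ennreal (4 / r ^ ?d) * (\<Phi> x * indicator ?H x) \<partial>lborel)"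
  proof (rule nn_integral_mono)
    fix x :: "real ^ 'd"
    show "ennreal (2 / \<bar>\<Prod>i\<in>UNIV. x $ i\<bar>) * \<Phi> x * indicator ?H x * (\<integral>\<^sup>+m. indicator ?C (q m x) \<partial>count_space (UNIV - {0}))
        \<le> ennreal (4 / r ^ ?d) * (\<Phi> x * indicator ?H x)"
    proof (cases "x \<in> ?H")
      case True
      let ?X = "\<bar>\<Prod>i\<in>UNIV. x $ i\<bar>"
      have "0 < r ^ ?d"
        using r by simp
      then have X: "?X > 0"
        using True by (simp del: abs_prod prod_zero_iff)
      have "ennreal (2 / ?X) * \<Phi> x * (\<integral>\<^sup>+m. indicator ?C (q m x) \<partial>count_space (UNIV - {0}))
          \<le> ennreal (2 / ?X) * \<Phi> x * ennreal (2 * ?X / r ^ ?d)"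
        by (intro mult_left_mono count True) simp
      also have "\<dots> = ennreal (2 / ?X) * ennreal (2 * ?X / r ^ ?d) * \<Phi> x"
        by (simp add: mult_ac)
      also have "ennreal (2 / ?X) * ennreal (2 * ?X / r ^ ?d) = ennreal (2 / ?X * (2 * ?X / r ^ ?d))"
        using r by (subst ennreal_mult) auto
      also have "2 / ?X * (2 * ?X / r ^ ?d) = 4 / r ^ ?d"
        using X by simp
      finally show ?thesis
        using True by simp
    qed simp
  qed
  also have "\<dots> = ennreal (4 / r ^ ?d) * (\<integral>\<^sup>+x. \<Phi> x * indicator ?H x \<partial>lborel)"
    by (simp add: nn_integral_cmult)
  finally show ?thesis .
qed

theorem theorem7:
  fixes s :: nat and B :: "real ^ 'd ^ 'd"
  assumes "real s > real CARD('d) / 2"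
    and "frolov_matrix B"
  shows "\<exists>c>0. \<forall>(M :: 'a measure) (U :: 'a \<Rightarrow> real ^ 'd).
    prob_space M \<longrightarrow> uniform_on_cube M U 1 (2 powr (1 / real CARD('d))) \<longrightarrow>
    (\<forall>(n :: nat) v. \<forall>f \<in> sobolev0_cube s. n \<ge> 1 \<longrightarrow>
       (let S = (\<lambda>u. (real n powr (1 / real CARD('d))) *\<^sub>R (diag_mat u ** B));
            err = (\<lambda>\<omega>. \<bar>quadrature (S (U \<omega>)) v f - (LINT x|lborel. f x)\<bar>)
        in integrable M err \<and>
           prob_space.expectation M err
             \<le> c * real n powr (- real s / real CARD('d) - 1 / 2) * sobolev_norm s f))"
proof -
  let ?d = "CARD('d)"
  have s: "?d < 2 * s"
    using assms(1) by (simp add: field_simps)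
  have detB: "det B \<noteq> 0"
    using assms(2) by (simp add: frolov_matrix_def invertible_det_nz)
  define b :: real where "b = 2 powr (1 / ?d)"
  have b: "b > 1" "b ^ ?d = 2"
    by (simp_all add: b_def powr_realpow[symmetric] powr_powr)
  let ?C = "cbox (\<chi> i. 1) (\<chi> i. b) :: (real ^ 'd) set"
  define V where "V = measure lborel ?C"
  have V: "V > 0"
  proof -
    have "emeasure lborel ?C = (\<Prod>i\<in>Basis. ((\<chi> i. b) - (\<chi> i. 1) :: real ^ 'd) \<bullet> i)"
      using b by (intro emeasure_lborel_cbox) (auto simp: Basis_vec_def inner_axis)
    also have "\<dots> = ennreal ((b - 1) ^ ?d)"
      by (simp add: prod_Basis_vec inner_axis)
    finally have "V = (b - 1) ^ ?d"
      using b by (simp add: V_def measure_def)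
    then show ?thesis
      using b by simp
  qed
  \<comment> \<open>Here 4 comes from the averaging, \<open>1 / V\<close> is the density of
    \<open>U\<close>, \<open>?d\<close> counts the dominant regions, and the root comes from
    Cauchy-Schwarz.\<close>
  define c where "c = 4 / V * (?d * sqrt (tail_const ?d s))"
  have c: "c > 0"
    using V tail_const_pos[OF s] by (simp add: c_def)
  show ?thesis
  proof (intro exI[of _ c] conjI allI impI ballI c)
    fix M :: "'a measure" and U :: "'a \<Rightarrow> real ^ 'd" and n :: nat and v :: "real ^ 'd" and f :: "real ^ 'd \<Rightarrow> real"
    assume M: "prob_space M" and U: "uniform_on_cube M U 1 (2 powr (1 / real ?d))"
      and f: "f \<in> sobolev0_cube s" and n: "n \<ge> 1"
    interpret prob_space M by (rule M)
    define r where "r = real n powr (1 / ?d)"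
    have r: "r > 0" "r ^ ?d = real n"
      using n by (simp_all add: r_def powr_realpow[symmetric] powr_powr)
    let ?I = "LINT x|lborel. f x"
    define h where "h = (\<lambda>u. \<bar>quadrature (r *\<^sub>R (diag_mat u ** B)) v f - ?I\<bar>)"
    have [measurable]: "f \<in> borel_measurable borel"
      using borel_measurable_integrable[OF sobolev0_cubeD(3)[OF f]] by simp
    have [measurable]: "h \<in> borel_measurable borel"
    proof -
      have [measurable]: "(\<lambda>w. quadrature (diag_mat w ** B) v f) \<in> borel_measurable borel"
        by (rule measurable_quadrature_diag[OF sobolev0_cubeD(1,2)[OF f] detB])
      show ?thesis
        unfolding h_def scaleR_diag_mat_mult by measurable
    qed
    \<comment> \<open>The density of \<open>U\<close> is put into \<open>\<Phi>\<close>, since the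
      averaging bound is stated for Lebesgue measure.\<close>
    define \<Phi> where "\<Phi> = (\<lambda>x. ennreal (1 / V) * ennreal (cmod (fourier f x)))"
    have [measurable]: "\<Phi> \<in> borel_measurable borel"
      unfolding \<Phi>_def by measurable
    have dist: "distributed M lborel U (\<lambda>x. indicator ?C x / V)"
      using U by (simp add: uniform_on_cube_def b_def V_def)
    have [measurable]: "U \<in> borel_measurable M"
      using distributed_measurable[OF dist] by simp
    let ?N = "sobolev_norm s f"
    let ?R = "c * real n powr (- real s / real ?d - 1 / 2) * ?N"
    have "(\<integral>\<^sup>+\<omega>. ennreal (h (U \<omega>)) \<partial>M) = (\<integral>\<^sup>+u. ennreal (indicator ?C u / V) * ennreal (h u) \<partial>lborel)"
      by (rule distributed_nn_integral[OF dist, symmetric]) measurable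
    also have "\<dots> \<le> (\<integral>\<^sup>+u. (\<integral>\<^sup>+m. \<Phi> ((r *\<^sub>R (diag_mat u ** B)) *v int_vec m) \<partial>count_space (UNIV - {0}))
        * indicator ?C u \<partial>lborel)"
    proof (rule nn_integral_mono)
      fix u :: "real ^ 'd"
      show "ennreal (indicator ?C u / V) * ennreal (h u)
        \<le> (\<integral>\<^sup>+m. \<Phi> ((r *\<^sub>R (diag_mat u ** B)) *v int_vec m) \<partial>count_space (UNIV - {0})) * indicator ?C u"
      proof (cases "u \<in> ?C")
        case True
        then have "1 \<le> u $ i" for i
          by (simp add: mem_box_cart)
        then have "u $ i \<noteq> 0" for i
          by (metis not_one_le_zero)
        then have "det (r *\<^sub>R (diag_mat u ** B)) \<noteq> 0"
          using r detB by (simp add: scaleR_diag_mat_mult det_diag_mat_mult)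
        then have "ennreal (h u)
            \<le> (\<integral>\<^sup>+m. ennreal (cmod (fourier f ((r *\<^sub>R (diag_mat u ** B)) *v int_vec m))) \<partial>count_space (UNIV - {0}))"
          unfolding h_def by (intro quadrature_error_le sobolev0_cubeD(1)[OF f]) (rule sobolev0_cubeD(2)[OF f])
        then have "ennreal (1 / V) * ennreal (h u)
            \<le> (\<integral>\<^sup>+m. \<Phi> ((r *\<^sub>R (diag_mat u ** B)) *v int_vec m) \<partial>count_space (UNIV - {0}))"
          by (simp add: \<Phi>_def nn_integral_cmult mult_left_mono)
        then show ?thesis
          using True by simp
      qed simp
    qed
    also have "\<dots> \<le> ennreal (4 / real n) *
        (\<integral>\<^sup>+x. \<Phi> x * indicator {x. real n \<le> \<bar>\<Prod>i\<in>UNIV. x $ i\<bar>} x \<partial>lborel)"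
      using frolov_averaging[OF assms(2) _ _ b(2) r(1), of \<Phi>] b(1) unfolding r(2) by simp
    also have "\<dots> = ennreal (1 / V) * (ennreal (4 / real n) *
        (\<integral>\<^sup>+x. ennreal (cmod (fourier f x)) * indicator {x. real n \<le> \<bar>\<Prod>i\<in>UNIV. x $ i\<bar>} x \<partial>lborel))"
      unfolding \<Phi>_def by (simp add: nn_integral_cmult mult.assoc mult.left_commute)
    also have "\<dots> \<le> ennreal (1 / V) * (ennreal (4 / real n) *
        ennreal (?d * sqrt (tail_const ?d s) * real n powr (1 / 2 - s / ?d) * ?N))"
      by (intro mult_left_mono nn_integral_fourier_hyperbolic_le f s n) auto
    also have "\<dots> = ennreal (1 / V * (4 / real n * (?d * sqrt (tail_const ?d s) * real n powr (1 / 2 - s / ?d) * ?N)))"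
      using V tail_const_pos[OF s] sobolev_norm_nonneg[of s f]
      by (subst ennreal_mult[symmetric], simp, simp, subst ennreal_mult[symmetric]) auto
    also have "1 / V * (4 / real n * (?d * sqrt (tail_const ?d s) * real n powr (1 / 2 - s / ?d) * ?N)) = ?R"
    proof -
      have "real n powr (- real s / real ?d - 1 / 2) = real n powr ((1 / 2 - s / ?d) + - 1)"
        by (rule arg_cong[where f = "\<lambda>t. real n powr t"]) simp
      also have "\<dots> = real n powr (1 / 2 - s / ?d) / real n"
        using n by (subst powr_add) (simp add: powr_minus_divide)
      finally show ?thesis
        by (simp add: c_def)
    qed
    finally have le: "(\<integral>\<^sup>+\<omega>. ennreal (h (U \<omega>)) \<partial>M) \<le> ennreal ?R" .
    \<comment> \<open>Only here does the error become known to be integrable: its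
      \<open>ennreal\<close> integral has a finite bound, and the pointwise estimates did not
      presuppose convergence.\<close>
    have int: "integrable M (\<lambda>\<omega>. h (U \<omega>))"
    proof (rule integrableI_bounded)
      show "(\<integral>\<^sup>+\<omega>. ennreal (norm (h (U \<omega>))) \<partial>M) < \<infinity>"
        using le by (simp add: h_def le_less_trans[OF _ ennreal_less_top])
    qed measurable
    have "expectation (\<lambda>\<omega>. h (U \<omega>)) \<le> ?R"
    proof -
      have "ennreal (expectation (\<lambda>\<omega>. h (U \<omega>))) = (\<integral>\<^sup>+\<omega>. ennreal (h (U \<omega>)) \<partial>M)"
        by (rule nn_integral_eq_integral[symmetric, OF int]) (simp add: h_def)
      with le have "ennreal (expectation (\<lambda>\<omega>. h (U \<omega>))) \<le> ennreal ?R"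
        by simp
      moreover have "?R \<ge> 0"
        using c sobolev_norm_nonneg[of s f] by simp
      ultimately show ?thesis
        by (simp add: ennreal_le_iff)
    qed
    with int show "let S = (\<lambda>u. (real n powr (1 / real CARD('d))) *\<^sub>R (diag_mat u ** B));
            err = (\<lambda>\<omega>. \<bar>quadrature (S (U \<omega>)) v f - (LINT x|lborel. f x)\<bar>)
        in integrable M err \<and> prob_space.expectation M err
             \<le> c * real n powr (- real s / real CARD('d) - 1 / 2) * sobolev_norm s f"
      by (simp add: h_def r_def Let_def)
  qed
qed

end
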